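(* Let $M$ be an irreducible representation of $H_\beta$. Then $M$ is isomorphic to one of the following types: $V_I(\gamma_1,\gamma_2,\gamma_3;i)$, $V_{II}(\gamma_1,\gamma_2,\gamma_3;i)$, $V_0(\gamma_1,\gamma_2,\gamma_3;i)$, and $V_r(\gamma_1,\gamma_2,\gamma_3;i)$.
   Context: Let $\mathbf{K}$ be an algebraically closed field of characteristic zero, $\mathbf{K}^*=\mathbf{K}\setminus\{0\}$, $n\ge 2$, $q\in\mathbf{K}$ a primitive $n$-th root of unity, $n_1$ an integer with $1\le n_1\le n$ and $2\nmid (n,n_1)$. For $\beta=(\beta_1,\beta_2,\beta_3)\in\mathbf{K}^3$, $H_\beta$ is the $\mathbf{K}$-algebra generated by invertible $a,b,c$ and by $x,y$ with relations $ab=ba$, $ac=ca$, $bc=cb$, $xa=qax$, $ya=q^{-1}ay$, $bx=xb$, $cx=xc$, $by=yb$, $cy=yc$, $yx-q^{-n_1}xy=\beta_3(a^{2n_1}-bc)$, $x^n=\beta_1(a^{nn_1}-b^n)$, $y^n=\beta_2(a^{nn_1}-c^n)$. Let $\gamma_1,\gamma_2,\gamma_3\in\mathbf{K}^*$ and $0\le i\le n-1$. Fix an $n$-th root $\sqrt[n]{\gamma_1}$ and write $\gamma_1^{2n_1/n}=(\sqrt[n]{\gamma_1})^{2n_1}$. In all modules below $b,c$ act as the scalars $\gamma_2,\gamma_3$. (I) If $\beta_1(\gamma_1^{n_1}-\gamma_2^n)\neq0$: $V_I(\gamma_1,\gamma_2,\gamma_3;i)$ has basis $m_0,\dots,m_{n-1}$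 with $am_j=\sqrt[n]{\gamma_1}q^{i-j}m_j$; $xm_j=m_{j+1}$ ($0\le j\le n-2$), $xm_{n-1}=(\gamma_1^{n_1}-\gamma_2^n)\beta_1m_0$; $ym_j=k_{n-j+1}m_{j-1}$ ($1\le j\le n-1$), $ym_0=k_1m_{n-1}$, where $k_l=q^{(l-1)n_1}\beta_1(\gamma_1^{n_1}-\gamma_2^n)k_1+\sum_{j=0}^{n-l}q^{-jn_1}\beta_3(\gamma_1^{2n_1/n}q^{(2i+l)n_1}-\gamma_2\gamma_3)$ for $2\le l\le n$, and $k_1$ is chosen such that $k_1k_2\cdots k_n=(\gamma_1^{n_1}-\gamma_3^n)\beta_2$. (II) If $\beta_1(\gamma_1^{n_1}-\gamma_2^n)=0$ and $\beta_2(\gamma_1^{n_1}-\gamma_3^n)\ne0$: $V_{II}(\gamma_1,\gamma_2,\gamma_3;i)$ has basis $m_0,\dots,m_{n-1}$ with $am_j=\sqrt[n]{\gamma_1}q^{i+j}m_j$; $ym_j=m_{j+1}$ ($0\le j\le n-2$), $ym_{n-1}=(\gamma_1^{n_1}-\gamma_3^n)\beta_2m_0$; $xm_j=k_jm_{j-1}$ ($1\le j\le n-1$), $xm_0=k_nm_{n-1}$, where $k_l=q^{ln_1}\bigl(\beta_2(\gamma_1^{n_1}-\gamma_3^n)k_n-\sum_{j=0}^{l-1}q^{-jn_1}\beta_3(\gamma_1^{2n_1/n}q^{(2i+l-1)n_1}-\gamma_2\gamma_3)\bigr)$ for $1\le l\le n-1$, and $k_n$ is chosen such that $k_1\cdots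 k_n=(\gamma_1^{n_1}-\gamma_2^n)\beta_1$. (0) If $\beta_1(\gamma_1^{n_1}-\gamma_2^n)=\beta_2(\gamma_1^{n_1}-\gamma_3^n)=\beta_3(\gamma_1^{2n_1/n}q^{2n_1i}-\gamma_2\gamma_3)=0$: $V_0(\gamma_1,\gamma_2,\gamma_3;i)=\mathbf{K}$ with $a\cdot1=\sqrt[n]{\gamma_1}q^i$, $x\cdot1=y\cdot1=0$. (r) Let $t$ be the order of $q^{n_1}$. If $\beta_1(\gamma_1^{n_1}-\gamma_2^n)=\beta_2(\gamma_1^{n_1}-\gamma_3^n)=0$ and $\beta_3(\gamma_1^{2n_1/n}q^{2n_1i}-\gamma_2\gamma_3)\ne0$, let $r$ be the minimal positive integer with $q^{(2i-r+1)n_1}=\gamma_1^{-2n_1/n}\gamma_2\gamma_3$ if such an integer exists, and $r=t$ otherwise. $V_r(\gamma_1,\gamma_2,\gamma_3;i)$ has basis $m_0,\dots,m_{r-1}$ with $am_j=\sqrt[n]{\gamma_1}q^{i-j}m_j$; $xm_j=m_{j+1}$ ($0\le j\le r-2$), $xm_{r-1}=0$; $ym_0=0$, $ym_l=k_lm_{l-1}$ with $k_l=\sum_{j=0}^{l-1}q^{-jn_1}\beta_3(q^{(2i-l+1)n_1}\gamma_1^{2n_1/n}-\gamma_2\gamma_3)$ for $1\le l\le r-1$. *)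

theory Defs
  imports
    "HOL-Library.Poly_Mapping"
    "HOL-Library.Function_Algebras"
    "HOL-Algebra.QuotRing"
    "HOL-Algebra.Algebraic_Closure_Type"
begin

definition primitive_root :: "nat \<Rightarrow> 'k::field \<Rightarrow> bool" where
  "primitive_root n q \<longleftrightarrow> n > 0 \<and> q ^ n = 1 \<and> (\<forall>m. 0 < m \<and> m < n \<longrightarrow> q ^ m \<noteq> 1)"

section \<open>Modules over an algebra\<close>

text \<open>
  A left module over the associative unital algebra \<open>A\<close> with structure map
  \<open>\<iota> : K \<rightarrow> A\<close>. The underlying vector space is a subspace \<open>V\<close> of the type \<open>'v\<close>;
  values of \<open>act\<close> outside of \<open>carrier A\<close> and \<open>V\<close> are irrelevant.
\<close>

locale left_module = vector_space scale
  for scale :: "'k::field \<Rightarrow> 'v::ab_group_add \<Rightarrow> 'v" +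
  fixes A :: "'h ring" and \<iota> :: "'k \<Rightarrow> 'h" and V :: "'v set" and act :: "'h \<Rightarrow> 'v \<Rightarrow> 'v"
  assumes subspace_V: "subspace V"
    and act_closed: "\<lbrakk>h \<in> carrier A; v \<in> V\<rbrakk> \<Longrightarrow> act h v \<in> V"
    and act_add: "\<lbrakk>h \<in> carrier A; v \<in> V; w \<in> V\<rbrakk> \<Longrightarrow> act h (v + w) = act h v + act h w"
    and act_scale: "\<lbrakk>h \<in> carrier A; v \<in> V\<rbrakk> \<Longrightarrow> act h (scale c v) = scale c (act h v)"
    and add_act: "\<lbrakk>h \<in> carrier A; h' \<in> carrier A; v \<in> V\<rbrakk>
      \<Longrightarrow> act (h \<oplus>\<^bsub>A\<^esub> h') v = act h v + act h' v"
    and mult_act: "\<lbrakk>h \<in> carrier A; h' \<in> carrier A; v \<in> V\<rbrakk>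
      \<Longrightarrow> act (h \<otimes>\<^bsub>A\<^esub> h') v = act h (act h' v)"
    and one_act: "v \<in> V \<Longrightarrow> act \<one>\<^bsub>A\<^esub> v = v"
    and scalar_act: "v \<in> V \<Longrightarrow> act (\<iota> c) v = scale c v"
begin

definition submodule :: "'v set \<Rightarrow> bool" where
  "submodule U \<longleftrightarrow> subspace U \<and> U \<subseteq> V \<and> (\<forall>h\<in>carrier A. \<forall>u\<in>U. act h u \<in> U)"

end

locale irreducible_left_module = left_module +
  assumes nontrivial: "V \<noteq> {0}"
    and irreducible: "submodule U \<Longrightarrow> U = {0} \<or> U = V"

definition module_isomorphic ::
    "'h ring \<Rightarrow> ('k::field \<Rightarrow> 'v::ab_group_add \<Rightarrow> 'v) \<Rightarrow> 'v set \<Rightarrow> ('h \<Rightarrow> 'v \<Rightarrow> 'v)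
      \<Rightarrow> ('k \<Rightarrow> 'w::ab_group_add \<Rightarrow> 'w) \<Rightarrow> 'w set \<Rightarrow> ('h \<Rightarrow> 'w \<Rightarrow> 'w) \<Rightarrow> bool" where
  "module_isomorphic A scale V act scale' V' act' \<longleftrightarrow>
    (\<exists>f. bij_betw f V V'
       \<and> (\<forall>v\<in>V. \<forall>w\<in>V. f (v + w) = f v + f w)
       \<and> (\<forall>c. \<forall>v\<in>V. f (scale c v) = scale' c (f v))
       \<and> (\<forall>h\<in>carrier A. \<forall>v\<in>V. f (act h v) = act' h (f v)))"

text \<open>The coordinate space \<open>K\<^sup>d\<close> inside \<open>nat \<Rightarrow> K\<close>, with standard basis
  \<open>basis_vec 0, \<dots>, basis_vec (d - 1)\<close>.\<close>

definition coords :: "nat \<Rightarrow> (nat \<Rightarrow> 'k::field) set" where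
  "coords d = {v. \<forall>j\<ge>d. v j = 0}"

definition coord_scale :: "'k::field \<Rightarrow> (nat \<Rightarrow> 'k) \<Rightarrow> (nat \<Rightarrow> 'k)" (infixr \<open>*c\<close> 75) where
  "c *c v = (\<lambda>j. c * v j)"

definition basis_vec :: "nat \<Rightarrow> (nat \<Rightarrow> 'k::field)" where
  "basis_vec j = (\<lambda>l. if l = j then 1 else 0)"

section \<open>The free algebra on eight generators\<close>

text \<open>The primed generators become the inverses of \<open>a\<close>, \<open>b\<close>, \<open>c\<close>.\<close>

datatype generator = Ga | Ga' | Gb | Gb' | Gc | Gc' | Gx | Gy

text \<open>The free monoid, written additively so that finitely supported functions on it, with the convolution
  product, form the free algebra.\<close>

datatype word = Word (letters: "generator list")

instantiation word :: monoid_add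
begin

definition zero_word :: word where "0 = Word []"

definition plus_word :: "word \<Rightarrow> word \<Rightarrow> word" where
  "u + v = Word (letters u @ letters v)"

instance
  by standard (simp_all add: zero_word_def plus_word_def)

end

definition var :: "generator \<Rightarrow> (word \<Rightarrow>\<^sub>0 'k::field)" where
  "var g = Poly_Mapping.single (Word [g]) 1"

definition const :: "'k::field \<Rightarrow> (word \<Rightarrow>\<^sub>0 'k)" where
  "const s = Poly_Mapping.single 0 s"

section \<open>The algebra \<open>H\<^sub>\<beta>\<close> and its modules\<close>

locale H_beta =
  fixes n n\<^sub>1 :: nat and q \<beta>\<^sub>1 \<beta>\<^sub>2 \<beta>\<^sub>3 :: "'k::field"
begin

definition relators :: "(word \<Rightarrow>\<^sub>0 'k) set" where
  "relators =
    (let a = var Ga; a' = var Ga'; b = var Gb; b' = var Gb'; c = var Gc; c' = var Gc';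
         x = var Gx; y = var Gy
     in {a * a' - 1, a' * a - 1, b * b' - 1, b' * b - 1, c * c' - 1, c' * c - 1,
         a * b - b * a, a * c - c * a, b * c - c * b,
         x * a - const q * a * x, y * a - const (inverse q) * a * y,
         b * x - x * b, c * x - x * c, b * y - y * b, c * y - y * c,
         y * x - const (inverse q ^ n\<^sub>1) * x * y - const \<beta>\<^sub>3 * (a ^ (2 * n\<^sub>1) - b * c),
         x ^ n - const \<beta>\<^sub>1 * (a ^ (n * n\<^sub>1) - b ^ n),
         y ^ n - const \<beta>\<^sub>2 * (a ^ (n * n\<^sub>1) - c ^ n)})"

text \<open>\<^const>\<open>genideal\<close> is the generated two-sided ideal.\<close>

definition relation_ideal :: "(word \<Rightarrow>\<^sub>0 'k) set" where
  "relation_ideal = Idl\<^bsub>ring_of_type_algebra\<^esub> relators"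

definition H :: "(word \<Rightarrow>\<^sub>0 'k) set ring" where
  "H = ring_of_type_algebra Quot relation_ideal"

definition cls :: "(word \<Rightarrow>\<^sub>0 'k) \<Rightarrow> (word \<Rightarrow>\<^sub>0 'k) set" where
  "cls p = relation_ideal +>\<^bsub>ring_of_type_algebra\<^esub> p"

definition scalar :: "'k \<Rightarrow> (word \<Rightarrow>\<^sub>0 'k) set" where
  "scalar s = cls (const s)"

abbreviation "a \<equiv> cls (var Ga)"
abbreviation "b \<equiv> cls (var Gb)"
abbreviation "c \<equiv> cls (var Gc)"
abbreviation "x \<equiv> cls (var Gx)"
abbreviation "y \<equiv> cls (var Gy)"

text \<open>
  The predicates below say that the subspace \<open>V\<close> of \<open>nat \<Rightarrow> K\<close> with the action \<open>act\<close> is the module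
  named, written in coordinates: \<open>V\<close> is \<open>K\<^sup>d\<close> and the basis vector \<open>m\<^sub>j\<close> is \<^term>\<open>basis_vec j\<close>.
  Throughout, \<open>\<rho>\<close> is the chosen \<open>n\<close>-th root of \<open>\<gamma>\<^sub>1\<close>, so that \<open>\<gamma>\<^sub>1\<close> to the power \<open>2n\<^sub>1/n\<close>
  is \<open>\<rho> ^ (2 * n\<^sub>1)\<close>. They are predicates, not functions, because \<open>k\<^sub>1\<close> in the first family and
  \<open>k\<^sub>n\<close> in the second can be any element satisfying the stated product condition.
\<close>

definition k_I :: "'k \<Rightarrow> 'k \<Rightarrow> 'k \<Rightarrow> 'k \<Rightarrow> nat \<Rightarrow> 'k \<Rightarrow> nat \<Rightarrow> 'k" where
  "k_I \<rho> \<gamma>\<^sub>1 \<gamma>\<^sub>2 \<gamma>\<^sub>3 i k\<^sub>1 l =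
    (if l = 1 then k\<^sub>1
     else q ^ ((l - 1) * n\<^sub>1) * \<beta>\<^sub>1 * (\<gamma>\<^sub>1 ^ n\<^sub>1 - \<gamma>\<^sub>2 ^ n) * k\<^sub>1
        + (\<Sum>j = 0..n - l. q powi (- int (j * n\<^sub>1)) * \<beta>\<^sub>3
              * (\<rho> ^ (2 * n\<^sub>1) * q ^ ((2 * i + l) * n\<^sub>1) - \<gamma>\<^sub>2 * \<gamma>\<^sub>3)))"

definition is_V_I ::
  "'k \<Rightarrow> 'k \<Rightarrow> 'k \<Rightarrow> 'k \<Rightarrow> nat \<Rightarrow> (nat \<Rightarrow> 'k) set \<Rightarrow> ((word \<Rightarrow>\<^sub>0 'k) set \<Rightarrow> (nat \<Rightarrow> 'k) \<Rightarrow> (nat \<Rightarrow> 'k)) \<Rightarrow> bool"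
where
  "is_V_I \<rho> \<gamma>\<^sub>1 \<gamma>\<^sub>2 \<gamma>\<^sub>3 i V act \<longleftrightarrow>
    \<beta>\<^sub>1 * (\<gamma>\<^sub>1 ^ n\<^sub>1 - \<gamma>\<^sub>2 ^ n) \<noteq> 0 \<and>
    V = coords n \<and> left_module (*c) H scalar V act \<and>
    (\<forall>v\<in>V. act b v = \<gamma>\<^sub>2 *c v) \<and> (\<forall>v\<in>V. act c v = \<gamma>\<^sub>3 *c v) \<and>
    (\<exists>k\<^sub>1. let k = k_I \<rho> \<gamma>\<^sub>1 \<gamma>\<^sub>2 \<gamma>\<^sub>3 i k\<^sub>1 in
       (\<Prod>l = 1..n. k l) = (\<gamma>\<^sub>1 ^ n\<^sub>1 - \<gamma>\<^sub>3 ^ n) * \<beta>\<^sub>2 \<and>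
       (\<forall>j<n. act a (basis_vec j) = (\<rho> * q powi (int i - int j)) *c basis_vec j) \<and>
       (\<forall>j<n - 1. act x (basis_vec j) = basis_vec (j + 1)) \<and>
       act x (basis_vec (n - 1)) = ((\<gamma>\<^sub>1 ^ n\<^sub>1 - \<gamma>\<^sub>2 ^ n) * \<beta>\<^sub>1) *c basis_vec 0 \<and>
       (\<forall>j\<in>{1..n - 1}. act y (basis_vec j) = k (n - j + 1) *c basis_vec (j - 1)) \<and>
       act y (basis_vec 0) = k 1 *c basis_vec (n - 1))"

definition k_II :: "'k \<Rightarrow> 'k \<Rightarrow> 'k \<Rightarrow> 'k \<Rightarrow> nat \<Rightarrow> 'k \<Rightarrow> nat \<Rightarrow> 'k" where
  "k_II \<rho> \<gamma>\<^sub>1 \<gamma>\<^sub>2 \<gamma>\<^sub>3 i k\<^sub>n l =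
    (if l = n then k\<^sub>n
     else q ^ (l * n\<^sub>1) * (\<beta>\<^sub>2 * (\<gamma>\<^sub>1 ^ n\<^sub>1 - \<gamma>\<^sub>3 ^ n) * k\<^sub>n
        - (\<Sum>j = 0..l - 1. q powi (- int (j * n\<^sub>1)) * \<beta>\<^sub>3
              * (\<rho> ^ (2 * n\<^sub>1) * q ^ ((2 * i + l - 1) * n\<^sub>1) - \<gamma>\<^sub>2 * \<gamma>\<^sub>3))))"

definition is_V_II ::
  "'k \<Rightarrow> 'k \<Rightarrow> 'k \<Rightarrow> 'k \<Rightarrow> nat \<Rightarrow> (nat \<Rightarrow> 'k) set \<Rightarrow> ((word \<Rightarrow>\<^sub>0 'k) set \<Rightarrow> (nat \<Rightarrow> 'k) \<Rightarrow> (nat \<Rightarrow> 'k)) \<Rightarrow> bool"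
where
  "is_V_II \<rho> \<gamma>\<^sub>1 \<gamma>\<^sub>2 \<gamma>\<^sub>3 i V act \<longleftrightarrow>
    \<beta>\<^sub>1 * (\<gamma>\<^sub>1 ^ n\<^sub>1 - \<gamma>\<^sub>2 ^ n) = 0 \<and> \<beta>\<^sub>2 * (\<gamma>\<^sub>1 ^ n\<^sub>1 - \<gamma>\<^sub>3 ^ n) \<noteq> 0 \<and>
    V = coords n \<and> left_module (*c) H scalar V act \<and>
    (\<forall>v\<in>V. act b v = \<gamma>\<^sub>2 *c v) \<and> (\<forall>v\<in>V. act c v = \<gamma>\<^sub>3 *c v) \<and>
    (\<exists>k\<^sub>n. let k = k_II \<rho> \<gamma>\<^sub>1 \<gamma>\<^sub>2 \<gamma>\<^sub>3 i k\<^sub>n in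
       (\<Prod>l = 1..n. k l) = (\<gamma>\<^sub>1 ^ n\<^sub>1 - \<gamma>\<^sub>2 ^ n) * \<beta>\<^sub>1 \<and>
       (\<forall>j<n. act a (basis_vec j) = (\<rho> * q ^ (i + j)) *c basis_vec j) \<and>
       (\<forall>j<n - 1. act y (basis_vec j) = basis_vec (j + 1)) \<and>
       act y (basis_vec (n - 1)) = ((\<gamma>\<^sub>1 ^ n\<^sub>1 - \<gamma>\<^sub>3 ^ n) * \<beta>\<^sub>2) *c basis_vec 0 \<and>
       (\<forall>j\<in>{1..n - 1}. act x (basis_vec j) = k j *c basis_vec (j - 1)) \<and>
       act x (basis_vec 0) = k n *c basis_vec (n - 1))"

definition is_V_0 ::
  "'k \<Rightarrow> 'k \<Rightarrow> 'k \<Rightarrow> 'k \<Rightarrow> nat \<Rightarrow> (nat \<Rightarrow> 'k) set \<Rightarrow> ((word \<Rightarrow>\<^sub>0 'k) set \<Rightarrow> (nat \<Rightarrow> 'k) \<Rightarrow> (nat \<Rightarrow> 'k)) \<Rightarrow> bool"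
where
  "is_V_0 \<rho> \<gamma>\<^sub>1 \<gamma>\<^sub>2 \<gamma>\<^sub>3 i V act \<longleftrightarrow>
    \<beta>\<^sub>1 * (\<gamma>\<^sub>1 ^ n\<^sub>1 - \<gamma>\<^sub>2 ^ n) = 0 \<and> \<beta>\<^sub>2 * (\<gamma>\<^sub>1 ^ n\<^sub>1 - \<gamma>\<^sub>3 ^ n) = 0 \<and>
    \<beta>\<^sub>3 * (\<rho> ^ (2 * n\<^sub>1) * q ^ (2 * n\<^sub>1 * i) - \<gamma>\<^sub>2 * \<gamma>\<^sub>3) = 0 \<and>
    V = coords 1 \<and> left_module (*c) H scalar V act \<and>
    (\<forall>v\<in>V. act b v = \<gamma>\<^sub>2 *c v) \<and> (\<forall>v\<in>V. act c v = \<gamma>\<^sub>3 *c v) \<and>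
    act a (basis_vec 0) = (\<rho> * q ^ i) *c basis_vec 0 \<and> act x (basis_vec 0) = 0 \<and> act y (basis_vec 0) = 0"

definition t :: nat where
  "t = (LEAST s. s > 0 \<and> (q ^ n\<^sub>1) ^ s = 1)"

definition r :: "'k \<Rightarrow> 'k \<Rightarrow> 'k \<Rightarrow> nat \<Rightarrow> nat" where
  "r \<rho> \<gamma>\<^sub>2 \<gamma>\<^sub>3 i =
    (let P = (\<lambda>s. s > 0 \<and>
       q powi ((2 * int i - int s + 1) * int n\<^sub>1) = inverse (\<rho> ^ (2 * n\<^sub>1)) * \<gamma>\<^sub>2 * \<gamma>\<^sub>3)
     in if \<exists>s. P s then (LEAST s. P s) else t)"

definition k_r :: "'k \<Rightarrow> 'k \<Rightarrow> 'k \<Rightarrow> nat \<Rightarrow> nat \<Rightarrow> 'k" where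
  "k_r \<rho> \<gamma>\<^sub>2 \<gamma>\<^sub>3 i l =
    (\<Sum>j = 0..l - 1. q powi (- int (j * n\<^sub>1)) * \<beta>\<^sub>3
       * (q powi ((2 * int i - int l + 1) * int n\<^sub>1) * \<rho> ^ (2 * n\<^sub>1) - \<gamma>\<^sub>2 * \<gamma>\<^sub>3))"

definition is_V_r ::
  "'k \<Rightarrow> 'k \<Rightarrow> 'k \<Rightarrow> 'k \<Rightarrow> nat \<Rightarrow> (nat \<Rightarrow> 'k) set \<Rightarrow> ((word \<Rightarrow>\<^sub>0 'k) set \<Rightarrow> (nat \<Rightarrow> 'k) \<Rightarrow> (nat \<Rightarrow> 'k)) \<Rightarrow> bool"
where
  "is_V_r \<rho> \<gamma>\<^sub>1 \<gamma>\<^sub>2 \<gamma>\<^sub>3 i V act \<longleftrightarrow>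
    \<beta>\<^sub>1 * (\<gamma>\<^sub>1 ^ n\<^sub>1 - \<gamma>\<^sub>2 ^ n) = 0 \<and> \<beta>\<^sub>2 * (\<gamma>\<^sub>1 ^ n\<^sub>1 - \<gamma>\<^sub>3 ^ n) = 0 \<and>
    \<beta>\<^sub>3 * (\<rho> ^ (2 * n\<^sub>1) * q ^ (2 * n\<^sub>1 * i) - \<gamma>\<^sub>2 * \<gamma>\<^sub>3) \<noteq> 0 \<and>
    (let d = r \<rho> \<gamma>\<^sub>2 \<gamma>\<^sub>3 i; k = k_r \<rho> \<gamma>\<^sub>2 \<gamma>\<^sub>3 i in
       V = coords d \<and> left_module (*c) H scalar V act \<and>
       (\<forall>v\<in>V. act b v = \<gamma>\<^sub>2 *c v) \<and> (\<forall>v\<in>V. act c v = \<gamma>\<^sub>3 *c v) \<and>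
       (\<forall>j<d. act a (basis_vec j) = (\<rho> * q powi (int i - int j)) *c basis_vec j) \<and>
       (\<forall>j<d - 1. act x (basis_vec j) = basis_vec (j + 1)) \<and> act x (basis_vec (d - 1)) = 0 \<and>
       act y (basis_vec 0) = 0 \<and> (\<forall>l\<in>{1..d - 1}. act y (basis_vec l) = k l *c basis_vec (l - 1)))"

end

end

theory Submission
  imports Defs
begin

text \<open>
  Let \<open>M\<close> be an irreducible module, and write \<open>A, B, C, \<xi>, \<eta>\<close> for the operators on
  \<open>M\<close> given by \<open>a, b, c, x, y\<close>. The operators \<open>Z = A\<^sup>n\<close>, \<open>B\<close>
  and \<open>C\<close> commute with everything, and up to inverting them \<open>M\<close> is spanned over the
  polynomial ring in \<open>Z, B, C\<close> by the \<open>n\<^sup>3\<close> vectors \<open>A\<^sup>i \<xi>\<^sup>l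
  \<eta>\<^sup>m v\<close> with \<open>i, l, m < n\<close>, because \<open>x\<^sup>n\<close> and
  \<open>y\<^sup>n\<close> are polynomials in the central elements and \<open>y\<close> can be moved past
  \<open>x\<close> (\<open>finitely_generated\<close>).

  Nothing is assumed about the dimension of \<open>M\<close> or the cardinality of the field, so the usual Schur
  argument does not apply at once. By irreducibility every polynomial in \<open>Z, B, C\<close> acts as zero or
  bijectively. Expressing \<open>d\<^sup>-\<^sup>1 v\<close> through a maximal linearly independent set of generators
  shows that the image of the polynomial ring in the endomorphisms of \<open>M\<close> has a nonzero element some
  power of which is divisible by any given nonzero element (\<open>goldman_ann\<close>; such a ring is a G-domain).
  This property descends from \<open>D[z]\<close> to \<open>D\<close> (\<open>goldman_coefficients\<close>) and forces
  \<open>z\<close> to be algebraic over \<open>D\<close> (\<open>goldman_algebraic\<close>); this is Zariski's lemma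
  in the form due to Goldman. Descending from three variables to one and factoring a polynomial over the algebraically
  closed field shows that \<open>Z, B, C\<close> act by scalars \<open>\<gamma>\<^sub>1, \<gamma>\<^sub>2,
  \<gamma>\<^sub>3\<close> (\<open>central_scalars\<close>). Consequently \<open>M\<close> is finite-dimensional,
  \<open>\<xi>\<^sup>n\<close> and \<open>\<eta>\<^sup>n\<close> are scalars, and every eigenvalue of \<open>A\<close>
  is \<open>\<rho> q\<^sup>i\<close> with \<open>\<rho>\<close> the chosen root of \<open>\<gamma>\<^sub>1\<close>.

  The operators \<open>\<xi>\<close> and \<open>\<eta>\<close> move the eigenspaces of \<open>A\<close> by
  \<open>q\<^sup>-\<^sup>1\<close> and \<open>q\<close>, and \<open>Y_Xpow\<close>, \<open>X_Ypow\<close> compute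
  \<open>\<eta> \<xi>\<^sup>j\<close> and \<open>\<xi> \<eta>\<^sup>j\<close> on them. If \<open>\<xi>\<^sup>n
  \<noteq> 0\<close>, take a common eigenvector \<open>v\<close> of \<open>A\<close> and \<open>\<xi>\<eta>\<close>:
  the vectors \<open>\<xi>\<^sup>j v\<close> form a module of type I. If \<open>\<xi>\<^sup>n = 0\<close> but
  \<open>\<eta>\<^sup>n \<noteq> 0\<close>, the vectors \<open>\<eta>\<^sup>j v\<close> with \<open>v\<close> a common
  eigenvector of \<open>A\<close> and \<open>\<eta>\<xi>\<close> give type II. If both are zero, take an eigenvector
  \<open>v\<close> of \<open>A\<close> killed by \<open>\<eta>\<close>; the nonzero vectors among the
  \<open>\<xi>\<^sup>j v\<close> form a basis, and irreducibility makes its length the first positive zero of the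
  structure constants, which is \<open>1\<close> or \<open>r\<close> (\<open>r_eq\<close>). In each case the vectors
  have distinct \<open>A\<close>-eigenvalues, so they are independent, and they span a submodule, so they are a basis
  of \<open>M\<close> (\<open>chain_basisI\<close>).
\<close>

section \<open>Polynomials in a module endomorphism\<close>

text \<open>
  The action of \<open>R[z]\<close> on an \<open>R\<close>-module in which the variable acts as the endomorphism
  \<open>T\<close>.
\<close>

definition poly_ext :: "('a::comm_ring_1 \<Rightarrow> 'b::ab_group_add \<Rightarrow> 'b) \<Rightarrow> ('b \<Rightarrow> 'b) \<Rightarrow> 'a poly \<Rightarrow> 'b \<Rightarrow> 'b" where
  "poly_ext \<phi> T p m = fold_coeffs (\<lambda>r v. \<phi> r m + T v) p 0"

context
  fixes \<phi> :: "'a::comm_ring_1 \<Rightarrow> 'b::ab_group_add \<Rightarrow> 'b" and T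
  assumes T: "module_hom \<phi> \<phi> T"
begin

interpretation module_hom \<phi> \<phi> T by (rule T)

lemma poly_ext_0 [simp]: "poly_ext \<phi> T 0 m = 0"
  by (simp add: poly_ext_def)

lemma poly_ext_pCons [simp]: "poly_ext \<phi> T (pCons r p) m = \<phi> r m + T (poly_ext \<phi> T p m)"
  by (cases "r = 0 \<and> p = 0") (auto simp: poly_ext_def)

lemma poly_ext_add: "poly_ext \<phi> T (p + p') m = poly_ext \<phi> T p m + poly_ext \<phi> T p' m"
  by (induction p p' rule: poly_induct2) (auto simp: add m1.scale_left_distrib)

lemma poly_ext_smult: "poly_ext \<phi> T (smult r p) m = \<phi> r (poly_ext \<phi> T p m)"
  by (induction p) (auto simp: scale m1.scale_right_distrib)

lemma poly_ext_mult: "poly_ext \<phi> T (p * p') m = poly_ext \<phi> T p (poly_ext \<phi> T p' m)"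
  by (induction p) (auto simp: poly_ext_add poly_ext_smult)

lemma module_poly_ext: "Modules.module (poly_ext \<phi> T)"
proof
  show "poly_ext \<phi> T p (u + v) = poly_ext \<phi> T p u + poly_ext \<phi> T p v" for p u v
    by (induction p) (auto simp: add m1.scale_right_distrib)
qed (auto simp: poly_ext_add poly_ext_mult one_pCons)

lemma module_hom_poly_ext:
  assumes S: "module_hom \<phi> \<phi> S" and ST: "\<And>v. S (T v) = T (S v)"
  shows "module_hom (poly_ext \<phi> T) (poly_ext \<phi> T) S"
proof -
  interpret S: module_hom \<phi> \<phi> S by (rule S)
  interpret E: Modules.module "poly_ext \<phi> T" by (rule module_poly_ext)
  show ?thesis
  proof
    show "S (poly_ext \<phi> T p v) = poly_ext \<phi> T p (S v)" for p v
      by (induction p) (auto simp: S.add S.scale ST)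
  qed (auto simp: S.add)
qed

end

section \<open>G-domains and polynomial extensions\<close>

text \<open>
  Prime ideals of a commutative ring. Working with a prime ideal of a polynomial ring instead of a chain of domains
  keeps the coefficients in one type.
\<close>

definition prime_set :: "'a::comm_ring_1 set \<Rightarrow> bool" where
  "prime_set P \<longleftrightarrow> 0 \<in> P \<and> 1 \<notin> P \<and> (\<forall>p\<in>P. \<forall>q\<in>P. p + q \<in> P) \<and> (\<forall>p\<in>P. \<forall>q. q * p \<in> P)
     \<and> (\<forall>p q. p * q \<in> P \<longrightarrow> p \<in> P \<or> q \<in> P)"

text \<open>
  The quotient by the prime ideal \<open>P\<close> is a G-domain: every nonzero element divides a power of one fixed
  nonzero element \<open>s\<close>. Equivalently, inverting \<open>s\<close> gives the field of fractions.
\<close>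

definition goldman :: "'a::comm_ring_1 set \<Rightarrow> bool" where
  "goldman P \<longleftrightarrow> (\<exists>s. s \<notin> P \<and> (\<forall>d. d \<notin> P \<longrightarrow> (\<exists>N e. s ^ N - d * e \<in> P)))"

text \<open>
  The intersection of an ideal of \<open>R[z]\<close> with \<open>R\<close>.
\<close>

definition contraction :: "'a::comm_ring_1 poly set \<Rightarrow> 'a set" where
  "contraction P = {r. [:r:] \<in> P}"

lemma prime_setD:
  assumes "prime_set P"
  shows "0 \<in> P" "1 \<notin> P" "p \<in> P \<Longrightarrow> q \<in> P \<Longrightarrow> p + q \<in> P" "p \<in> P \<Longrightarrow> q * p \<in> P" "p \<in> P \<Longrightarrow> p * q \<in> P"
    "p \<in> P \<Longrightarrow> q \<in> P \<Longrightarrow> p - q \<in> P" "p * q \<in> P \<longleftrightarrow> p \<in> P \<or> q \<in> P" "p - q \<in> P \<Longrightarrow> p \<in> P \<longleftrightarrow> q \<in> P"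
    "p ^ N \<in> P \<Longrightarrow> p \<in> P"
proof -
  show *: "0 \<in> P" "1 \<notin> P" "\<And>p q. p \<in> P \<Longrightarrow> q \<in> P \<Longrightarrow> p + q \<in> P" "\<And>p q. p \<in> P \<Longrightarrow> q * p \<in> P"
    using assms by (auto simp: prime_set_def)
  show **: "\<And>p q. p \<in> P \<Longrightarrow> p * q \<in> P" using *(4) by (simp add: mult.commute)
  show ***: "\<And>p q. p \<in> P \<Longrightarrow> q \<in> P \<Longrightarrow> p - q \<in> P"
    using *(3) *(4)[of _ "-1"] by (metis (no_types) mult_minus1 uminus_add_conv_diff add.commute)
  show m: "\<And>p q. p * q \<in> P \<longleftrightarrow> p \<in> P \<or> q \<in> P"
    using * ** assms by (auto simp: prime_set_def)
  show "\<And>p q. p - q \<in> P \<Longrightarrow> p \<in> P \<longleftrightarrow> q \<in> P"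
    using *(3) *** by (metis diff_add_cancel diff_diff_eq2 add_diff_cancel_left')
  show "p ^ N \<in> P \<Longrightarrow> p \<in> P"
    by (induction N) (auto simp: *(2) m)
qed

context
  fixes P :: "'a::idom poly set"
  assumes P: "prime_set P"
begin

lemmas PD = prime_setD[OF P]

abbreviation "P0 \<equiv> contraction P"

lemma prime_set_P0: "prime_set P0"
proof -
  have "[:p + q:] \<in> P" if "[:p:] \<in> P" "[:q:] \<in> P" for p q using PD(3)[OF that] by simp
  moreover have "[:q * p:] \<in> P" if "[:p:] \<in> P" for p q using PD(4)[OF that, of "[:q:]"] by (simp add: mult.commute)
  moreover have "[:p:] \<in> P \<or> [:q:] \<in> P" if "[:p * q:] \<in> P" for p q using PD(7)[of "[:p:]" "[:q:]"] that by (simp add: mult.commute)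
  ultimately show ?thesis using PD(1) PD(2)[unfolded one_pCons]
    unfolding prime_set_def contraction_def mem_Collect_eq by simp
qed

lemmas P0D = prime_setD[OF prime_set_P0]

lemma smult_in_P: "r \<in> P0 \<Longrightarrow> smult r p \<in> P"
  using PD(5)[of "[:r:]" p] by (simp add: contraction_def)

lemma monom_in_P: "r \<in> P0 \<Longrightarrow> monom r k \<in> P"
  using smult_in_P[of r "monom 1 k"] by (simp add: smult_monom)

lemma degree_minus_lead:
  assumes "degree (p::'a poly) > 0"
  shows "degree (p - monom (lead_coeff p) (degree p)) < degree p"
proof -
  have "degree (p - monom (lead_coeff p) (degree p)) \<le> degree p"
    by (intro degree_diff_le degree_monom_le) auto
  moreover have "coeff (p - monom (lead_coeff p) (degree p)) (degree p) = 0" by simp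
  ultimately show ?thesis using assms
    by (metis eq_zero_or_degree_less coeff_0_degree_minus_1 diff_less le_less_trans degree_0 leading_coeff_0_iff nless_le)
qed

text \<open>
  Modulo \<open>P\<close>, terms with coefficients in \<open>P0\<close> may be dropped. Choosing representatives whose
  leading coefficient lies outside \<open>P0\<close> makes degrees behave as over the domain \<open>R / P0\<close>.
\<close>

lemma truncate:
  assumes "p \<notin> P"
  obtains p' where "p - p' \<in> P" "lead_coeff p' \<notin> P0" "degree p' \<le> degree p"
  using assms
proof (induction "degree p" arbitrary: p thesis rule: less_induct)
  case less
  show ?case
  proof (cases "lead_coeff p \<in> P0")
    case False
    show ?thesis by (rule less(2)[of p]) (auto simp: PD(1) False)
  next
    case True
    define r where "r = p - monom (lead_coeff p) (degree p)"
    have deg: "degree p > 0"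
    proof (rule ccontr)
      assume "\<not> degree p > 0"
      then have "p = [:lead_coeff p:]" by (metis degree_0_id neq0_conv)
      with True less(3) show False by (simp add: contraction_def)
    qed
    have pr: "p - r \<in> P" using True by (simp add: r_def monom_in_P)
    with less(3) PD(8) have "r \<notin> P" by blast
    moreover have dr: "degree r < degree p" unfolding r_def using deg by (rule degree_minus_lead)
    ultimately obtain p' where "r - p' \<in> P" "lead_coeff p' \<notin> P0" "degree p' \<le> degree r"
      using less(1)[of r] by blast
    moreover have "p - p' \<in> P" using PD(3)[OF pr \<open>r - p' \<in> P\<close>] by simp
    ultimately show ?thesis using dr less(2)[of p'] by auto
  qed
qed

text \<open>
  If \<open>z\<close> satisfies no equation of degree less than \<open>k\<close> over \<open>R / P0\<close>, then
  \<open>1, z, \<dots>, z\<^bsup>k-1\<^esup>\<close> are linearly independent modulo \<open>P\<close>.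
\<close>

lemma coeffs_in_P0:
  assumes "\<And>g. g \<in> P \<Longrightarrow> degree g < k \<Longrightarrow> lead_coeff g \<in> P0" and "p \<in> P" "degree p < k"
  shows "coeff p i \<in> P0"
  using assms(2,3)
proof (induction "degree p" arbitrary: p rule: less_induct)
  case less
  have l: "lead_coeff p \<in> P0" using assms(1) less by blast
  show ?case
  proof (cases "degree p = 0")
    case True
    show ?thesis using l P0D(1) True by (cases "i = 0") (simp_all add: coeff_eq_0)
  next
    case False
    define r where "r = p - monom (lead_coeff p) (degree p)"
    have "degree r < degree p" unfolding r_def using False by (intro degree_minus_lead) auto
    moreover have "r \<in> P" unfolding r_def using less l by (intro PD(6) monom_in_P)
    ultimately have "coeff r i \<in> P0" using less by auto
    moreover have "coeff p i - coeff r i \<in> P0" using l P0D(1) by (cases "degree p = i") (auto simp: r_def)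
    ultimately show ?thesis using P0D(8) by blast
  qed
qed

lemma power_cong_P: "p - p' \<in> P \<Longrightarrow> p ^ N - p' ^ N \<in> P"
proof (induction N)
  case (Suc N)
  have "p ^ Suc N - p' ^ Suc N = p * (p ^ N - p' ^ N) + (p - p') * p' ^ N" by (simp add: algebra_simps)
  then show ?case using Suc PD(3,4,5) by metis
qed (auto simp: PD(1))

text \<open>
  If \<open>R[z] / P\<close> is a G-domain, then \<open>z\<close> is algebraic over \<open>R / P0\<close>: for
  transcendental \<open>z\<close>, the polynomial \<open>1 + z s\<close> is not a unit, but it would divide a power of
  \<open>s\<close> and hence \<open>1\<close>.
\<close>

lemma goldman_algebraic:
  assumes "goldman P"
  obtains g where "g \<in> P" "lead_coeff g \<notin> P0"
proof (rule ccontr)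
  assume "\<not> thesis"
  with that have no: "\<And>g. g \<in> P \<Longrightarrow> lead_coeff g \<in> P0" by blast
  have no': "coeff p i \<in> P0" if "p \<in> P" for p i
    by (rule coeffs_in_P0[of "Suc (degree p)"]) (use no that in auto)
  from assms obtain s where s: "s \<notin> P" "\<And>d. d \<notin> P \<Longrightarrow> \<exists>N e. s ^ N - d * e \<in> P"
    unfolding goldman_def by blast
  obtain s' where s': "s - s' \<in> P" "lead_coeff s' \<notin> P0" using truncate[OF s(1)] by blast
  define t :: "'a poly" where "t = [:0, 1:]"
  define d where "d = 1 + t * s'"
  have s'0: "s' \<noteq> 0" using s'(2) P0D(1) by auto
  have d_eq: "d = pCons 1 s'" by (simp add: d_def t_def one_pCons)
  have degd: "degree d = Suc (degree s')" and lcd: "lead_coeff d = lead_coeff s'" using s'0 by (auto simp: d_eq)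
  have "d \<notin> P" using no'[of d 0] P0D(2) by (auto simp: d_eq)
  with s(2) obtain N e where e: "s ^ N - d * e \<in> P" by blast
  \<comment> \<open>\<open>t s' \<equiv> -1\<close> modulo \<open>d\<close>, so \<open>d\<close> would be invertible modulo \<open>P\<close>\<close>
  have "s' ^ N - s ^ N \<in> P" using power_cong_P[OF s'(1), of N] PD(6)[OF PD(1)] by (metis diff_0 minus_diff_eq)
  from PD(3)[OF this e] have 1: "s' ^ N - d * e \<in> P" by simp
  obtain w where w: "1 - (- t * s') ^ N = d * w"
    using that[of "\<Sum>i<N. (- t * s') ^ i"] one_diff_power_eq[of "- t * s'" N] unfolding d_def by simp
  have "(- t) ^ N * (s' ^ N - d * e) \<in> P" using 1 by (rule PD(4))
  moreover have "1 - d * (w + (- t) ^ N * e) = (- t) ^ N * (s' ^ N - d * e)"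
  proof -
    have "1 - d * w = (- t) ^ N * s' ^ N" using w unfolding power_mult_distrib by (simp add: algebra_simps)
    then show ?thesis by (simp add: algebra_simps)
  qed
  ultimately have "1 - d * (w + (- t) ^ N * e) \<in> P" by simp
  then obtain e' where e': "1 - d * e' \<in> P" by blast
  then have "e' \<notin> P" using PD(2,4,8) by blast
  then obtain f where f: "e' - f \<in> P" "lead_coeff f \<notin> P0" using truncate by blast
  have f0: "f \<noteq> 0" using f P0D(1) by auto
  have "1 - d * f = (1 - d * e') + d * (e' - f)" by (simp add: algebra_simps)
  then have "1 - d * f \<in> P" using PD(3)[OF e' PD(4)[OF f(1)]] by metis
  from no'[OF this, of "degree (d * f)"] have "coeff (1 - d * f) (degree (d * f)) \<in> P0" .
  moreover have "degree (d * f) > 0" using f0 degd by (subst degree_mult_eq) auto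
  ultimately have "- lead_coeff (d * f) \<in> P0" by (simp add: coeff_eq_0)
  then have "- (lead_coeff s' * lead_coeff f) \<in> P0" by (simp only: lead_coeff_mult lcd)
  then have "lead_coeff s' * lead_coeff f \<in> P0" using P0D(4)[of _ "-1"] by fastforce
  then show False using P0D(7) s'(2) f(2) by blast
qed

lemma pseudo_div_exists:
  assumes "(g::'a poly) \<noteq> 0"
  obtains M Q r where "smult (lead_coeff g ^ M) f = Q * g + r" "r = 0 \<or> degree r < degree g"
proof -
  obtain Q r where "pseudo_divmod f g = (Q, r)" by fastforce
  from pseudo_divmod[OF assms this] that show ?thesis by (simp add: mult.commute)
qed

text \<open>
  If \<open>R[z] / P\<close> is a G-domain, then so is \<open>R / P0\<close>. Here \<open>g\<close> is a minimal
  equation of \<open>z\<close> over \<open>R / P0\<close> and \<open>c\<close> its leading coefficient. The element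
  \<open>s\<close> divides a constant \<open>\<sigma>\<close>. If a constant \<open>d\<close> divides
  \<open>\<sigma>\<^sup>N\<close> with quotient \<open>e\<close>, then pseudo-division by \<open>g\<close> writes
  \<open>c\<^sup>M e\<close> as a combination of \<open>1, z, \<dots>, z\<^bsup>k-1\<^esup>\<close>; comparing
  constant coefficients shows that \<open>d\<close> divides \<open>c\<^sup>M \<sigma>\<^sup>N\<close> already in
  \<open>R / P0\<close>.
\<close>

lemma goldman_coefficients:
  assumes G: "goldman P"
  shows "goldman P0"
proof -
  define k where "k = (LEAST k. \<exists>g. g \<in> P \<and> lead_coeff g \<notin> P0 \<and> degree g = k)"
  obtain g' where "g' \<in> P" "lead_coeff g' \<notin> P0" using goldman_algebraic[OF G] .
  then have "\<exists>k g. g \<in> P \<and> lead_coeff g \<notin> P0 \<and> degree g = k" by blast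
  from LeastI_ex[OF this] obtain g where g: "g \<in> P" "lead_coeff g \<notin> P0" "degree g = k"
    unfolding k_def by blast
  have min: "lead_coeff h \<in> P0" if "h \<in> P" "degree h < k" for h
    using that not_less_Least[of "degree h" "\<lambda>k. \<exists>g. g \<in> P \<and> lead_coeff g \<notin> P0 \<and> degree g = k"]
    by (auto simp: k_def)
  have small: "coeff h i \<in> P0" if "h \<in> P" "degree h < k" for h i
    by (rule coeffs_in_P0[OF min]) (use that in auto)
  have g0: "g \<noteq> 0" using g P0D(1) by auto
  have k0: "k > 0"
  proof (rule ccontr)
    assume "\<not> k > 0"
    then have "g = [:lead_coeff g:]" using g(3) by (metis degree_0_id neq0_conv)
    with g(1,2) show False by (metis contraction_def mem_Collect_eq)
  qed
  from G obtain s where s: "s \<notin> P" "\<And>d. d \<notin> P \<Longrightarrow> \<exists>N e. s ^ N - d * e \<in> P"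
    unfolding goldman_def by blast
  have pow: "c ^ M \<in> P0 \<Longrightarrow> c \<in> P0" for c M by (rule P0D(9))
  \<comment> \<open>\<open>s\<close> divides a nonzero constant: take a nonzero multiple \<open>r\<close> of \<open>s\<close> of minimal degree; dividing \<open>g\<close> by
    \<open>r\<close> shows that this degree is zero\<close>
  define R where "R = {r. r \<notin> P \<and> lead_coeff r \<notin> P0 \<and> (\<exists>w. r - s * w \<in> P)}"
  have RI: "\<exists>r'\<in>R. degree r' \<le> degree r" if r: "r \<notin> P" "r - s * w \<in> P" for r w
  proof -
    obtain r' where r': "r - r' \<in> P" "lead_coeff r' \<notin> P0" "degree r' \<le> degree r" using truncate[OF r(1)] by blast
    have "r' - s * w = (r - s * w) - (r - r')" by simp
    then have "r' - s * w \<in> P" using PD(6)[OF r(2) r'(1)] by metis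
    moreover have "r' \<notin> P" using r(1) r'(1) PD(8) by blast
    ultimately show ?thesis using r' unfolding R_def by blast
  qed
  have "R \<noteq> {}" using RI[OF s(1), of 1] PD(1) by auto
  then obtain r0 where "r0 \<in> R" by blast
  from ex_has_least_nat[of "\<lambda>r. r \<in> R", OF this, of degree]
  obtain r where r: "r \<in> R" and rmin: "\<And>r'. r' \<in> R \<Longrightarrow> degree r \<le> degree r'" by blast
  from r obtain w where w: "r - s * w \<in> P" and lr: "lead_coeff r \<notin> P0" and rP: "r \<notin> P"
    by (auto simp: R_def)
  have r0: "r \<noteq> 0" using lr P0D(1) by auto
  \<comment> \<open>otherwise its remainder modulo \<open>g\<close> is a multiple of \<open>s\<close> of smaller degree, since \<open>g \<in> P\<close>\<close>
  have rk: "degree r < k"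
  proof (rule ccontr)
    assume ge: "\<not> degree r < k"
    obtain M Q r2 where d: "smult (lead_coeff g ^ M) r = Q * g + r2" "r2 = 0 \<or> degree r2 < k"
      using pseudo_div_exists[OF g0, of r] g(3) by blast
    have "r2 - s * (smult (lead_coeff g ^ M) w) = smult (lead_coeff g ^ M) (r - s * w) - Q * g"
      using d(1) by (simp add: algebra_simps smult_diff_right)
    moreover have "smult (lead_coeff g ^ M) (r - s * w) - Q * g \<in> P"
      using PD(4)[OF g(1)] PD(4)[OF w, of "[:lead_coeff g ^ M:]"] by (intro PD(6)) auto
    ultimately have r2: "r2 - s * (smult (lead_coeff g ^ M) w) \<in> P" by metis
    have "[:lead_coeff g ^ M:] \<notin> P" using g(2) pow[of "lead_coeff g" M] by (auto simp: contraction_def)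
    then have "[:lead_coeff g ^ M:] * r \<notin> P" using rP PD(7) by blast
    moreover have "Q * g \<in> P" using PD(4)[OF g(1)] .
    ultimately have "r2 \<notin> P" using d(1) PD(3)[of "Q * g" r2] by auto
    then have "degree r2 < k" using d(2) PD(1) by auto
    moreover obtain r' where "r' \<in> R" "degree r' \<le> degree r2" using RI[OF \<open>r2 \<notin> P\<close> r2] by blast
    ultimately show False using rmin[of r'] ge by linarith
  qed
  \<comment> \<open>otherwise the remainder of \<open>g\<close> modulo \<open>r\<close> is a smaller multiple of \<open>s\<close>, so it is zero modulo \<open>P\<close>; then
    the quotient \<open>Q\<close> is an equation of \<open>z\<close> of degree below \<open>k\<close>\<close>
  have "degree r = 0"
  proof (rule ccontr)
    assume pos: "degree r \<noteq> 0"
    obtain M Q r2 where d: "smult (lead_coeff r ^ M) g = Q * r + r2" "r2 = 0 \<or> degree r2 < degree r"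
      using pseudo_div_exists[OF r0, of g] by blast
    have lc0: "lead_coeff r ^ M \<noteq> 0" using r0 by simp
    have "r2 - s * (- Q * w) = smult (lead_coeff r ^ M) g - Q * (r - s * w)"
      using d(1) by (simp add: algebra_simps smult_diff_right)
    moreover have "smult (lead_coeff r ^ M) g - Q * (r - s * w) \<in> P"
      using PD(4)[OF g(1), of "[:lead_coeff r ^ M:]"] PD(4)[OF w] by (intro PD(6)) auto
    ultimately have r2: "r2 - s * (- Q * w) \<in> P" by metis
    have r2P: "r2 \<in> P"
    proof (rule ccontr)
      assume "r2 \<notin> P"
      then have "degree r2 < degree r" using d(2) PD(1) by auto
      moreover obtain r' where "r' \<in> R" "degree r' \<le> degree r2" using RI[OF \<open>r2 \<notin> P\<close> r2] by blast
      ultimately show False using rmin[of r'] by linarith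
    qed
    have "smult (lead_coeff r ^ M) g - r2 \<in> P"
      using PD(4)[OF g(1), of "[:lead_coeff r ^ M:]"] r2P by (intro PD(6)) auto
    then have "Q * r \<in> P" using d(1) by simp
    then have Q: "Q \<in> P" using rP PD(7) by blast
    have eq: "Q * r = smult (lead_coeff r ^ M) g - r2" using d(1) by simp
    have lt: "r2 = 0 \<or> degree r2 < degree (smult (lead_coeff r ^ M) g)" using d(2) rk g(3) lc0 by auto
    have degQr: "degree (Q * r) = k"
    proof -
      have "degree (smult (lead_coeff r ^ M) g + - r2) = degree (smult (lead_coeff r ^ M) g)"
        using lt k0 g(3) lc0 by (intro degree_add_eq_left) auto
      then show ?thesis using lc0 r0 g(3) eq by simp
    qed
    have "coeff r2 k = 0" using d(2) rk by (auto simp: coeff_eq_0)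
    then have "lead_coeff (Q * r) = lead_coeff r ^ M * lead_coeff g"
      unfolding degQr using g(3) by (simp add: eq)
    then have "lead_coeff Q * lead_coeff r = lead_coeff r ^ M * lead_coeff g" by (simp add: lead_coeff_mult)
    moreover have "lead_coeff r ^ M * lead_coeff g \<notin> P0" using pow lr g(2) P0D(7) by blast
    ultimately have "lead_coeff Q \<notin> P0" using P0D(5) by metis
    moreover have "Q \<noteq> 0" using degQr k0 by auto
    then have "degree Q < k" using degQr pos r0 by (simp add: degree_mult_eq)
    ultimately show False using min Q by blast
  qed
  then obtain \<sigma> where \<sigma>: "r = [:\<sigma>:]" by (metis degree_0_id)
  have \<sigma>0: "\<sigma> \<notin> P0" using lr \<sigma> by simp
  define c where "c = lead_coeff g"
  have "\<exists>N e. (c * \<sigma>) ^ N - d * e \<in> P0" if d: "d \<notin> P0" for d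
  proof -
    have "[:d:] \<notin> P" using d by (simp add: contraction_def)
    with s(2) obtain N e where e: "s ^ N - [:d:] * e \<in> P" by blast
    have "[:\<sigma>:] ^ N - (s * w) ^ N \<in> P" using power_cong_P w \<sigma> by simp
    moreover have "w ^ N * (s ^ N - [:d:] * e) \<in> P" using PD(4) e by blast
    ultimately have "[:\<sigma>:] ^ N - (s * w) ^ N + w ^ N * (s ^ N - [:d:] * e) \<in> P" by (rule PD(3))
    then have 1: "[:\<sigma>:] ^ N - [:d:] * (e * w ^ N) \<in> P" by (simp add: power_mult_distrib algebra_simps)
    obtain M Q h where h: "smult (c ^ M) (e * w ^ N) = Q * g + h" "h = 0 \<or> degree h < k"
      using pseudo_div_exists[OF g0] g(3) c_def by metis
    have "[:c ^ M * \<sigma> ^ N:] - smult d h = smult (c ^ M) ([:\<sigma>:] ^ N - [:d:] * (e * w ^ N)) + smult d Q * g"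
    proof -
      have "smult d (smult (c ^ M) (e * w ^ N)) = smult d (Q * g) + smult d h" using h(1) by (simp add: smult_add_right)
      moreover have "[:\<sigma>:] ^ N = [:\<sigma> ^ N:]" by (rule poly_const_pow)
      ultimately show ?thesis by (simp add: smult_diff_right mult.commute)
    qed
    moreover have "smult (c ^ M) ([:\<sigma>:] ^ N - [:d:] * (e * w ^ N)) + smult d Q * g \<in> P"
      using PD(4)[OF 1, of "[:c ^ M:]"] PD(4)[OF g(1), of "smult d Q"] by (intro PD(3)) auto
    ultimately have "[:c ^ M * \<sigma> ^ N:] - smult d h \<in> P" by metis
    moreover have "degree ([:c ^ M * \<sigma> ^ N:] - smult d h) < k"
      using h(2) k0 by (intro degree_diff_less) auto
    ultimately have "coeff ([:c ^ M * \<sigma> ^ N:] - smult d h) 0 \<in> P0" by (rule small)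
    then have "c ^ M * \<sigma> ^ N - d * coeff h 0 \<in> P0" by simp
    then have "(c ^ N * \<sigma> ^ M) * (c ^ M * \<sigma> ^ N - d * coeff h 0) \<in> P0" by (rule P0D(4))
    then have "(c * \<sigma>) ^ (M + N) - d * (c ^ N * \<sigma> ^ M * coeff h 0) \<in> P0"
      by (simp add: power_mult_distrib power_add algebra_simps)
    then show ?thesis by blast
  qed
  moreover have "c * \<sigma> \<notin> P0" using \<sigma>0 g(2) P0D(7) c_def by blast
  ultimately show ?thesis unfolding goldman_def by blast
qed

end

section \<open>Zariski's lemma for three commuting operators\<close>

definition annihilator :: "('a::comm_ring_1 \<Rightarrow> 'b::ab_group_add \<Rightarrow> 'b) \<Rightarrow> 'a set" where
  "annihilator \<phi> = {r. \<forall>m. \<phi> r m = 0}"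

text \<open>
  A nonzero module on which every ring element acts as zero or bijectively; in particular it is torsion-free over the
  quotient of the ring by the annihilator, which is prime.
\<close>

locale simple_action = Modules.module \<phi> for \<phi> :: "'a::comm_ring_1 \<Rightarrow> 'b::ab_group_add \<Rightarrow> 'b" +
  assumes zero_or_bij: "(\<forall>m. \<phi> r m = 0) \<or> bij (\<phi> r)"
    and nonzero: "\<exists>m::'b. m \<noteq> 0"
begin

lemma not_annD: "r \<notin> annihilator \<phi> \<Longrightarrow> bij (\<phi> r)"
  using zero_or_bij by (auto simp: annihilator_def)

lemma not_ann_eq_0: "r \<notin> annihilator \<phi> \<Longrightarrow> \<phi> r m = 0 \<Longrightarrow> m = 0"
  using not_annD by (metis bij_pointE scale_zero_right)

lemma annD: "r \<in> annihilator \<phi> \<Longrightarrow> \<phi> r m = 0"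
  by (simp add: annihilator_def)

lemma prime_set_ann: "prime_set (annihilator \<phi>)"
proof -
  have "p \<in> annihilator \<phi> \<or> q \<in> annihilator \<phi>" if "p * q \<in> annihilator \<phi>" for p q
  proof (rule ccontr)
    assume *: "\<not> ?thesis"
    obtain m :: 'b where "m \<noteq> 0" using nonzero by blast
    moreover have "\<phi> p (\<phi> q m) = 0" using annD[OF that] by simp
    ultimately show False using * not_ann_eq_0 by blast
  qed
  moreover have "1 \<notin> annihilator \<phi>" using nonzero by (auto simp: annihilator_def)
  ultimately show ?thesis
    unfolding prime_set_def by (auto simp: annihilator_def scale_left_distrib simp flip: scale_scale)
qed

lemmas AD = prime_setD[OF prime_set_ann]

text \<open>
  If such a module is finitely generated after inverting an element \<open>u\<close>, then the quotient by the
  annihilator is a G-domain. Let \<open>B\<close> be a maximal independent set of generators, and \<open>s\<close> an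
  element that multiplies all generators into the span of \<open>B\<close>. For \<open>b \<in> B\<close> and \<open>d
  \<noteq> 0\<close>, expressing \<open>s u\<^sup>N d\<^sup>-\<^sup>1 b\<close> in \<open>B\<close> and comparing the
  coefficients of \<open>b\<close> shows that \<open>d\<close> divides \<open>s u\<^sup>N\<close>.
\<close>

lemma goldman_ann:
  assumes S: "finite S" and u: "bij (\<phi> u)" and gen: "\<And>m. \<exists>N. \<phi> (u ^ N) m \<in> span S"
  shows "goldman (annihilator \<phi>)"
proof -
  define free where "free = (\<lambda>B. B \<subseteq> S \<and> (\<forall>f. (\<Sum>b\<in>B. \<phi> (f b) b) = 0 \<longrightarrow> (\<forall>b\<in>B. f b \<in> annihilator \<phi>)))"
  have "free {}" by (simp add: free_def)
  moreover have "\<forall>B. free B \<longrightarrow> card B < Suc (card S)"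
    using S by (auto simp: free_def less_Suc_eq_le intro: card_mono)
  ultimately obtain B where B: "free B" and max: "\<And>C. free C \<Longrightarrow> card C \<le> card B"
    using ex_has_greatest_nat[of free _ card] by blast
  have BS: "B \<subseteq> S" and fB: "finite B" using B S finite_subset by (auto simp: free_def)
  have one: "\<exists>s. s \<notin> annihilator \<phi> \<and> \<phi> s b \<in> span B" if b: "b \<in> S" for b
  proof (cases "b \<in> B")
    case True
    then show ?thesis using AD(2) by (intro exI[of _ 1]) (auto intro: span_base)
  next
    case False
    have "\<not> free (insert b B)" using max[of "insert b B"] False fB by auto
    then obtain f b' where f: "(\<Sum>b\<in>insert b B. \<phi> (f b) b) = 0" and b': "b' \<in> insert b B" "f b' \<notin> annihilator \<phi>"
      using b BS by (auto simp: free_def)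
    have f': "\<phi> (f b) b + (\<Sum>b\<in>B. \<phi> (f b) b) = 0" using f fB False by simp
    have "f b \<notin> annihilator \<phi>"
    proof
      assume "f b \<in> annihilator \<phi>"
      with f' have "(\<Sum>b\<in>B. \<phi> (f b) b) = 0" using annD by simp
      with B \<open>f b \<in> annihilator \<phi>\<close> b' show False by (auto simp: free_def)
    qed
    moreover have "\<phi> (f b) b = - (\<Sum>b\<in>B. \<phi> (f b) b)" using f' by (simp add: eq_neg_iff_add_eq_0)
    then have "\<phi> (f b) b \<in> span B" by (simp only:) (intro span_neg span_sum span_scale span_base)
    ultimately show ?thesis by blast
  qed
  have "\<exists>s. s \<notin> annihilator \<phi> \<and> (\<forall>b\<in>C. \<phi> s b \<in> span B)" if "C \<subseteq> S" for C
    using finite_subset[OF that S] that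
  proof (induction C rule: finite_induct)
    case empty
    show ?case using AD(2) by auto
  next
    case (insert b C)
    then obtain s where s: "s \<notin> annihilator \<phi>" "\<forall>b\<in>C. \<phi> s b \<in> span B" by auto
    obtain s' where s': "s' \<notin> annihilator \<phi>" "\<phi> s' b \<in> span B" using one[of b] insert.prems by blast
    have "s * s' \<notin> annihilator \<phi>" using s s' AD(7) by blast
    moreover have "\<phi> (s * s') b' \<in> span B" if "b' \<in> insert b C" for b'
      using that s(2) s'(2) span_scale[of _ B s] span_scale[of _ B s'] by (metis insert_iff scale_scale mult.commute)
    ultimately show ?case by blast
  qed
  then obtain s where s: "s \<notin> annihilator \<phi>" "\<forall>b\<in>S. \<phi> s b \<in> span B" by blast
  have "subspace {m. \<phi> s m \<in> span B}"
    by (auto simp: subspace_def scale_right_distrib span_add span_zero) (metis scale_left_commute span_scale scale_scale)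
  then have sspan: "\<phi> s m \<in> span B" if "m \<in> span S" for m
    using span_minimal[of S "{m. \<phi> s m \<in> span B}"] s(2) that by auto
  have ua: "u \<notin> annihilator \<phi>"
    using u nonzero by (metis annD bij_pointE)
  then have uN: "u ^ N \<notin> annihilator \<phi>" for N using AD(9) by blast
  have "B \<noteq> {}"
  proof
    assume "B = {}"
    obtain m :: 'b where m: "m \<noteq> 0" using nonzero by blast
    obtain N where "\<phi> (u ^ N) m \<in> span S" using gen by blast
    then have "\<phi> s (\<phi> (u ^ N) m) = 0" using sspan \<open>B = {}\<close> by fastforce
    then show False using not_ann_eq_0 s(1) uN m by blast
  qed
  then obtain b where b: "b \<in> B" by blast
  have "\<exists>N e. (s * u) ^ N - d * e \<in> annihilator \<phi>" if d: "d \<notin> annihilator \<phi>" for d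
  proof -
    obtain m where m: "\<phi> d m = b" using not_annD[OF d] by (metis bij_pointE)
    obtain N where "\<phi> (u ^ N) m \<in> span S" using gen by blast
    then have "\<phi> (s * u ^ N) m \<in> span B" using sspan by fastforce
    then obtain f where f: "\<phi> (s * u ^ N) m = (\<Sum>b\<in>B. \<phi> (f b) b)" using span_finite[OF fB] by auto
    have "\<phi> (s * u ^ N) b = \<phi> d (\<phi> (s * u ^ N) m)" by (simp add: m[symmetric] mult.commute)
    also have "\<dots> = (\<Sum>b\<in>B. \<phi> (d * f b) b)" by (simp add: f scale_sum_right)
    finally have 1: "\<phi> (s * u ^ N) b = (\<Sum>b\<in>B. \<phi> (d * f b) b)" .
    define h where "h = (\<lambda>b'. (if b' = b then s * u ^ N else 0) - d * f b')"
    have "(\<Sum>b'\<in>B. \<phi> (h b') b') = (\<Sum>b'\<in>B. if b' = b then \<phi> (s * u ^ N) b' else 0) - (\<Sum>b\<in>B. \<phi> (d * f b) b)"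
      unfolding sum_subtractf[symmetric] by (intro sum.cong) (auto simp: h_def scale_left_diff_distrib)
    also have "\<dots> = 0" using b fB by (simp add: 1)
    finally have "h b \<in> annihilator \<phi>" using B b by (auto simp: free_def)
    then have "s * u ^ N - d * f b \<in> annihilator \<phi>" by (simp add: h_def)
    then have "(s ^ N * u) * (s * u ^ N - d * f b) \<in> annihilator \<phi>" by (rule AD(4))
    then have "(s * u) ^ Suc N - d * (s ^ N * u * f b) \<in> annihilator \<phi>"
      by (simp add: power_mult_distrib algebra_simps)
    then show ?thesis by blast
  qed
  moreover have "s * u \<notin> annihilator \<phi>" using s(1) ua AD(7) by blast
  ultimately show ?thesis unfolding goldman_def by blast
qed

end

lemma annihilator_coeffs:
  assumes "module_hom \<phi> \<phi> T"
  shows "contraction (annihilator (poly_ext \<phi> T)) = annihilator \<phi>"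
  using poly_ext_pCons[OF assms] poly_ext_0[OF assms]
  by (simp add: contraction_def annihilator_def module_hom.zero[OF assms])

lemma linear_factor_in_prime_set:
  fixes g :: "'k::alg_closed_field poly"
  assumes P: "prime_set P" and "g \<in> P" "g \<noteq> 0"
  shows "\<exists>\<gamma>. [:- \<gamma>, 1:] \<in> P"
  using assms(2,3)
proof (induction "degree g" arbitrary: g rule: less_induct)
  case less
  show ?case
  proof (cases "degree g = 0")
    case True
    then obtain c where c: "g = [:c:]" "c \<noteq> 0" using less.prems by (metis degree_0_id pCons_0_0)
    then have "1 = [:inverse c:] * g" by (simp add: one_pCons)
    then show ?thesis using prime_setD(2,4)[OF P] less.prems by metis
  next
    case False
    then obtain \<gamma> where "poly g \<gamma> = 0" using alg_closed_imp_poly_has_root by blast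
    then obtain h where h: "g = [:- \<gamma>, 1:] * h" by (metis dvdE poly_eq_0_iff_dvd)
    with less.prems have "h \<noteq> 0" by auto
    then have "degree h < degree g" unfolding h by (subst degree_mult_eq) auto
    then show ?thesis using less h \<open>h \<noteq> 0\<close> prime_setD(7)[OF P] by metis
  qed
qed

text \<open>
  Two descents remove the variables \<open>Z\<^sub>3\<close> and \<open>Z\<^sub>2\<close>. Algebraicity of
  \<open>Z\<^sub>1\<close> over the field then gives a polynomial that annihilates the module, and one of its linear
  factors must do so because the annihilator is prime.
\<close>

lemma goldman_imp_scalar:
  fixes scale :: "'k::alg_closed_field \<Rightarrow> 'm::ab_group_add \<Rightarrow> 'm"
  assumes hom: "module_hom scale scale Z\<^sub>1" "module_hom scale scale Z\<^sub>2" "module_hom scale scale Z\<^sub>3"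
    and comm: "\<And>m. Z\<^sub>2 (Z\<^sub>1 m) = Z\<^sub>1 (Z\<^sub>2 m)" "\<And>m. Z\<^sub>3 (Z\<^sub>1 m) = Z\<^sub>1 (Z\<^sub>3 m)" "\<And>m. Z\<^sub>3 (Z\<^sub>2 m) = Z\<^sub>2 (Z\<^sub>3 m)"
    and simple: "simple_action (poly_ext (poly_ext (poly_ext scale Z\<^sub>1) Z\<^sub>2) Z\<^sub>3)"
    and G: "goldman (annihilator (poly_ext (poly_ext (poly_ext scale Z\<^sub>1) Z\<^sub>2) Z\<^sub>3))"
  shows "\<exists>\<gamma>. \<forall>m. Z\<^sub>1 m = scale \<gamma> m"
proof -
  let ?\<phi>\<^sub>1 = "poly_ext scale Z\<^sub>1"
  let ?\<phi>\<^sub>2 = "poly_ext ?\<phi>\<^sub>1 Z\<^sub>2"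
  let ?\<phi>\<^sub>3 = "poly_ext ?\<phi>\<^sub>2 Z\<^sub>3"
  interpret simple_action ?\<phi>\<^sub>3 by (rule simple)
  have h2: "module_hom ?\<phi>\<^sub>1 ?\<phi>\<^sub>1 Z\<^sub>2" "module_hom ?\<phi>\<^sub>1 ?\<phi>\<^sub>1 Z\<^sub>3"
    using hom comm by (auto intro: module_hom_poly_ext)
  have h3: "module_hom ?\<phi>\<^sub>2 ?\<phi>\<^sub>2 Z\<^sub>3" using h2 comm by (auto intro: module_hom_poly_ext)
  have p2: "prime_set (annihilator ?\<phi>\<^sub>2)" "goldman (annihilator ?\<phi>\<^sub>2)"
    using prime_set_P0[OF prime_set_ann] goldman_coefficients[OF prime_set_ann G] annihilator_coeffs[OF h3] by auto
  have p1: "prime_set (annihilator ?\<phi>\<^sub>1)" "goldman (annihilator ?\<phi>\<^sub>1)"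
    using prime_set_P0[OF p2(1)] goldman_coefficients[OF p2] annihilator_coeffs[OF h2(1)] by auto
  obtain g where "g \<in> annihilator ?\<phi>\<^sub>1" "lead_coeff g \<notin> contraction (annihilator ?\<phi>\<^sub>1)"
    using goldman_algebraic[OF p1] .
  moreover have "0 \<in> contraction (annihilator ?\<phi>\<^sub>1)" using prime_set_P0[OF p1(1)] by (rule prime_setD(1))
  ultimately obtain \<gamma> where "[:- \<gamma>, 1:] \<in> annihilator ?\<phi>\<^sub>1"
    using linear_factor_in_prime_set[OF p1(1)] by fastforce
  then have "scale (- \<gamma>) m + Z\<^sub>1 (scale 1 m + Z\<^sub>1 0) = 0" for m
    by (simp add: annihilator_def poly_ext_pCons[OF hom(1)] poly_ext_0[OF hom(1)])
  moreover interpret Z1: module_hom scale scale Z\<^sub>1 by (rule hom)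
  have "Z\<^sub>1 m = scale \<gamma> m" if "scale (- \<gamma>) m + Z\<^sub>1 (scale 1 m + Z\<^sub>1 0) = 0" for m
    using that by (simp add: Z1.m1.scale_minus_left neg_eq_iff_add_eq_0)
  ultimately show ?thesis by blast
qed

section \<open>The central operators are scalars\<close>

text \<open>
  Irreducible \<open>H\<^sub>\<beta>\<close>-modules in terms of the operators by which the generators act; the primed
  operators are the inverses, and the Greek letters \<open>\<xi>\<close> and \<open>\<eta>\<close> stand for the
  actions of \<open>x\<close> and \<open>y\<close>.
\<close>

locale H_operators = Vector_Spaces.vector_space scale
  for scale :: "'k::{alg_closed_field, field_char_0} \<Rightarrow> 'm::ab_group_add \<Rightarrow> 'm" +
  fixes n n\<^sub>1 :: nat and q \<beta>\<^sub>1 \<beta>\<^sub>2 \<beta>\<^sub>3 :: 'k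
    and A A' B B' C C' \<xi> \<eta> :: "'m \<Rightarrow> 'm"
  assumes n2: "n \<ge> 2" and root: "primitive_root n q"
    and hom: "module_hom scale scale A" "module_hom scale scale A'" "module_hom scale scale B"
      "module_hom scale scale B'" "module_hom scale scale C" "module_hom scale scale C'"
      "module_hom scale scale \<xi>" "module_hom scale scale \<eta>"
    and inv: "A (A' v) = v" "A' (A v) = v" "B (B' v) = v" "B' (B v) = v" "C (C' v) = v" "C' (C v) = v"
    and comm: "B (A v) = A (B v)" "C (A v) = A (C v)" "C (B v) = B (C v)"
      "\<xi> (B v) = B (\<xi> v)" "\<xi> (C v) = C (\<xi> v)" "\<eta> (B v) = B (\<eta> v)" "\<eta> (C v) = C (\<eta> v)"
    and XA: "\<xi> (A v) = scale q (A (\<xi> v))"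
    and YA: "\<eta> (A v) = scale (inverse q) (A (\<eta> v))"
    and YX: "\<eta> (\<xi> v) = scale (inverse q ^ n\<^sub>1) (\<xi> (\<eta> v)) + scale \<beta>\<^sub>3 ((A ^^ (2 * n\<^sub>1)) v - B (C v))"
    and Xn: "(\<xi> ^^ n) v = scale \<beta>\<^sub>1 ((A ^^ (n * n\<^sub>1)) v - (B ^^ n) v)"
    and Yn: "(\<eta> ^^ n) v = scale \<beta>\<^sub>2 ((A ^^ (n * n\<^sub>1)) v - (C ^^ n) v)"
    and nonzero: "\<exists>v::'m. v \<noteq> 0"
    and irreducible: "subspace U \<Longrightarrow> (\<And>g u. g \<in> {A, A', B, B', C, C', \<xi>, \<eta>} \<Longrightarrow> u \<in> U \<Longrightarrow> g u \<in> U)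
      \<Longrightarrow> U = {0} \<or> U = UNIV"
begin

abbreviation "gens \<equiv> {A, A', B, B', C, C', \<xi>, \<eta>}"

lemma q_root: "q ^ n = 1" "q \<noteq> 0" and n0: "n > 0"
  using root n2 by (auto simp: primitive_root_def power_0_left)

lemma hom_gens: "g \<in> gens \<Longrightarrow> module_hom scale scale g"
  using hom by auto

lemmas hom_add = module_hom.add[OF hom(1)] module_hom.add[OF hom(2)] module_hom.add[OF hom(3)] module_hom.add[OF hom(4)]
  module_hom.add[OF hom(5)] module_hom.add[OF hom(6)] module_hom.add[OF hom(7)] module_hom.add[OF hom(8)]
lemmas hom_scale = module_hom.scale[OF hom(1)] module_hom.scale[OF hom(2)] module_hom.scale[OF hom(3)] module_hom.scale[OF hom(4)]
  module_hom.scale[OF hom(5)] module_hom.scale[OF hom(6)] module_hom.scale[OF hom(7)] module_hom.scale[OF hom(8)]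

lemma inj_ops: "A v = A w \<longleftrightarrow> v = w" "B v = B w \<longleftrightarrow> v = w" "C v = C w \<longleftrightarrow> v = w"
  using inv by metis+

lemma comm_inv: "B' (A v) = A (B' v)" "C' (A v) = A (C' v)" "C' (B v) = B (C' v)" "C (A' v) = A' (C v)"
  "B (A' v) = A' (B v)" "C (B' v) = B' (C v)" "\<xi> (B' v) = B' (\<xi> v)" "\<xi> (C' v) = C' (\<xi> v)" "\<eta> (B' v) = B' (\<eta> v)" "\<eta> (C' v) = C' (\<eta> v)"
  by (metis inv comm)+

lemma funpow_scale: "module_hom scale scale L \<Longrightarrow> (L ^^ i) (scale c v) = scale c ((L ^^ i) v)"
  by (induction i) (auto simp: module_hom.scale)

lemma funpow_comm: "(\<And>v. L (T v) = T (L v)) \<Longrightarrow> (L ^^ i) (T v) = T ((L ^^ i) v)"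
  by (induction i) auto

lemma XA_pow: "\<xi> ((A ^^ i) v) = scale (q ^ i) ((A ^^ i) (\<xi> v))"
  by (induction i) (auto simp: XA hom_scale mult.commute)

lemma YA_pow: "\<eta> ((A ^^ i) v) = scale (inverse q ^ i) ((A ^^ i) (\<eta> v))"
  by (induction i) (auto simp: YA hom_scale mult.commute)

text \<open>
  The action of the central element \<open>a\<^sup>n\<close>.
\<close>

definition "Z = A ^^ n"

text \<open>
  Endomorphisms that commute with the action of the algebra.
\<close>

definition central :: "('m \<Rightarrow> 'm) \<Rightarrow> bool" where
  "central L \<longleftrightarrow> module_hom scale scale L \<and> (\<forall>g\<in>gens. \<forall>v. L (g v) = g (L v))"

lemma centralD: "central L \<Longrightarrow> module_hom scale scale L" "central L \<Longrightarrow> g \<in> gens \<Longrightarrow> L (g v) = g (L v)"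
  by (auto simp: central_def)

lemma module_homI:
  "(\<And>u v. L (u + v) = L u + L v) \<Longrightarrow> (\<And>c v. L (scale c v) = scale c (L v)) \<Longrightarrow> module_hom scale scale L"
  by unfold_locales auto

lemma hom_funpow: "module_hom scale scale L \<Longrightarrow> module_hom scale scale (L ^^ i)"
  by (induction i) (auto intro!: module_homI simp: module_hom.add module_hom.scale)

lemma central_scale: "central (scale c)"
  unfolding central_def using hom_scale by (auto intro!: module_homI simp: scale_right_distrib mult.commute)

lemma central_B: "central B"
  unfolding central_def using hom comm comm_inv inv by auto

lemma central_C: "central C"
  unfolding central_def using hom comm comm_inv inv by auto

lemma central_Z: "central Z"
proof -
  have "Z (A' v) = A' (Z v)" for v unfolding Z_def by (rule funpow_comm) (simp add: inv)
  moreover have "Z (B v) = B (Z v)" "Z (B' v) = B' (Z v)" "Z (C v) = C (Z v)" "Z (C' v) = C' (Z v)" "Z (A v) = A (Z v)" for v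
    unfolding Z_def by (rule funpow_comm, simp add: comm comm_inv)+
  moreover have "Z (\<xi> v) = \<xi> (Z v)" "Z (\<eta> v) = \<eta> (Z v)" for v
    by (auto simp: Z_def XA_pow YA_pow q_root power_inverse)
  moreover have "module_hom scale scale Z" unfolding Z_def using hom by (intro hom_funpow) auto
  ultimately show ?thesis unfolding central_def by auto
qed

lemma central_poly_ext:
  assumes T: "module_hom \<phi> \<phi> T" "central T" and \<phi>: "\<And>r. central (\<phi> r)"
  shows "central (poly_ext \<phi> T p)"
proof (induction p)
  case 0
  show ?case using hom[THEN module_hom.zero]
    by (auto simp: central_def poly_ext_0[OF T(1)] intro!: module_homI)
next
  case (pCons r p)
  note 1 = centralD(1)[OF pCons.IH] and 2 = centralD(1)[OF T(2)] and 3 = centralD(1)[OF \<phi>[of r]]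
  note c = centralD(2)[OF pCons.IH] centralD(2)[OF T(2)] centralD(2)[OF \<phi>[of r]]
  have "module_hom scale scale (poly_ext \<phi> T (pCons r p))"
    by (rule module_homI)
      (auto simp: poly_ext_pCons[OF T(1)] module_hom.add[OF 1] module_hom.add[OF 2] module_hom.add[OF 3]
       module_hom.scale[OF 1] module_hom.scale[OF 2] module_hom.scale[OF 3] scale_right_distrib)
  moreover have "poly_ext \<phi> T (pCons r p) (g v) = g (poly_ext \<phi> T (pCons r p) v)" if "g \<in> gens" for g v
    using module_hom.add[OF hom_gens[OF that]] by (simp add: poly_ext_pCons[OF T(1)] c[OF that])
  ultimately show ?case by (auto simp: central_def)
qed

text \<open>
  Schur's lemma.
\<close>

lemma zero_or_bij:
  assumes L: "central L"
  shows "(\<forall>m. L m = 0) \<or> bij L"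
proof -
  interpret L: module_hom scale scale L using L by (rule centralD)
  have "{m. L m = 0} = {0} \<or> {m. L m = 0} = UNIV"
    using centralD(2)[OF L] hom_gens[THEN module_hom.zero]
    by (intro irreducible L.subspace_kernel) auto
  moreover have "range L = {0} \<or> range L = UNIV"
  proof (rule irreducible)
    show "subspace (range L)" using L.subspace_image[OF subspace_UNIV] .
    show "g u \<in> range L" if "g \<in> gens" "u \<in> range L" for g u
      using centralD(2)[OF L that(1), symmetric] that(2) by auto
  qed
  moreover have "inj L" if "{m. L m = 0} = {0}" using that by (auto simp: L.inj_iff_eq_0)
  ultimately show ?thesis unfolding bij_def by blast
qed

text \<open>
  The action of polynomials in three central operators. The innermost variable acts as \<open>Z\<^sub>1\<close>, the
  outermost as \<open>Z\<^sub>3\<close>.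
\<close>

abbreviation "ext3 Z\<^sub>1 Z\<^sub>2 Z\<^sub>3 \<equiv> poly_ext (poly_ext (poly_ext scale Z\<^sub>1) Z\<^sub>2) Z\<^sub>3"

lemma ext3:
  assumes c: "central Z\<^sub>1" "central Z\<^sub>2" "central Z\<^sub>3"
    and comm3: "\<And>v. Z\<^sub>2 (Z\<^sub>1 v) = Z\<^sub>1 (Z\<^sub>2 v)" "\<And>v. Z\<^sub>3 (Z\<^sub>1 v) = Z\<^sub>1 (Z\<^sub>3 v)" "\<And>v. Z\<^sub>3 (Z\<^sub>2 v) = Z\<^sub>2 (Z\<^sub>3 v)"
  shows "module_hom (poly_ext scale Z\<^sub>1) (poly_ext scale Z\<^sub>1) Z\<^sub>2"
    "module_hom (poly_ext (poly_ext scale Z\<^sub>1) Z\<^sub>2) (poly_ext (poly_ext scale Z\<^sub>1) Z\<^sub>2) Z\<^sub>3"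
    "central (ext3 Z\<^sub>1 Z\<^sub>2 Z\<^sub>3 p)" "simple_action (ext3 Z\<^sub>1 Z\<^sub>2 Z\<^sub>3)"
    "g \<in> gens \<Longrightarrow> module_hom (ext3 Z\<^sub>1 Z\<^sub>2 Z\<^sub>3) (ext3 Z\<^sub>1 Z\<^sub>2 Z\<^sub>3) g"
    "ext3 Z\<^sub>1 Z\<^sub>2 Z\<^sub>3 [:[:[:0, 1:]:]:] = Z\<^sub>1" "ext3 Z\<^sub>1 Z\<^sub>2 Z\<^sub>3 [:[:0, 1:]:] = Z\<^sub>2" "ext3 Z\<^sub>1 Z\<^sub>2 Z\<^sub>3 [:0, 1:] = Z\<^sub>3"
    "ext3 Z\<^sub>1 Z\<^sub>2 Z\<^sub>3 [:[:[:c:]:]:] = scale c"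
proof -
  note h = c[THEN centralD(1)]
  have h1: "module_hom (poly_ext scale Z\<^sub>1) (poly_ext scale Z\<^sub>1) Z\<^sub>2" "module_hom (poly_ext scale Z\<^sub>1) (poly_ext scale Z\<^sub>1) Z\<^sub>3"
    using h comm3 by (auto intro: module_hom_poly_ext)
  then show "module_hom (poly_ext scale Z\<^sub>1) (poly_ext scale Z\<^sub>1) Z\<^sub>2" by simp
  show h2: "module_hom (poly_ext (poly_ext scale Z\<^sub>1) Z\<^sub>2) (poly_ext (poly_ext scale Z\<^sub>1) Z\<^sub>2) Z\<^sub>3"
    using h1 comm3 by (auto intro: module_hom_poly_ext)
  show cen: "central (ext3 Z\<^sub>1 Z\<^sub>2 Z\<^sub>3 p)" for p
    by (intro central_poly_ext h h1 h2 c central_scale)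
  interpret M3: Modules.module "ext3 Z\<^sub>1 Z\<^sub>2 Z\<^sub>3" using h2 by (rule module_poly_ext)
  show "simple_action (ext3 Z\<^sub>1 Z\<^sub>2 Z\<^sub>3)"
    by unfold_locales (use zero_or_bij[OF cen] nonzero in auto)
  show "module_hom (ext3 Z\<^sub>1 Z\<^sub>2 Z\<^sub>3) (ext3 Z\<^sub>1 Z\<^sub>2 Z\<^sub>3) g" if "g \<in> gens"
    by unfold_locales (use module_hom.add[OF hom_gens[OF that]] centralD(2)[OF cen that] in auto)
  have 1: "poly_ext (poly_ext scale Z\<^sub>1) Z\<^sub>2 [:r:] = poly_ext scale Z\<^sub>1 r" for r
    using module_hom.zero[OF h1(1)] by (simp add: fun_eq_iff poly_ext_pCons[OF h1(1)] poly_ext_0[OF h1(1)])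
  have 2: "ext3 Z\<^sub>1 Z\<^sub>2 Z\<^sub>3 [:r:] = poly_ext (poly_ext scale Z\<^sub>1) Z\<^sub>2 r" for r
    using module_hom.zero[OF h2] by (simp add: fun_eq_iff poly_ext_pCons[OF h2] poly_ext_0[OF h2])
  have 3: "poly_ext scale Z\<^sub>1 [:r:] = scale r" for r
    using module_hom.zero[OF h(1)] by (simp add: fun_eq_iff poly_ext_pCons[OF h(1)] poly_ext_0[OF h(1)])
  show "ext3 Z\<^sub>1 Z\<^sub>2 Z\<^sub>3 [:[:[:c:]:]:] = scale c" by (simp add: 1 2 3)
  interpret M1: Modules.module "poly_ext scale Z\<^sub>1" using h(1) by (rule module_poly_ext)
  interpret M2: Modules.module "poly_ext (poly_ext scale Z\<^sub>1) Z\<^sub>2" using h1(1) by (rule module_poly_ext)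
  show "ext3 Z\<^sub>1 Z\<^sub>2 Z\<^sub>3 [:[:[:0, 1:]:]:] = Z\<^sub>1"
    unfolding 1 2 using module_hom.zero[OF h(1)] by (simp add: fun_eq_iff poly_ext_pCons[OF h(1)] poly_ext_0[OF h(1)])
  show "ext3 Z\<^sub>1 Z\<^sub>2 Z\<^sub>3 [:[:0, 1:]:] = Z\<^sub>2"
    unfolding 2 using module_hom.zero[OF h1(1)] by (simp add: fun_eq_iff poly_ext_pCons[OF h1(1)] poly_ext_0[OF h1(1)])
  show "ext3 Z\<^sub>1 Z\<^sub>2 Z\<^sub>3 [:0, 1:] = Z\<^sub>3"
    using module_hom.zero[OF h2] by (simp add: fun_eq_iff poly_ext_pCons[OF h2] poly_ext_0[OF h2])
qed

text \<open>
  The submodule spanned by the vectors \<open>e i l m\<close> over the polynomial ring is closed under \<open>A,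
  \<xi>, \<eta>\<close>. It need not be closed under the inverse operators, but the vectors that a power of \<open>u =
  Z B C\<close> maps into it form an invariant subspace. The three orders of the central operators are needed to show
  in turn that each of them is a scalar.
\<close>

lemma finitely_generated:
  assumes perm: "[Z\<^sub>1, Z\<^sub>2, Z\<^sub>3] \<in> {[Z, B, C], [B, Z, C], [C, Z, B]}"
  shows "\<exists>S. finite S \<and> (\<forall>m. \<exists>N. ext3 Z\<^sub>1 Z\<^sub>2 Z\<^sub>3 (([:[:[:0, 1:]:]:] * [:[:0, 1:]:] * [:0, 1:]) ^ N) m
      \<in> Modules.module.span (ext3 Z\<^sub>1 Z\<^sub>2 Z\<^sub>3) S)"
    and "simple_action (ext3 Z\<^sub>1 Z\<^sub>2 Z\<^sub>3)"
    and "\<And>v. Z\<^sub>2 (Z\<^sub>1 v) = Z\<^sub>1 (Z\<^sub>2 v)" "\<And>v. Z\<^sub>3 (Z\<^sub>1 v) = Z\<^sub>1 (Z\<^sub>3 v)" "\<And>v. Z\<^sub>3 (Z\<^sub>2 v) = Z\<^sub>2 (Z\<^sub>3 v)"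
    and "bij (ext3 Z\<^sub>1 Z\<^sub>2 Z\<^sub>3 ([:[:[:0, 1:]:]:] * [:[:0, 1:]:] * [:0, 1:]))"
proof -
  have ZBC: "C (Z v) = Z (C v)" "B (Z v) = Z (B v)" "A (Z v) = Z (A v)" for v
    using central_Z by (auto simp: central_def)
  have c: "central Z\<^sub>1" "central Z\<^sub>2" "central Z\<^sub>3" using perm central_Z central_B central_C by auto
  show comm3: "\<And>v. Z\<^sub>2 (Z\<^sub>1 v) = Z\<^sub>1 (Z\<^sub>2 v)" "\<And>v. Z\<^sub>3 (Z\<^sub>1 v) = Z\<^sub>1 (Z\<^sub>3 v)" "\<And>v. Z\<^sub>3 (Z\<^sub>2 v) = Z\<^sub>2 (Z\<^sub>3 v)"
    using perm by (auto simp: ZBC comm)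
  note E = ext3[OF c comm3]
  show "simple_action (ext3 Z\<^sub>1 Z\<^sub>2 Z\<^sub>3)" using E(4) .
  interpret M3: simple_action "ext3 Z\<^sub>1 Z\<^sub>2 Z\<^sub>3" by (rule E(4))
  define u where "u = [:[:[:0, 1:]:]:] * [:[:0, 1:]:] * [:0, 1 :: 'k poly poly:]"
  have u: "ext3 Z\<^sub>1 Z\<^sub>2 Z\<^sub>3 u m = Z (B (C m))" for m
  proof -
    have "ext3 Z\<^sub>1 Z\<^sub>2 Z\<^sub>3 u m = Z\<^sub>1 (Z\<^sub>2 (Z\<^sub>3 m))"
      unfolding u_def using E(6-8) by (simp only: M3.scale_scale[symmetric])
    then show ?thesis using perm by (auto simp: ZBC comm)
  qed
  have Z0: "Z v = 0 \<Longrightarrow> v = 0" for v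
  proof -
    have "(A ^^ i) v = 0 \<Longrightarrow> v = 0" for i using inj_ops(1)[of _ 0] hom(1)[THEN module_hom.zero] by (induction i) auto
    then show "Z v = 0 \<Longrightarrow> v = 0" by (simp add: Z_def)
  qed
  have "bij (ext3 Z\<^sub>1 Z\<^sub>2 Z\<^sub>3 u)"
    using M3.zero_or_bij[of u] nonzero Z0 inj_ops(2,3)[of _ 0] hom(3,5)[THEN module_hom.zero] by (auto simp: u)
  then show "bij (ext3 Z\<^sub>1 Z\<^sub>2 Z\<^sub>3 ([:[:[:0, 1:]:]:] * [:[:0, 1:]:] * [:0, 1:]))" by (simp only: u_def)
  obtain v :: 'm where v: "v \<noteq> 0" using nonzero by blast
  define e where "e = (\<lambda>i l m. (A ^^ i) ((\<xi> ^^ l) ((\<eta> ^^ m) v)))"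
  define S where "S = (\<lambda>(i, l, m). e i l m) ` ({..<n} \<times> {..<n} \<times> {..<n})"
  have S: "finite S" by (simp add: S_def)
  have eS: "e i l m \<in> M3.span S" if "i < n" "l < n" "m < n" for i l m
    using that by (intro M3.span_base) (auto simp: S_def intro!: image_eqI[of _ _ "(i, l, m)"])
  have sc: "scale c w \<in> M3.span S" if "w \<in> M3.span S" for c w
    using M3.span_scale[OF that, of "[:[:[:c:]:]:]"] by (simp only: E(9))
  have cl3: "Z\<^sub>1 w \<in> M3.span S" "Z\<^sub>2 w \<in> M3.span S" "Z\<^sub>3 w \<in> M3.span S" if "w \<in> M3.span S" for w
    using M3.span_scale[OF that, of "[:[:[:0, 1:]:]:]"] M3.span_scale[OF that, of "[:[:0, 1:]:]"]
      M3.span_scale[OF that, of "[:0, 1:]"] by (simp_all only: E(6-8))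
  then have clZ: "Z w \<in> M3.span S" "B w \<in> M3.span S" "C w \<in> M3.span S" if "w \<in> M3.span S" for w
    using perm that by auto
  have gen_closed: "g w \<in> M3.span S" if "g \<in> gens" "\<And>s. s \<in> S \<Longrightarrow> g s \<in> M3.span S" "w \<in> M3.span S" for g w
  proof -
    interpret g: module_hom "ext3 Z\<^sub>1 Z\<^sub>2 Z\<^sub>3" "ext3 Z\<^sub>1 Z\<^sub>2 Z\<^sub>3" g using E(5)[OF that(1)] .
    have "g ` S \<subseteq> M3.span S" using that(2) by auto
    then have "M3.span (g ` S) \<subseteq> M3.span S" by (rule M3.span_minimal[OF _ M3.subspace_span])
    then show ?thesis using g.span_image[of S] that(3) by auto
  qed
  have pow: "(L ^^ i) w \<in> M3.span S" if "\<And>w. w \<in> M3.span S \<Longrightarrow> L w \<in> M3.span S" "w \<in> M3.span S" for L i w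
    using that by (induction i) auto
  have A: "A w \<in> M3.span S" if "w \<in> M3.span S" for w
  proof (rule gen_closed[OF _ _ that])
    fix s assume "s \<in> S"
    then obtain i l m where s: "s = e i l m" "i < n" "l < n" "m < n" by (auto simp: S_def)
    show "A s \<in> M3.span S"
    proof (cases "Suc i < n")
      case True
      then show ?thesis using eS[of "Suc i" l m] s by (simp add: e_def)
    next
      case False
      then have "n = Suc i" using s by simp
      then have "Z w = A ((A ^^ i) w)" for w unfolding Z_def by (simp only: funpow.simps comp_apply)
      then have "A s = Z (e 0 l m)" using s by (simp add: e_def)
      then show ?thesis using clZ eS s n0 by auto
    qed
  qed simp
  have powA: "(A ^^ i) w \<in> M3.span S" if "w \<in> M3.span S" for i w using pow[OF A that] .
  have Xn': "(\<xi> ^^ n) w \<in> M3.span S" "(\<eta> ^^ n) w \<in> M3.span S" if "w \<in> M3.span S" for w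
    unfolding Xn Yn using that A clZ by (auto intro!: sc M3.span_diff pow)
  have \<xi>: "\<xi> w \<in> M3.span S" if "w \<in> M3.span S" for w
  proof (rule gen_closed[OF _ _ that])
    fix s assume "s \<in> S"
    then obtain i l m where s: "s = e i l m" "i < n" "l < n" "m < n" by (auto simp: S_def)
    have "(A ^^ i) (\<xi> ((\<xi> ^^ l) ((\<eta> ^^ m) v))) \<in> M3.span S"
    proof (cases "Suc l < n")
      case True
      then show ?thesis using eS[of i "Suc l" m] s by (simp add: e_def)
    next
      case False
      then have "n = Suc l" using s by simp
      then have "\<xi> ((\<xi> ^^ l) ((\<eta> ^^ m) v)) = (\<xi> ^^ n) (e 0 0 m)" using s by (simp add: e_def)
      moreover have "(\<xi> ^^ n) (e 0 0 m) \<in> M3.span S" using s n0 by (intro Xn' eS) auto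
      ultimately show ?thesis using powA by simp
    qed
    then show "\<xi> s \<in> M3.span S" using s sc by (simp add: e_def XA_pow)
  qed simp
  have \<eta>: "\<eta> w \<in> M3.span S" if "w \<in> M3.span S" for w
  proof (rule gen_closed[OF _ _ that])
    fix s assume "s \<in> S"
    then obtain i l m where s: "s = e i l m" "i < n" "l < n" "m < n" by (auto simp: S_def)
    have e0: "(\<xi> ^^ l) ((\<eta> ^^ m) v) \<in> M3.span S" for l
      using eS[of 0 0 m] s n0 pow[OF \<xi>] by (simp add: e_def)
    have "\<eta> ((\<xi> ^^ l) ((\<eta> ^^ m) v)) \<in> M3.span S" for l
    proof (induction l)
      case 0
      show ?case
      proof (cases "Suc m < n")
        case True
        then show ?thesis using eS[of 0 0 "Suc m"] s n0 by (simp add: e_def)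
      next
        case False
        then have "n = Suc m" using s by simp
        then have "\<eta> ((\<eta> ^^ m) v) = (\<eta> ^^ n) (e 0 0 0)" by (simp add: e_def)
        then show ?thesis using Xn' eS n0 by auto
      qed
    next
      case (Suc l)
      show ?case using Suc e0 by (auto simp: YX intro!: M3.span_add M3.span_diff sc \<xi> powA clZ)
    qed
    then have "(A ^^ i) (\<eta> ((\<xi> ^^ l) ((\<eta> ^^ m) v))) \<in> M3.span S" by (auto intro!: powA)
    then show "\<eta> s \<in> M3.span S" using s sc by (simp add: e_def YA_pow)
  qed simp
  define W where "W = {m. \<exists>N. ext3 Z\<^sub>1 Z\<^sub>2 Z\<^sub>3 (u ^ N) m \<in> M3.span S}"
  have WI: "m \<in> W" if "ext3 Z\<^sub>1 Z\<^sub>2 Z\<^sub>3 (u ^ N) m \<in> M3.span S" for m N using that by (auto simp: W_def)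
  have more: "ext3 Z\<^sub>1 Z\<^sub>2 Z\<^sub>3 (u ^ (N + N')) m \<in> M3.span S" if "ext3 Z\<^sub>1 Z\<^sub>2 Z\<^sub>3 (u ^ N) m \<in> M3.span S" for N N' m
    using M3.span_scale[OF that, of "u ^ N'"] by (simp add: power_add mult.commute)
  have "W = {0} \<or> W = UNIV"
  proof (rule irreducible)
    have "w + w' \<in> W" if "w \<in> W" "w' \<in> W" for w w'
    proof -
      from that obtain N N' where "ext3 Z\<^sub>1 Z\<^sub>2 Z\<^sub>3 (u ^ N) w \<in> M3.span S" "ext3 Z\<^sub>1 Z\<^sub>2 Z\<^sub>3 (u ^ N') w' \<in> M3.span S"
        by (auto simp: W_def)
      from more[OF this(1), of N'] more[OF this(2), of N] show ?thesis
        by (intro WI[of "N + N'"]) (auto simp: M3.scale_right_distrib add.commute intro!: M3.span_add)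
    qed
    moreover have "scale c w \<in> W" if "w \<in> W" for c w
    proof -
      from that obtain N where N: "ext3 Z\<^sub>1 Z\<^sub>2 Z\<^sub>3 (u ^ N) w \<in> M3.span S" by (auto simp: W_def)
      show ?thesis using sc[OF N, of c] by (intro WI[of N]) (simp add: module_hom.scale[OF centralD(1)[OF E(3)]])
    qed
    moreover have "0 \<in> W" by (rule WI[of 0]) (simp add: M3.span_zero)
    ultimately show "subspace W" by (auto simp: subspace_def)
    fix g w assume g: "g \<in> gens" and w: "w \<in> W"
    then obtain N where N: "ext3 Z\<^sub>1 Z\<^sub>2 Z\<^sub>3 (u ^ N) w \<in> M3.span S" by (auto simp: W_def)
    let ?w = "ext3 Z\<^sub>1 Z\<^sub>2 Z\<^sub>3 (u ^ N) w"
    have "ext3 Z\<^sub>1 Z\<^sub>2 Z\<^sub>3 (u ^ Suc N) (g w) = ext3 Z\<^sub>1 Z\<^sub>2 Z\<^sub>3 u (ext3 Z\<^sub>1 Z\<^sub>2 Z\<^sub>3 (u ^ N) (g w))" by simp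
    also have "\<dots> = Z (B (C (g ?w)))" unfolding u by (simp only: centralD(2)[OF E(3) g])
    finally have *: "ext3 Z\<^sub>1 Z\<^sub>2 Z\<^sub>3 (u ^ Suc N) (g w) = Z (B (C (g ?w)))" .
    have "A ^^ n = A ^^ (n - 1) \<circ> A" using n0 funpow_Suc_right[of "n - 1" A] by simp
    then have ZA': "Z (A' w') = (A ^^ (n - 1)) w'" for w' by (simp add: Z_def inv)
    consider "g = A'" | "g = B'" | "g = C'" | "g \<in> {A, B, C, \<xi>, \<eta>}" using g by auto
    then have "Z (B (C (g ?w))) \<in> M3.span S"
    proof cases
      case 1
      then have "Z (B (C (g ?w))) = (A ^^ (n - 1)) (B (C ?w))" by (simp add: comm_inv ZA')
      then show ?thesis using powA clZ N by simp
    next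
      case 2
      then have "Z (B (C (g ?w))) = Z (C ?w)" by (simp add: comm_inv inv)
      then show ?thesis using clZ N by simp
    next
      case 3
      then have "Z (B (C (g ?w))) = Z (B ?w)" by (simp add: inv)
      then show ?thesis using clZ N by simp
    next
      case 4
      then have "g ?w \<in> M3.span S" using clZ N A \<xi> \<eta> by auto
      then show ?thesis using clZ by simp
    qed
    then show "g w \<in> W" unfolding *[symmetric] by (rule WI)
  qed
  moreover have "v \<in> W" using eS[of 0 0 0] n0 by (intro WI[of 0]) (simp add: e_def)
  ultimately have "W = UNIV" using v by auto
  then have all: "\<forall>m. \<exists>N. ext3 Z\<^sub>1 Z\<^sub>2 Z\<^sub>3 (u ^ N) m \<in> M3.span S" by (auto simp: W_def)
  then show "\<exists>S. finite S \<and> (\<forall>m. \<exists>N. ext3 Z\<^sub>1 Z\<^sub>2 Z\<^sub>3 (([:[:[:0, 1:]:]:] * [:[:0, 1:]:] * [:0, 1:]) ^ N) m \<in> M3.span S)"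
    by (intro exI[of _ S] conjI S all[unfolded u_def])
qed

lemma scalar_if:
  assumes "[Z\<^sub>1, Z\<^sub>2, Z\<^sub>3] \<in> {[Z, B, C], [B, Z, C], [C, Z, B]}"
  shows "\<exists>\<gamma>. \<forall>m. Z\<^sub>1 m = scale \<gamma> m"
proof -
  note F = finitely_generated[OF assms]
  have c: "central Z\<^sub>1" "central Z\<^sub>2" "central Z\<^sub>3" using assms central_Z central_B central_C by auto
  interpret M3: simple_action "ext3 Z\<^sub>1 Z\<^sub>2 Z\<^sub>3" by (rule F(2))
  obtain S where "finite S" "\<And>m. \<exists>N. ext3 Z\<^sub>1 Z\<^sub>2 Z\<^sub>3 (([:[:[:0, 1:]:]:] * [:[:0, 1:]:] * [:0, 1:]) ^ N) m \<in> M3.span S"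
    using F(1) by blast
  then have G: "goldman (annihilator (ext3 Z\<^sub>1 Z\<^sub>2 Z\<^sub>3))" using M3.goldman_ann F(6) by blast
  show ?thesis by (rule goldman_imp_scalar[OF c[THEN centralD(1)] F(3-5) F(2) G])
qed

lemma central_scalars:
  obtains \<gamma>\<^sub>1 \<gamma>\<^sub>2 \<gamma>\<^sub>3 where "\<gamma>\<^sub>1 \<noteq> 0" "\<gamma>\<^sub>2 \<noteq> 0" "\<gamma>\<^sub>3 \<noteq> 0"
    "\<And>v. (A ^^ n) v = scale \<gamma>\<^sub>1 v" "\<And>v. B v = scale \<gamma>\<^sub>2 v" "\<And>v. C v = scale \<gamma>\<^sub>3 v"
proof -
  obtain \<gamma>\<^sub>1 \<gamma>\<^sub>2 \<gamma>\<^sub>3 where g: "\<And>v. Z v = scale \<gamma>\<^sub>1 v" "\<And>v. B v = scale \<gamma>\<^sub>2 v" "\<And>v. C v = scale \<gamma>\<^sub>3 v"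
    using scalar_if[of Z B C] scalar_if[of B Z C] scalar_if[of C Z B] by auto
  obtain v :: 'm where v: "v \<noteq> 0" using nonzero by blast
  have "(A ^^ i) v \<noteq> 0" for i using v inj_ops(1)[of _ 0] hom(1)[THEN module_hom.zero] by (induction i) auto
  then have "Z v \<noteq> 0" by (simp add: Z_def)
  moreover have "B v \<noteq> 0" "C v \<noteq> 0" using v inj_ops(2,3)[of _ 0] hom(3,5)[THEN module_hom.zero] by auto
  ultimately have "\<gamma>\<^sub>1 \<noteq> 0" "\<gamma>\<^sub>2 \<noteq> 0" "\<gamma>\<^sub>3 \<noteq> 0" using g by auto
  with that g show ?thesis by (auto simp: Z_def)
qed

text \<open>
  The polynomials in the central operators now act by scalars, so the finite set that generates the module over them
  spans it as a vector space.
\<close>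

lemma finite_dimensional: "\<exists>S. finite S \<and> span S = UNIV"
proof -
  obtain \<gamma>\<^sub>1 \<gamma>\<^sub>2 \<gamma>\<^sub>3 where g: "\<gamma>\<^sub>1 \<noteq> 0" "\<gamma>\<^sub>2 \<noteq> 0" "\<gamma>\<^sub>3 \<noteq> 0" "\<And>v. Z v = scale \<gamma>\<^sub>1 v" "\<And>v. B v = scale \<gamma>\<^sub>2 v" "\<And>v. C v = scale \<gamma>\<^sub>3 v"
    using central_scalars unfolding Z_def by metis
  have perm: "[Z, B, C] \<in> {[Z, B, C], [B, Z, C], [C, Z, B]}" by simp
  note F = finitely_generated[OF perm]
  note E = ext3[OF central_Z central_B central_C F(3-5)]
  interpret M3: simple_action "ext3 Z B C" by (rule F(2))
  have sc: "\<exists>\<kappa>. \<forall>m. poly_ext \<phi> T p m = scale \<kappa> m"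
    if T: "module_hom \<phi> \<phi> T" and \<phi>: "\<And>r. \<exists>\<kappa>. \<forall>m. \<phi> r m = scale \<kappa> m" and sT: "\<exists>\<kappa>. \<forall>m. T m = scale \<kappa> m"
    for \<phi> :: "'r::comm_ring_1 \<Rightarrow> 'm \<Rightarrow> 'm" and T p
  proof (induction p)
    case 0
    show ?case by (intro exI[of _ 0]) (simp add: poly_ext_0[OF T])
  next
    case (pCons r p)
    then obtain \<kappa> \<kappa>' \<kappa>'' where "\<forall>m. poly_ext \<phi> T p m = scale \<kappa> m" "\<forall>m. \<phi> r m = scale \<kappa>' m" "\<forall>m. T m = scale \<kappa>'' m"
      using \<phi>[of r] sT by auto
    then show ?case by (intro exI[of _ "\<kappa>' + \<kappa>'' * \<kappa>"], unfold poly_ext_pCons[OF T]) (simp add: scale_left_distrib)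
  qed
  have h: "module_hom scale scale Z" using central_Z by (rule centralD)
  have sc3: "\<exists>\<kappa>. \<forall>m. ext3 Z B C p m = scale \<kappa> m" for p
    by (intro sc[OF E(2)] sc[OF E(1)] sc[OF h]) (use g in auto)
  obtain S where S: "finite S" and gen: "\<And>m. \<exists>N. ext3 Z B C (([:[:[:0, 1:]:]:] * [:[:0, 1:]:] * [:0, 1:]) ^ N) m \<in> M3.span S"
    using F(1) by blast
  have sub: "M3.span S \<subseteq> span S"
  proof (rule M3.span_minimal)
    have "ext3 Z B C c m \<in> span S" if "m \<in> span S" for c m
      using sc3[of c] span_scale[OF that] by auto
    then show "M3.subspace (span S)"
      by (auto simp: M3.subspace_def span_add span_zero)
  qed (rule span_superset)
  have "m \<in> span S" for m
  proof -
    obtain N where N: "ext3 Z B C (([:[:[:0, 1:]:]:] * [:[:0, 1:]:] * [:0, 1:]) ^ N) m \<in> M3.span S" using gen by blast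
    obtain \<kappa> where \<kappa>: "\<And>m. ext3 Z B C (([:[:[:0, 1:]:]:] * [:[:0, 1:]:] * [:0, 1:]) ^ N) m = scale \<kappa> m" using sc3 by blast
    have "[:[:[:0, 1:]:]:] * [:[:0, 1:]:] * [:0, 1:] \<notin> annihilator (ext3 Z B C)"
      using F(6) nonzero by (metis M3.annD bij_pointE)
    then have "([:[:[:0, 1:]:]:] * [:[:0, 1:]:] * [:0, 1:]) ^ N \<notin> annihilator (ext3 Z B C)" using M3.AD(9) by blast
    then have "\<kappa> \<noteq> 0" using \<kappa> by (auto simp: annihilator_def)
    moreover have "scale \<kappa> m \<in> span S" using N sub unfolding \<kappa> by blast
    then have "scale (inverse \<kappa>) (scale \<kappa> m) \<in> span S" by (rule span_scale)
    ultimately show ?thesis by simp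
  qed
  then show ?thesis using S by blast
qed

end

section \<open>Eigenvectors and roots of unity\<close>

lemma poly_ext_monom:
  assumes "module_hom \<phi> \<phi> T"
  shows "poly_ext \<phi> T (monom r i) m = (T ^^ i) (\<phi> r m)"
  using poly_ext_pCons[OF assms] poly_ext_0[OF assms] module_hom.zero[OF assms]
    module.scale_zero_left[of \<phi>] assms
  by (induction i) (auto simp: monom_0 monom_Suc module_hom_def)

text \<open>
  A polynomial \<open>p\<close> of minimal degree with \<open>p(T) v = 0\<close> has a linear factor, and its cofactor
  maps \<open>v\<close> to an eigenvector.
\<close>

lemma eigenvector_in_subspace:
  fixes scale :: "'k::alg_closed_field \<Rightarrow> 'm::ab_group_add \<Rightarrow> 'm"
  assumes T: "module_hom scale scale T" and S: "finite S" "module.span scale S = UNIV"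
    and U: "module.subspace scale U" "\<And>u. u \<in> U \<Longrightarrow> T u \<in> U" and v: "v \<in> U" "v \<noteq> 0"
  obtains u \<mu> where "u \<in> U" "u \<noteq> 0" "T u = scale \<mu> u"
proof -
  interpret V: Vector_Spaces.vector_space scale
    using T by (auto simp: module_hom_def vector_space_def Modules.module_def)
  interpret T: module_hom scale scale T by (rule T)
  interpret E: Modules.module "poly_ext scale T" by (rule module_poly_ext[OF T])
  note ext = poly_ext_pCons[OF T] poly_ext_0[OF T]
  have Tpow: "(T ^^ i) (scale c u) = scale c ((T ^^ i) u)" for i c u by (induction i) (auto simp: T.scale)
  have "\<exists>p. p \<noteq> 0 \<and> poly_ext scale T p v = 0"
  proof (cases "inj_on (\<lambda>i. (T ^^ i) v) {..card S}")
    case True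
    let ?B = "(\<lambda>i. (T ^^ i) v) ` {..card S}"
    have "card ?B = Suc (card S)" using card_image[OF True] by simp
    then have "V.dependent ?B" using V.independent_span_bound[OF S(1), of ?B] S(2) by auto
    then obtain u where u: "\<exists>b\<in>?B. u b \<noteq> 0" "(\<Sum>b\<in>?B. scale (u b) b) = 0"
      by (subst (asm) V.dependent_finite) auto
    define p where "p = (\<Sum>i\<le>card S. monom (u ((T ^^ i) v)) i)"
    have "poly_ext scale T p v = (\<Sum>i\<le>card S. scale (u ((T ^^ i) v)) ((T ^^ i) v))"
      by (simp add: p_def E.scale_sum_left poly_ext_monom[OF T] Tpow)
    also have "\<dots> = 0" using u(2) by (simp add: sum.reindex[OF True])
    finally have "poly_ext scale T p v = 0" .
    moreover from u(1) obtain i where "i \<le> card S" "u ((T ^^ i) v) \<noteq> 0" by auto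
    then have "coeff p i \<noteq> 0" by (simp add: p_def coeff_sum)
    then have "p \<noteq> 0" by auto
    ultimately show ?thesis by blast
  next
    case False
    then obtain i j where ij: "i \<noteq> j" "(T ^^ i) v = (T ^^ j) v" by (auto simp: inj_on_def)
    let ?p = "monom 1 i - monom 1 j :: 'k poly"
    have "poly_ext scale T ?p v = 0" using ij by (simp add: E.scale_left_diff_distrib poly_ext_monom[OF T])
    moreover have "coeff ?p i = 1" using ij by simp
    then have "?p \<noteq> 0" by (metis coeff_0 zero_neq_one)
    ultimately show ?thesis by blast
  qed
  then obtain p0 where p0: "p0 \<noteq> 0 \<and> poly_ext scale T p0 v = 0" by blast
  from ex_has_least_nat[of "\<lambda>p. p \<noteq> 0 \<and> poly_ext scale T p v = 0", OF p0, of degree]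
  obtain p where p: "p \<noteq> 0" "poly_ext scale T p v = 0"
    and min: "\<And>p'. p' \<noteq> 0 \<Longrightarrow> poly_ext scale T p' v = 0 \<Longrightarrow> degree p \<le> degree p'" by blast
  have "degree p \<noteq> 0"
  proof
    assume "degree p = 0"
    then obtain c where "p = [:c:]" "c \<noteq> 0" using p(1) by (metis degree_0_id pCons_0_0)
    then show False using p(2) v by (simp add: ext)
  qed
  then obtain \<mu> where "poly p \<mu> = 0" using alg_closed_imp_poly_has_root by blast
  then obtain p' where p': "p = [:- \<mu>, 1:] * p'" by (metis dvdE poly_eq_0_iff_dvd)
  then have p'0: "p' \<noteq> 0" using p by auto
  define u where "u = poly_ext scale T p' v"
  have "degree p' < degree p" unfolding p' using p'0 by (subst degree_mult_eq) auto
  then have "u \<noteq> 0" unfolding u_def using min[OF p'0] by auto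
  moreover have "poly_ext scale T p' u \<in> U" if "u \<in> U" for u
    using that U by (induction p') (auto simp: ext V.subspace_def)
  then have "u \<in> U" using v by (simp add: u_def)
  moreover have "poly_ext scale T [:- \<mu>, 1:] u = 0" using p(2) by (simp add: p' u_def del: mult_pCons_left)
  then have "T u = scale \<mu> u" by (simp add: ext)
  ultimately show ?thesis using that by blast
qed

lemma primitive_root_inj:
  assumes "primitive_root n (q::'k::field)"
  shows "inj_on (\<lambda>i. q ^ i) {..<n}"
proof (rule linorder_inj_onI)
  have n: "n > 0" and qn: "q ^ n = 1" and min: "\<And>m. 0 < m \<Longrightarrow> m < n \<Longrightarrow> q ^ m \<noteq> 1"
    using assms by (auto simp: primitive_root_def)
  have q0: "q \<noteq> 0" using n qn by (auto simp: power_0_left)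
  fix i j assume "i < j" "j \<in> {..<n}"
  then have "q ^ j = q ^ i * q ^ (j - i)" by (simp flip: power_add)
  then show "q ^ i \<noteq> q ^ j" using min[of "j - i"] \<open>i < j\<close> \<open>j \<in> {..<n}\<close> q0 by auto
qed auto

lemma roots_of_unity:
  assumes "primitive_root n (q::'k::field)" "z ^ n = 1"
  shows "\<exists>i<n. z = q ^ i"
proof -
  note inj = primitive_root_inj[OF assms(1)]
  have n: "n > 0" and qn: "q ^ n = 1"
    using assms(1) by (auto simp: primitive_root_def)
  let ?p = "monom 1 n - 1 :: 'k poly"
  have p: "?p \<noteq> 0" "degree ?p \<le> n"
    using n by (auto simp: monom_eq_1_iff intro!: degree_diff_le degree_monom_le)
  have fin: "finite {z. poly ?p z = 0}" using poly_roots_finite[OF p(1)] .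
  have "(\<lambda>i. q ^ i) ` {..<n} \<subseteq> {z. poly ?p z = 0}"
  proof (rule image_subsetI)
    fix i
    have "(q ^ i) ^ n = (q ^ n) ^ i" by (simp only: power_mult[symmetric] mult.commute)
    then show "q ^ i \<in> {z. poly ?p z = 0}" by (simp add: poly_monom qn)
  qed
  moreover have "card {z. poly ?p z = 0} \<le> card ((\<lambda>i. q ^ i) ` {..<n})"
    using card_image[OF inj] card_poly_roots_bound[OF p(1)] p(2) by simp
  ultimately have "(\<lambda>i. q ^ i) ` {..<n} = {z. poly ?p z = 0}" using fin by (intro card_subset_eq) (auto intro: card_mono le_antisym)
  moreover have "z \<in> {z. poly ?p z = 0}" using assms(2) by (simp add: poly_monom)
  ultimately show ?thesis by auto
qed

section \<open>The operators \<open>\<xi>\<close> and \<open>\<eta>\<close> on the eigenspaces of \<open>A\<close>\<close>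

text \<open>
  An irreducible module on which \<open>A\<^sup>n, B, C\<close> are the scalars \<open>\<gamma>\<^sub>1,
  \<gamma>\<^sub>2, \<gamma>\<^sub>3\<close>, with a chosen \<open>n\<close>-th root \<open>\<rho>\<close> of
  \<open>\<gamma>\<^sub>1\<close>.
\<close>

locale H_central = H_operators +
  fixes \<gamma>\<^sub>1 \<gamma>\<^sub>2 \<gamma>\<^sub>3 \<rho> :: 'a
  assumes \<gamma>: "\<gamma>\<^sub>1 \<noteq> 0" "\<gamma>\<^sub>2 \<noteq> 0" "\<gamma>\<^sub>3 \<noteq> 0"
    and An: "(A ^^ n) v = scale \<gamma>\<^sub>1 v" and Bs: "B v = scale \<gamma>\<^sub>2 v" and Cs: "C v = scale \<gamma>\<^sub>3 v"
    and \<rho>: "\<rho> ^ n = \<gamma>\<^sub>1"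
begin

text \<open>
  The commutation factor of \<open>\<eta>\<close> past \<open>\<xi>\<close>, and its inverse.
\<close>

definition "w = inverse q ^ n\<^sub>1"

definition "p = q ^ n\<^sub>1"

text \<open>
  The scalars by which \<open>\<xi>\<^sup>n\<close> and \<open>\<eta>\<^sup>n\<close> act.
\<close>

definition "Xc = \<beta>\<^sub>1 * (\<gamma>\<^sub>1 ^ n\<^sub>1 - \<gamma>\<^sub>2 ^ n)"

definition "Yc = \<beta>\<^sub>2 * (\<gamma>\<^sub>1 ^ n\<^sub>1 - \<gamma>\<^sub>3 ^ n)"

lemma wp: "w * p = 1" "p * w = 1" "w \<noteq> 0" "p \<noteq> 0" "p = inverse w"
  using q_root by (auto simp: w_def p_def power_inverse)

lemma \<rho>0: "\<rho> \<noteq> 0"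
  using \<rho> \<gamma> n0 by (auto simp: power_0_left)

lemma funpow_scalar: "(\<And>v. L v = scale c v) \<Longrightarrow> (L ^^ i) v = scale (c ^ i) v"
  by (induction i) (auto simp: mult.commute)

lemma A_nn1: "(A ^^ (n * n\<^sub>1)) v = scale (\<gamma>\<^sub>1 ^ n\<^sub>1) v"
  using funpow_scalar[of "A ^^ n" \<gamma>\<^sub>1, OF An, of n\<^sub>1] by (simp add: funpow_mult mult.commute)

lemma Xn_scalar: "(\<xi> ^^ n) v = scale Xc v"
  by (simp add: Xn A_nn1 funpow_scalar[OF Bs] Xc_def flip: scale_left_diff_distrib)

lemma Yn_scalar: "(\<eta> ^^ n) v = scale Yc v"
  by (simp add: Yn A_nn1 funpow_scalar[OF Cs] Yc_def flip: scale_left_diff_distrib)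

text \<open>
  The eigenspaces of \<open>A\<close>.
\<close>

definition "eig \<nu> = {v. A v = scale \<nu> v}"

lemma eigD: "v \<in> eig \<nu> \<Longrightarrow> A v = scale \<nu> v"
  by (simp add: eig_def)

lemma subspace_eig: "subspace (eig \<nu>)"
  by (auto simp: subspace_def eig_def hom_add hom_scale module_hom.zero[OF hom(1)] scale_right_distrib mult.commute)

lemma eig_pow: "v \<in> eig \<nu> \<Longrightarrow> (A ^^ i) v = scale (\<nu> ^ i) v"
  by (induction i) (auto simp: hom_scale eigD mult.commute)

lemma eigenvalue:
  assumes "v \<in> eig \<nu>" "v \<noteq> 0"
  obtains i where "i < n" "\<nu> = \<rho> * q ^ i"
proof -
  have "scale (\<nu> ^ n) v = scale \<gamma>\<^sub>1 v" using eig_pow[OF assms(1)] An by metis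
  then have "\<nu> ^ n = \<gamma>\<^sub>1" using assms(2) by simp
  then have "(\<nu> / \<rho>) ^ n = 1" using \<rho> \<gamma> by (simp add: power_divide)
  from roots_of_unity[OF root this] obtain i where "i < n" "\<nu> / \<rho> = q ^ i" by blast
  then show ?thesis using that[of i] \<rho>0 by (simp add: field_simps)
qed

lemma eig_X: "v \<in> eig \<nu> \<Longrightarrow> \<xi> v \<in> eig (\<nu> * inverse q)"
proof -
  assume "v \<in> eig \<nu>"
  then have "scale \<nu> (\<xi> v) = scale q (A (\<xi> v))" using XA[of v] by (simp add: eigD hom_scale)
  then have "scale (inverse q) (scale \<nu> (\<xi> v)) = A (\<xi> v)" using q_root by simp
  then show ?thesis by (simp add: eig_def mult.commute)
qed

lemma eig_Y: "v \<in> eig \<nu> \<Longrightarrow> \<eta> v \<in> eig (\<nu> * q)"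
proof -
  assume "v \<in> eig \<nu>"
  then have "scale \<nu> (\<eta> v) = scale (inverse q) (A (\<eta> v))" using YA[of v] by (simp add: eigD hom_scale)
  then have "scale q (scale \<nu> (\<eta> v)) = A (\<eta> v)" using q_root by simp
  then show ?thesis by (simp add: eig_def mult.commute)
qed

lemma eig_Xpow: "v \<in> eig \<nu> \<Longrightarrow> (\<xi> ^^ j) v \<in> eig (\<nu> * inverse q ^ j)"
proof (induction j)
  case (Suc j)
  then have "\<xi> ((\<xi> ^^ j) v) \<in> eig (\<nu> * inverse q ^ j * inverse q)" by (intro eig_X)
  then show ?case by (simp add: mult_ac)
qed simp

lemma eig_Ypow: "v \<in> eig \<nu> \<Longrightarrow> (\<eta> ^^ j) v \<in> eig (\<nu> * q ^ j)"
proof (induction j)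
  case (Suc j)
  then have "\<eta> ((\<eta> ^^ j) v) \<in> eig (\<nu> * q ^ j * q)" by (intro eig_Y)
  then show ?case by (simp add: mult_ac)
qed simp

lemma YX_eig: "v \<in> eig \<nu> \<Longrightarrow> \<eta> (\<xi> v) = scale w (\<xi> (\<eta> v)) + scale (\<beta>\<^sub>3 * (\<nu> ^ (2 * n\<^sub>1) - \<gamma>\<^sub>2 * \<gamma>\<^sub>3)) v"
  by (simp add: YX eig_pow Bs Cs w_def flip: scale_left_diff_distrib)

text \<open>
  The constants \<open>\<beta> (1 + \<omega> + \<cdots> + \<omega>\<^bsup>j-1\<^esup>) (\<Lambda>
  \<omega>\<^bsup>j-1\<^esup> - \<gamma>\<^sub>2 \<gamma>\<^sub>3)\<close> that appear when \<open>\<eta>\<close> is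
  moved past \<open>\<xi>\<^sup>j\<close> (with \<open>\<omega> = w\<close>), or \<open>\<xi>\<close> past
  \<open>\<eta>\<^sup>j\<close> (with \<open>\<omega> = p\<close>). For \<open>j = 0\<close> the sum is empty, so the
  truncated exponent \<open>j - 1\<close> does not matter.
\<close>

definition sigma :: "'a \<Rightarrow> 'a \<Rightarrow> 'a \<Rightarrow> nat \<Rightarrow> 'a" where
  "sigma \<beta> \<omega> \<Lambda> j = (\<Sum>s<j. \<omega> ^ s) * \<beta> * (\<Lambda> * \<omega> ^ (j - 1) - \<gamma>\<^sub>2 * \<gamma>\<^sub>3)"

lemma sigma_0 [simp]: "sigma \<beta> \<omega> \<Lambda> 0 = 0"
  by (simp add: sigma_def)

lemma sigma_Suc: "sigma \<beta> \<omega> \<Lambda> (Suc j) = \<omega> * sigma \<beta> \<omega> \<Lambda> j + \<beta> * (\<Lambda> * \<omega> ^ (2 * j) - \<gamma>\<^sub>2 * \<gamma>\<^sub>3)"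
proof (cases j)
  case (Suc k)
  have 1: "(\<Sum>s<Suc j. \<omega> ^ s) = 1 + \<omega> * (\<Sum>s<j. \<omega> ^ s)"
    by (simp only: sum.lessThan_Suc_shift sum_distrib_left power_0 power_Suc)
  have 2: "(\<Sum>s<Suc j. \<omega> ^ s) = (\<Sum>s<j. \<omega> ^ s) + \<omega> ^ j" by simp
  have "sigma \<beta> \<omega> \<Lambda> (Suc j) = (\<Sum>s<Suc j. \<omega> ^ s) * (\<beta> * \<Lambda> * \<omega> ^ j) - (\<Sum>s<Suc j. \<omega> ^ s) * (\<beta> * (\<gamma>\<^sub>2 * \<gamma>\<^sub>3))"
    by (simp add: sigma_def algebra_simps)
  also have "\<dots> = ((\<Sum>s<j. \<omega> ^ s) + \<omega> ^ j) * (\<beta> * \<Lambda> * \<omega> ^ j) - (1 + \<omega> * (\<Sum>s<j. \<omega> ^ s)) * (\<beta> * (\<gamma>\<^sub>2 * \<gamma>\<^sub>3))"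
    unfolding 1[symmetric] unfolding 2 ..
  also have "\<dots> = \<omega> * ((\<Sum>s<j. \<omega> ^ s) * \<beta> * (\<Lambda> * \<omega> ^ k - \<gamma>\<^sub>2 * \<gamma>\<^sub>3)) + \<beta> * (\<Lambda> * \<omega> ^ (2 * j) - \<gamma>\<^sub>2 * \<gamma>\<^sub>3)"
    unfolding Suc mult_2 power_add power_Suc by (simp add: algebra_simps del: sum.lessThan_Suc)
  finally show ?thesis by (simp add: sigma_def Suc del: sum.lessThan_Suc)
qed (simp add: sigma_def)

lemma Y_Xpow:
  assumes v: "v \<in> eig \<nu>"
  shows "\<eta> ((\<xi> ^^ j) v) = scale (w ^ j) ((\<xi> ^^ j) (\<eta> v)) + scale (sigma \<beta>\<^sub>3 w (\<nu> ^ (2 * n\<^sub>1)) j) ((\<xi> ^^ (j - 1)) v)"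
proof (induction j)
  case (Suc j)
  have pow: "(\<nu> * inverse q ^ j) ^ (2 * n\<^sub>1) = \<nu> ^ (2 * n\<^sub>1) * w ^ (2 * j)"
    by (simp add: w_def power_mult_distrib mult_ac flip: power_mult)
  have s: "scale (sigma \<beta>\<^sub>3 w (\<nu> ^ (2 * n\<^sub>1)) j) (\<xi> ((\<xi> ^^ (j - 1)) v)) = scale (sigma \<beta>\<^sub>3 w (\<nu> ^ (2 * n\<^sub>1)) j) ((\<xi> ^^ j) v)"
    by (cases j) auto
  have "\<eta> ((\<xi> ^^ Suc j) v) = scale w (\<xi> (\<eta> ((\<xi> ^^ j) v))) + scale (\<beta>\<^sub>3 * (\<nu> ^ (2 * n\<^sub>1) * w ^ (2 * j) - \<gamma>\<^sub>2 * \<gamma>\<^sub>3)) ((\<xi> ^^ j) v)"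
    using YX_eig[OF eig_Xpow[OF v], of j] by (simp add: pow)
  also have "\<xi> (\<eta> ((\<xi> ^^ j) v)) = scale (w ^ j) (\<xi> ((\<xi> ^^ j) (\<eta> v))) + scale (sigma \<beta>\<^sub>3 w (\<nu> ^ (2 * n\<^sub>1)) j) ((\<xi> ^^ j) v)"
    by (simp only: Suc hom_add hom_scale s)
  finally show ?case by (simp add: sigma_Suc scale_right_distrib scale_left_distrib)
qed simp

lemma XY_eig:
  assumes "v \<in> eig \<nu>"
  shows "\<xi> (\<eta> v) = scale p (\<eta> (\<xi> v)) + scale (- p * \<beta>\<^sub>3 * (\<nu> ^ (2 * n\<^sub>1) - \<gamma>\<^sub>2 * \<gamma>\<^sub>3)) v"
  by (simp add: YX_eig[OF assms] scale_right_distrib wp scale_minus_left mult.assoc)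

lemma X_Ypow:
  assumes v: "v \<in> eig \<nu>"
  shows "\<xi> ((\<eta> ^^ j) v) = scale (p ^ j) ((\<eta> ^^ j) (\<xi> v)) + scale (sigma (- p * \<beta>\<^sub>3) p (\<nu> ^ (2 * n\<^sub>1)) j) ((\<eta> ^^ (j - 1)) v)"
proof (induction j)
  case (Suc j)
  let ?s = "sigma (- p * \<beta>\<^sub>3) p (\<nu> ^ (2 * n\<^sub>1)) j"
  have pow: "(\<nu> * q ^ j) ^ (2 * n\<^sub>1) = \<nu> ^ (2 * n\<^sub>1) * p ^ (2 * j)"
    by (simp add: p_def power_mult_distrib mult_ac flip: power_mult)
  have s: "scale ?s (\<eta> ((\<eta> ^^ (j - 1)) v)) = scale ?s ((\<eta> ^^ j) v)"
    by (cases j) auto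
  have "\<xi> ((\<eta> ^^ Suc j) v) = scale p (\<eta> (\<xi> ((\<eta> ^^ j) v))) + scale (- p * \<beta>\<^sub>3 * (\<nu> ^ (2 * n\<^sub>1) * p ^ (2 * j) - \<gamma>\<^sub>2 * \<gamma>\<^sub>3)) ((\<eta> ^^ j) v)"
    using XY_eig[OF eig_Ypow[OF v], of j] by (simp add: pow)
  also have "\<eta> (\<xi> ((\<eta> ^^ j) v)) = scale (p ^ j) (\<eta> ((\<eta> ^^ j) (\<xi> v))) + scale ?s ((\<eta> ^^ j) v)"
    by (simp only: Suc hom_add hom_scale s)
  finally show ?case by (simp add: sigma_Suc scale_right_distrib scale_left_distrib scale_left_diff_distrib)
qed simp

section \<open>Bases of eigenvectors\<close>

text \<open>
  The vectors \<open>m 0, \<dots>, m (d - 1)\<close> form a basis of the whole module. This is stated through the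
  coordinate map, which later carries the action to \<open>coords d\<close>.
\<close>

definition chain_basis :: "nat \<Rightarrow> (nat \<Rightarrow> 'b) \<Rightarrow> bool" where
  "chain_basis d m \<longleftrightarrow> (\<exists>f. bij_betw f UNIV (coords d) \<and> (\<forall>v v'. f (v + v') = f v + f v')
     \<and> (\<forall>c v. f (scale c v) = c *c f v) \<and> (\<forall>j<d. f (m j) = basis_vec j))"

text \<open>
  For vectors that are eigenvectors of \<open>A\<close>, closure of the span under \<open>\<xi>\<close> and
  \<open>\<eta>\<close> suffices, since \<open>B\<close> and \<open>C\<close> are scalars.
\<close>

lemma invariant_span:
  assumes eig: "\<And>s. s \<in> S \<Longrightarrow> \<exists>\<nu>. s \<in> eig \<nu>"
    and X: "\<And>s. s \<in> S \<Longrightarrow> \<xi> s \<in> span S" and Y: "\<And>s. s \<in> S \<Longrightarrow> \<eta> s \<in> span S"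
    and s0: "s \<in> S" "s \<noteq> 0"
  shows "span S = UNIV"
proof -
  have "span S = {0} \<or> span S = UNIV"
  proof (rule irreducible)
    fix g u assume g: "g \<in> gens" and u: "u \<in> span S"
    have closed: "L u \<in> span S" if "module_hom scale scale L" "\<And>s. s \<in> S \<Longrightarrow> L s \<in> span S" for L
    proof -
      interpret L: module_hom scale scale L by (rule that)
      have "span (L ` S) \<subseteq> span S" using that(2) by (intro span_minimal subspace_span) auto
      then show ?thesis using L.span_image[of S] u by auto
    qed
    have A: "A s \<in> span S" if "s \<in> S" for s using eig[OF that] span_scale[OF span_base[OF that]] by (auto simp: eig_def)
    have A': "A' s \<in> span S" if s: "s \<in> S" for s
    proof -
      obtain \<nu> where "A s = scale \<nu> s" using eig[OF s] by (auto simp: eig_def)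
      then have *: "s = scale \<nu> (A' s)" using inv(2)[of s] by (simp add: hom_scale)
      show ?thesis
      proof (cases "\<nu> = 0")
        case True
        then have "s = 0" using * by simp
        then show ?thesis using module_hom.zero[OF hom(2)] by (simp add: span_zero)
      next
        case False
        then have "A' s = scale (inverse \<nu>) s" by (subst (2) *) simp
        then show ?thesis using s by (auto intro: span_scale span_base)
      qed
    qed
    have "B' v = scale (inverse \<gamma>\<^sub>2) v" "C' v = scale (inverse \<gamma>\<^sub>3) v" for v
      using inv(3)[of v] inv(5)[of v] \<gamma> by (auto simp: Bs Cs) (metis scale_scale left_inverse scale_one)+
    then show "g u \<in> span S" using g u closed[OF hom(1) A] closed[OF hom(2) A'] closed[OF hom(7) X] closed[OF hom(8) Y]
      by (auto simp: Bs Cs intro: span_scale)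
  qed simp
  moreover have "s \<in> span S" using s0 by (simp add: span_base)
  ultimately show ?thesis using s0 by auto
qed

lemma chain_basisI:
  assumes d: "d > 0" and m0: "\<And>j. j < d \<Longrightarrow> m j \<noteq> 0"
    and eig: "\<And>j. j < d \<Longrightarrow> m j \<in> eig (\<nu> j)" and inj: "inj_on \<nu> {..<d}"
    and X: "\<And>j. j < d \<Longrightarrow> \<xi> (m j) \<in> span (m ` {..<d})"
    and Y: "\<And>j. j < d \<Longrightarrow> \<eta> (m j) \<in> span (m ` {..<d})"
  shows "chain_basis d m"
proof -
  define g where "g = (\<lambda>v. \<Sum>j<d. scale (v j) (m j))"
  have g_add: "g (v + v') = g v + g v'" for v v' by (simp add: g_def scale_left_distrib sum.distrib)
  have g_scale: "g (c *c v) = scale c (g v)" for c v by (simp add: g_def coord_scale_def scale_sum_right)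
  have g_basis: "g (basis_vec j) = m j" if "j < d" for j
  proof -
    have "g (basis_vec j) = (\<Sum>l<d. if l = j then m l else 0)" unfolding g_def by (intro sum.cong) (auto simp: basis_vec_def)
    then show ?thesis using that by simp
  qed
  have basis_coords: "basis_vec j \<in> coords d" if "j < d" for j using that by (auto simp: basis_vec_def coords_def)
  have coords: "v + v' \<in> coords d" "c *c v \<in> coords d" if "v \<in> coords d" "v' \<in> coords d" for v v' :: "nat \<Rightarrow> 'a" and c
    using that by (auto simp: coords_def coord_scale_def)
  have "0 \<in> (coords d :: (nat \<Rightarrow> 'a) set)" by (simp add: coords_def)
  then have sub: "subspace (g ` coords d)"
    unfolding subspace_def
  proof (intro conjI ballI allI)
    assume "0 \<in> (coords d :: (nat \<Rightarrow> 'a) set)"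
    moreover have "g 0 = 0" by (simp add: g_def)
    ultimately show "0 \<in> g ` coords d" by (metis imageI)
  next
    fix u v assume "u \<in> g ` coords d" "v \<in> g ` coords d"
    then obtain u' v' where "u = g u'" "v = g v'" "u' \<in> coords d" "v' \<in> coords d" by auto
    then show "u + v \<in> g ` coords d" using coords(1)[of u' v'] by (simp flip: g_add)
  next
    fix c v assume "v \<in> g ` coords d"
    then obtain v' where "v = g v'" "v' \<in> coords d" by auto
    then show "scale c v \<in> g ` coords d" using coords(2)[of v' v' c] by (simp flip: g_scale)
  qed
  have "span (m ` {..<d}) = UNIV"
    by (rule invariant_span[of _ "m 0"]) (use d m0 eig X Y in auto)
  moreover have "m ` {..<d} \<subseteq> g ` coords d" using g_basis basis_coords by force
  then have "span (m ` {..<d}) \<subseteq> g ` coords d" using sub by (rule span_minimal)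
  ultimately have surj: "g ` coords d = UNIV" by auto
  have indep: "\<forall>j<k. c j = 0" if "k \<le> d" "(\<Sum>j<k. scale (c j) (m j)) = 0" for k c
    using that
  proof (induction k arbitrary: c)
    case (Suc k)
    interpret A: module_hom scale scale A by (rule hom)
    have "A (\<Sum>j<Suc k. scale (c j) (m j)) = (\<Sum>j<Suc k. scale (\<nu> j * c j) (m j))"
      unfolding A.sum using Suc.prems eig by (intro sum.cong) (auto simp: A.scale eig_def mult.commute)
    then have "(\<Sum>j<Suc k. scale (\<nu> j * c j) (m j)) = 0" using Suc.prems(2) by simp
    moreover have "(\<Sum>j<Suc k. scale (\<nu> k * c j) (m j)) = 0"
      using arg_cong[OF Suc.prems(2), of "scale (\<nu> k)"] by (simp add: scale_sum_right scale_right_distrib)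
    ultimately have "(\<Sum>j<Suc k. scale (\<nu> j * c j) (m j)) - (\<Sum>j<Suc k. scale (\<nu> k * c j) (m j)) = 0" by simp
    then have "(\<Sum>j<Suc k. scale ((\<nu> j - \<nu> k) * c j) (m j)) = 0"
      unfolding sum_subtractf[symmetric] by (simp only: left_diff_distrib scale_left_diff_distrib)
    then have "(\<Sum>j<k. scale ((\<nu> j - \<nu> k) * c j) (m j)) = 0" by simp
    then have 1: "\<forall>j<k. (\<nu> j - \<nu> k) * c j = 0" using Suc.IH[of "\<lambda>j. (\<nu> j - \<nu> k) * c j"] Suc.prems(1) by simp
    have 2: "c j = 0" if "j < k" for j
    proof -
      have "\<nu> j \<noteq> \<nu> k" using inj_onD[OF inj, of j k] that Suc.prems(1) by auto
      then show ?thesis using 1 that by auto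
    qed
    then have "scale (c k) (m k) = 0" using Suc.prems(2) by simp
    then have "c k = 0" using m0[of k] Suc.prems(1) by auto
    then show ?case using 2 by (auto simp: less_Suc_eq)
  qed simp
  have "inj_on g (coords d)"
  proof (rule inj_onI)
    fix v v' assume v: "v \<in> coords d" "v' \<in> coords d" "g v = g v'"
    then have "(\<Sum>j<d. scale (v j - v' j) (m j)) = 0" by (simp add: g_def scale_left_diff_distrib sum_subtractf)
    then have "\<forall>j<d. v j - v' j = 0" using indep[of d "\<lambda>j. v j - v' j"] by simp
    then have "v j = v' j" for j using v by (cases "j < d") (auto simp: coords_def)
    then show "v = v'" by blast
  qed
  then have bij: "bij_betw g (coords d) UNIV" using surj by (simp add: bij_betw_def)
  define f where "f = inv_into (coords d) g"
  have f: "f (g v) = v" if "v \<in> coords d" for v unfolding f_def using bij that by (simp add: bij_betw_inv_into_left)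
  have gf: "g (f v) = v" "f v \<in> coords d" for v
    unfolding f_def using f_inv_into_f[of v g "coords d"] inv_into_into[of v g "coords d"] by (simp_all add: surj)
  have "bij_betw f UNIV (coords d)" unfolding f_def by (rule bij_betw_inv_into[OF bij])
  moreover have "f (v + v') = f v + f v'" for v v'
    using f[OF coords(1)[OF gf(2) gf(2)], of v v'] by (simp add: g_add gf)
  moreover have "f (scale c v) = c *c f v" for c v
    using f[OF coords(2)[OF gf(2) gf(2)], of c v] by (simp add: g_scale gf)
  moreover have "f (m j) = basis_vec j" if "j < d" for j
    using f[OF basis_coords[OF that]] by (simp add: g_basis that)
  ultimately show ?thesis unfolding chain_basis_def by blast
qed

end

context H_central
begin

section \<open>Structure constants and the three kinds of bases\<close>

lemma w_pow: "j \<le> n \<Longrightarrow> w ^ j = q ^ ((n - j) * n\<^sub>1)"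
proof -
  assume "j \<le> n"
  then have "(n - j) * n\<^sub>1 + j * n\<^sub>1 = n * n\<^sub>1" by (simp flip: add_mult_distrib)
  then have "q ^ ((n - j) * n\<^sub>1) * q ^ (j * n\<^sub>1) = (q ^ n) ^ n\<^sub>1" by (simp flip: power_add power_mult)
  moreover have "q ^ (j * n\<^sub>1) = p ^ j" by (simp add: p_def mult.commute flip: power_mult)
  ultimately have "q ^ ((n - j) * n\<^sub>1) * p ^ j * w ^ j = w ^ j" using q_root by simp
  then show ?thesis by (simp add: mult.assoc wp flip: power_mult_distrib)
qed

lemma powi_w: "q powi (- int (s * n\<^sub>1)) = w ^ s"
  by (simp add: w_def power_int_minus power_int_of_nat power_inverse mult.commute flip: power_mult del: of_nat_mult)

lemma powi_eig: "\<rho> * q powi (int i - int j) = \<rho> * q ^ i * inverse q ^ j"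
  using q_root by (simp add: power_int_diff power_inverse divide_inverse)

lemma inj_eig:
  assumes "c \<noteq> 0" "d \<le> n"
  shows "inj_on (\<lambda>j. c * q ^ j) {..<d}" "inj_on (\<lambda>j. c * inverse q ^ j) {..<d}"
  using primitive_root_inj[OF root] assms q_root by (auto simp: inj_on_def power_inverse)

lemma joint_eigenvector:
  assumes L: "module_hom scale scale L" and inv: "\<And>\<nu> v. v \<in> eig \<nu> \<Longrightarrow> L v \<in> eig \<nu>"
  obtains i v \<mu> where "i < n" "v \<in> eig (\<rho> * q ^ i)" "v \<noteq> 0" "L v = scale \<mu> v"
proof -
  obtain S where S: "finite S" "span S = UNIV" using finite_dimensional by blast
  obtain v0 :: 'b where "v0 \<noteq> 0" using nonzero by blast
  then obtain v \<nu> where v: "v \<noteq> 0" "A v = scale \<nu> v"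
    using eigenvector_in_subspace[OF hom(1) S subspace_UNIV, of v0] by auto
  then have "v \<in> eig \<nu>" by (simp add: eig_def)
  from eigenvalue[OF this v(1)] obtain i where i: "i < n" "\<nu> = \<rho> * q ^ i" .
  obtain u \<mu> where "u \<in> eig \<nu>" "u \<noteq> 0" "L u = scale \<mu> u"
    using eigenvector_in_subspace[OF L S subspace_eig inv \<open>v \<in> eig \<nu>\<close> v(1)] .
  with that i show ?thesis by blast
qed

lemma funpow_zero: "module_hom scale scale L \<Longrightarrow> (L ^^ i) 0 = 0"
  by (induction i) (auto simp: module_hom.zero)

lemma funpow_nonzero:
  assumes "module_hom scale scale L" "(L ^^ d) v \<noteq> 0" "j \<le> d"
  shows "(L ^^ j) v \<noteq> 0"
proof
  assume *: "(L ^^ j) v = 0"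
  have "(L ^^ d) v = (L ^^ (d - j)) ((L ^^ j) v)" using assms(3) by (simp flip: funpow_add comp_apply[of "L ^^ _"])
  then show False using assms * funpow_zero by simp
qed

lemma k_I_eq:
  assumes "1 \<le> j" "j \<le> n - 1"
  shows "H_beta.k_I n n\<^sub>1 q \<beta>\<^sub>1 \<beta>\<^sub>3 \<rho> \<gamma>\<^sub>1 \<gamma>\<^sub>2 \<gamma>\<^sub>3 i k\<^sub>1 (n - j + 1) = w ^ j * (Xc * k\<^sub>1) + sigma \<beta>\<^sub>3 w ((\<rho> * q ^ i) ^ (2 * n\<^sub>1)) j"
proof -
  have le: "j - 1 \<le> n" using assms by auto
  have 1: "q ^ ((2 * i + (n - j + 1)) * n\<^sub>1) = q ^ (2 * i * n\<^sub>1) * w ^ (j - 1)"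
  proof -
    have "n - j + 1 = n - (j - 1)" using assms by auto
    then show ?thesis unfolding w_pow[OF le] by (simp only: add_mult_distrib power_add)
  qed
  have 2: "(\<rho> * q ^ i) ^ (2 * n\<^sub>1) * w ^ (j - 1) = \<rho> ^ (2 * n\<^sub>1) * q ^ ((2 * i + (n - j + 1)) * n\<^sub>1)"
    unfolding 1 by (simp add: power_mult_distrib mult_ac flip: power_mult)
  have 3: "{0..n - (n - j + 1)} = {..<j}" using assms by auto
  have 4: "n - j + 1 \<noteq> 1" "n - j + 1 - 1 = n - j" using assms by auto
  have jn: "j \<le> n" using assms by simp
  show ?thesis
    unfolding H_beta.k_I_def 3 4 powi_w sigma_def 2 w_pow[OF jn]
    using 4 by (simp add: Xc_def sum_distrib_right sum_distrib_left mult_ac)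
qed

text \<open>
  With \<open>v\<close> an eigenvector of \<open>A\<close> and \<open>\<xi>\<eta>\<close>, say \<open>\<xi>\<eta>v =
  \<mu>v\<close>, the equation \<open>\<eta>v = k\<^sub>1 \<xi>\<^bsup>n-1\<^esup> v\<close> holds with
  \<open>k\<^sub>1 = \<mu> / Xc\<close>. The product condition expresses \<open>\<eta>\<^sup>n v = Yc v\<close>.
\<close>

lemma type_I:
  assumes "Xc \<noteq> 0"
  shows "\<exists>i m k\<^sub>1. i \<le> n - 1 \<and> chain_basis n m \<and>
    (let k = H_beta.k_I n n\<^sub>1 q \<beta>\<^sub>1 \<beta>\<^sub>3 \<rho> \<gamma>\<^sub>1 \<gamma>\<^sub>2 \<gamma>\<^sub>3 i k\<^sub>1 in
     (\<Prod>l = 1..n. k l) = (\<gamma>\<^sub>1 ^ n\<^sub>1 - \<gamma>\<^sub>3 ^ n) * \<beta>\<^sub>2 \<and>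
     (\<forall>j<n. A (m j) = scale (\<rho> * q powi (int i - int j)) (m j)) \<and>
     (\<forall>j<n - 1. \<xi> (m j) = m (j + 1)) \<and>
     \<xi> (m (n - 1)) = scale ((\<gamma>\<^sub>1 ^ n\<^sub>1 - \<gamma>\<^sub>2 ^ n) * \<beta>\<^sub>1) (m 0) \<and>
     (\<forall>j\<in>{1..n - 1}. \<eta> (m j) = scale (k (n - j + 1)) (m (j - 1))) \<and>
     \<eta> (m 0) = scale (k 1) (m (n - 1)))"
proof -
  have "module_hom scale scale (\<lambda>v. \<xi> (\<eta> v))" by (rule module_homI) (auto simp: hom_add hom_scale)
  moreover have "\<xi> (\<eta> v) \<in> eig \<nu>" if "v \<in> eig \<nu>" for v \<nu>
    using eig_X[OF eig_Y[OF that]] q_root by (simp add: mult.assoc)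
  ultimately obtain i v \<mu> where i: "i < n" and v: "v \<in> eig (\<rho> * q ^ i)" "v \<noteq> 0" and \<mu>: "\<xi> (\<eta> v) = scale \<mu> v"
    using joint_eigenvector by blast
  define m where "m = (\<lambda>j. (\<xi> ^^ j) v)"
  define k\<^sub>1 where "k\<^sub>1 = \<mu> / Xc"
  define k where "k = H_beta.k_I n n\<^sub>1 q \<beta>\<^sub>1 \<beta>\<^sub>3 \<rho> \<gamma>\<^sub>1 \<gamma>\<^sub>2 \<gamma>\<^sub>3 i k\<^sub>1"
  have n: "n = Suc (n - 1)" using n0 by simp
  have k1: "k 1 = k\<^sub>1" by (simp add: k_def H_beta.k_I_def)
  have Xn': "\<xi> (m (n - 1)) = scale Xc v"
    using Xn_scalar[of v] by (subst (asm) n) (simp add: m_def)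
  have "(\<xi> ^^ n) (\<eta> v) = (\<xi> ^^ (n - 1)) (\<xi> (\<eta> v))" by (subst n) (simp add: funpow_Suc_right del: funpow.simps)
  also have "\<dots> = scale \<mu> (m (n - 1))" by (simp add: \<mu> m_def funpow_scale[OF hom(7)])
  finally have "scale Xc (\<eta> v) = scale \<mu> (m (n - 1))" by (simp add: Xn_scalar)
  then have "scale (inverse Xc) (scale Xc (\<eta> v)) = scale (inverse Xc) (scale \<mu> (m (n - 1)))" by simp
  then have Y0: "\<eta> v = scale k\<^sub>1 (m (n - 1))" using assms by (simp add: k\<^sub>1_def field_simps)
  have Yj: "\<eta> (m j) = scale (k (n - j + 1)) (m (j - 1))" if j: "1 \<le> j" "j \<le> n - 1" for j
  proof -
    have "(\<xi> ^^ j) (m (n - 1)) = (\<xi> ^^ (j - 1)) (\<xi> (m (n - 1)))"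
      using j by (cases j) (auto simp: funpow_Suc_right simp del: funpow.simps)
    also have "\<dots> = scale Xc (m (j - 1))" unfolding Xn' by (simp add: m_def funpow_scale[OF hom(7)])
    finally have "(\<xi> ^^ j) (\<eta> v) = scale (Xc * k\<^sub>1) (m (j - 1))"
      by (simp add: Y0 funpow_scale[OF hom(7)] mult.commute)
    then show ?thesis
      using Y_Xpow[OF v(1), of j] k_I_eq[OF j, of i k\<^sub>1] by (simp add: m_def k_def scale_left_distrib)
  qed
  have nz: "m j \<noteq> 0" if "j < n" for j
    unfolding m_def using funpow_nonzero[OF hom(7), of n v j] that assms v(2) by (simp add: Xn_scalar)
  have eig: "m j \<in> eig (\<rho> * q ^ i * inverse q ^ j)" for j
    unfolding m_def by (rule eig_Xpow[OF v(1)])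
  have mem: "scale c (m j) \<in> span (m ` {..<n})" if "j < n" for c j
    using that by (intro span_scale span_base) auto
  have mXj: "\<xi> (m j) = m (j + 1)" for j by (simp add: m_def)
  have m0: "m 0 = v" by (simp add: m_def)
  have "chain_basis n m"
  proof (rule chain_basisI[OF n0 nz eig])
    show "inj_on (\<lambda>j. \<rho> * q ^ i * inverse q ^ j) {..<n}" using inj_eig(2)[of "\<rho> * q ^ i" n] \<rho>0 q_root by simp
    show "\<xi> (m j) \<in> span (m ` {..<n})" if "j < n" for j
    proof (cases "j = n - 1")
      case True
      then show ?thesis using Xn' mem[of 0 Xc] n0 m0 by simp
    next
      case False
      then show ?thesis using mem[of "j + 1" 1] that by (simp add: mXj)
    qed
    show "\<eta> (m j) \<in> span (m ` {..<n})" if "j < n" for j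
    proof (cases "j = 0")
      case True
      then show ?thesis using Y0 mem[of "n - 1" k\<^sub>1] n0 m0 by simp
    next
      case False
      then show ?thesis using Yj[of j] mem[of "j - 1" "k (n - j + 1)"] that by auto
    qed
  qed
  moreover have "(\<eta> ^^ j) v = scale (\<Prod>l = 1..j. k l) (m (n - j))" if "1 \<le> j" "j \<le> n" for j
    using that
  proof (induction j rule: dec_induct)
    case base
    then show ?case using k1 by (simp add: Y0)
  next
    case (step j)
    have "n - (n - j) + 1 = Suc j" "n - j - 1 = n - Suc j" using step by auto
    then have "\<eta> (m (n - j)) = scale (k (Suc j)) (m (n - Suc j))" using Yj[of "n - j"] step by auto
    then show ?case using step by (simp add: hom_scale mult.commute)
  qed
  from this[of n] have "scale Yc v = scale (\<Prod>l = 1..n. k l) v" using n0 by (simp add: Yn_scalar m0)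
  then have "(\<Prod>l = 1..n. k l) = Yc" using v(2) by simp
  ultimately show ?thesis
    using i Yj Xn' eig Y0 k1
    by (intro exI[of _ i] exI[of _ m] exI[of _ k\<^sub>1])
      (auto simp: Let_def k_def[symmetric] Yc_def Xc_def mult.commute mXj m0 k1 powi_eig dest: eigD)
qed

lemma k_II_eq:
  assumes "1 \<le> j" "j \<le> n - 1"
  shows "H_beta.k_II n n\<^sub>1 q \<beta>\<^sub>2 \<beta>\<^sub>3 \<rho> \<gamma>\<^sub>1 \<gamma>\<^sub>2 \<gamma>\<^sub>3 i k\<^sub>n j = p ^ j * (Yc * k\<^sub>n) + sigma (- p * \<beta>\<^sub>3) p ((\<rho> * q ^ i) ^ (2 * n\<^sub>1)) j"
proof -
  obtain l where l: "j = Suc l" using assms by (cases j) auto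
  have "p ^ l = q ^ (l * n\<^sub>1)" "(q ^ i) ^ (2 * n\<^sub>1) = q ^ (2 * i * n\<^sub>1)"
    by (simp_all add: p_def mult_ac flip: power_mult)
  moreover have "2 * i + j - 1 = 2 * i + l" by (simp add: l)
  ultimately have 2: "\<rho> ^ (2 * n\<^sub>1) * q ^ ((2 * i + j - 1) * n\<^sub>1) = (\<rho> * q ^ i) ^ (2 * n\<^sub>1) * p ^ (j - 1)"
    by (simp add: l power_mult_distrib add_mult_distrib power_add mult.assoc)
  have 3: "{0..j - 1} = {..<j}" using assms by auto
  have 4: "j \<noteq> n" using assms by auto
  have "p ^ j * (\<Sum>s<j. w ^ s) = (\<Sum>s<j. p ^ (j - s))"
  proof (unfold sum_distrib_left, rule sum.cong)
    fix s assume "s \<in> {..<j}"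
    then have "p ^ j = p ^ (j - s) * p ^ s" by (simp flip: power_add)
    then show "p ^ j * w ^ s = p ^ (j - s)" by (simp add: mult.assoc wp flip: power_mult_distrib)
  qed simp
  also have "\<dots> = (\<Sum>s<j. p ^ Suc s)"
    by (rule sum.reindex_bij_witness[of _ "\<lambda>s. j - Suc s" "\<lambda>s. j - Suc s"]) (auto simp: Suc_diff_Suc)
  also have "\<dots> = p * (\<Sum>s<j. p ^ s)" by (simp add: sum_distrib_left)
  finally have 5: "p ^ j * (\<Sum>s<j. w ^ s) = p * (\<Sum>s<j. p ^ s)" .
  have 6: "q ^ (j * n\<^sub>1) = p ^ j" by (simp add: p_def mult.commute flip: power_mult)
  have "H_beta.k_II n n\<^sub>1 q \<beta>\<^sub>2 \<beta>\<^sub>3 \<rho> \<gamma>\<^sub>1 \<gamma>\<^sub>2 \<gamma>\<^sub>3 i k\<^sub>n j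
    = p ^ j * (Yc * k\<^sub>n - (\<Sum>s<j. w ^ s) * \<beta>\<^sub>3 * ((\<rho> * q ^ i) ^ (2 * n\<^sub>1) * p ^ (j - 1) - \<gamma>\<^sub>2 * \<gamma>\<^sub>3))"
    unfolding H_beta.k_II_def 2 3 powi_w 6 using 4 by (simp add: Yc_def sum_distrib_right sum_distrib_left mult_ac)
  also have "\<dots> = p ^ j * (Yc * k\<^sub>n) - (p ^ j * (\<Sum>s<j. w ^ s)) * \<beta>\<^sub>3 * ((\<rho> * q ^ i) ^ (2 * n\<^sub>1) * p ^ (j - 1) - \<gamma>\<^sub>2 * \<gamma>\<^sub>3)"
    by (simp add: algebra_simps)
  also have "\<dots> = p ^ j * (Yc * k\<^sub>n) + sigma (- p * \<beta>\<^sub>3) p ((\<rho> * q ^ i) ^ (2 * n\<^sub>1)) j"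
    unfolding 5 sigma_def by (simp add: algebra_simps)
  finally show ?thesis .
qed

text \<open>
  The same argument with \<open>\<xi>\<close> and \<open>\<eta>\<close> exchanged; only \<open>\<eta>\<^sup>n \<noteq>
  0\<close> is needed.
\<close>

lemma type_II:
  assumes "Yc \<noteq> 0"
  shows "\<exists>i m k\<^sub>n. i \<le> n - 1 \<and> chain_basis n m \<and>
    (let k = H_beta.k_II n n\<^sub>1 q \<beta>\<^sub>2 \<beta>\<^sub>3 \<rho> \<gamma>\<^sub>1 \<gamma>\<^sub>2 \<gamma>\<^sub>3 i k\<^sub>n in
     (\<Prod>l = 1..n. k l) = (\<gamma>\<^sub>1 ^ n\<^sub>1 - \<gamma>\<^sub>2 ^ n) * \<beta>\<^sub>1 \<and>
     (\<forall>j<n. A (m j) = scale (\<rho> * q ^ (i + j)) (m j)) \<and>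
     (\<forall>j<n - 1. \<eta> (m j) = m (j + 1)) \<and>
     \<eta> (m (n - 1)) = scale ((\<gamma>\<^sub>1 ^ n\<^sub>1 - \<gamma>\<^sub>3 ^ n) * \<beta>\<^sub>2) (m 0) \<and>
     (\<forall>j\<in>{1..n - 1}. \<xi> (m j) = scale (k j) (m (j - 1))) \<and>
     \<xi> (m 0) = scale (k n) (m (n - 1)))"
proof -
  have "module_hom scale scale (\<lambda>v. \<eta> (\<xi> v))" by (rule module_homI) (auto simp: hom_add hom_scale)
  moreover have "\<eta> (\<xi> v) \<in> eig \<nu>" if "v \<in> eig \<nu>" for v \<nu>
    using eig_Y[OF eig_X[OF that]] q_root by (simp add: mult.assoc)
  ultimately obtain i v \<mu> where i: "i < n" and v: "v \<in> eig (\<rho> * q ^ i)" "v \<noteq> 0" and \<mu>: "\<eta> (\<xi> v) = scale \<mu> v"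
    using joint_eigenvector by blast
  define m where "m = (\<lambda>j. (\<eta> ^^ j) v)"
  define k\<^sub>n where "k\<^sub>n = \<mu> / Yc"
  define k where "k = H_beta.k_II n n\<^sub>1 q \<beta>\<^sub>2 \<beta>\<^sub>3 \<rho> \<gamma>\<^sub>1 \<gamma>\<^sub>2 \<gamma>\<^sub>3 i k\<^sub>n"
  have n: "n = Suc (n - 1)" using n0 by simp
  have kn: "k n = k\<^sub>n" by (simp add: k_def H_beta.k_II_def)
  have Yn': "\<eta> (m (n - 1)) = scale Yc v"
    using Yn_scalar[of v] by (subst (asm) n) (simp add: m_def)
  have "(\<eta> ^^ n) (\<xi> v) = (\<eta> ^^ (n - 1)) (\<eta> (\<xi> v))" by (subst n) (simp add: funpow_Suc_right del: funpow.simps)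
  also have "\<dots> = scale \<mu> (m (n - 1))" by (simp add: \<mu> m_def funpow_scale[OF hom(8)])
  finally have "scale Yc (\<xi> v) = scale \<mu> (m (n - 1))" by (simp add: Yn_scalar)
  then have "scale (inverse Yc) (scale Yc (\<xi> v)) = scale (inverse Yc) (scale \<mu> (m (n - 1)))" by simp
  then have X0: "\<xi> v = scale k\<^sub>n (m (n - 1))" using assms by (simp add: k\<^sub>n_def field_simps)
  have Xj: "\<xi> (m j) = scale (k j) (m (j - 1))" if j: "1 \<le> j" "j \<le> n - 1" for j
  proof -
    have "(\<eta> ^^ j) (m (n - 1)) = (\<eta> ^^ (j - 1)) (\<eta> (m (n - 1)))"
      using j by (cases j) (auto simp: funpow_Suc_right simp del: funpow.simps)
    also have "\<dots> = scale Yc (m (j - 1))" unfolding Yn' by (simp add: m_def funpow_scale[OF hom(8)])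
    finally have "(\<eta> ^^ j) (\<xi> v) = scale (Yc * k\<^sub>n) (m (j - 1))"
      by (simp add: X0 funpow_scale[OF hom(8)] mult.commute)
    then show ?thesis
      using X_Ypow[OF v(1), of j] k_II_eq[OF j, of i k\<^sub>n] by (simp add: m_def k_def scale_left_distrib)
  qed
  have nz: "m j \<noteq> 0" if "j < n" for j
    unfolding m_def using funpow_nonzero[OF hom(8), of n v j] that assms v(2) by (simp add: Yn_scalar)
  have eig: "m j \<in> eig (\<rho> * q ^ i * q ^ j)" for j
    unfolding m_def by (rule eig_Ypow[OF v(1)])
  have mem: "scale c (m j) \<in> span (m ` {..<n})" if "j < n" for c j
    using that by (intro span_scale span_base) auto
  have mYj: "\<eta> (m j) = m (j + 1)" for j by (simp add: m_def)
  have m0: "m 0 = v" by (simp add: m_def)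
  have "chain_basis n m"
  proof (rule chain_basisI[OF n0 nz eig])
    show "inj_on (\<lambda>j. \<rho> * q ^ i * q ^ j) {..<n}" using inj_eig(1)[of "\<rho> * q ^ i" n] \<rho>0 q_root by simp
    show "\<eta> (m j) \<in> span (m ` {..<n})" if "j < n" for j
    proof (cases "j = n - 1")
      case True
      then show ?thesis using Yn' mem[of 0 Yc] n0 m0 by simp
    next
      case False
      then show ?thesis using mem[of "j + 1" 1] that by (simp add: mYj)
    qed
    show "\<xi> (m j) \<in> span (m ` {..<n})" if "j < n" for j
    proof (cases "j = 0")
      case True
      then show ?thesis using X0 mem[of "n - 1" k\<^sub>n] n0 m0 by simp
    next
      case False
      then show ?thesis using Xj[of j] mem[of "j - 1" "k j"] that by auto
    qed
  qed
  moreover have "(\<xi> ^^ j) v = scale (\<Prod>l = n - j + 1..n. k l) (m (n - j))" if "1 \<le> j" "j \<le> n" for j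
    using that
  proof (induction j rule: dec_induct)
    case base
    then show ?case using n0 by (simp add: X0 kn)
  next
    case (step j)
    have "\<xi> (m (n - j)) = scale (k (n - j)) (m (n - Suc j))" using Xj[of "n - j"] step by auto
    moreover have "{n - Suc j + 1..n} = insert (n - j) {n - j + 1..n}" using step by auto
    ultimately show ?case using step by (simp add: hom_scale mult.commute)
  qed
  from this[of n] have "scale Xc v = scale (\<Prod>l = 1..n. k l) v" using n0 by (simp add: Xn_scalar m0)
  then have "(\<Prod>l = 1..n. k l) = Xc" using v(2) by simp
  ultimately show ?thesis
    using i Xj Yn' eig X0
    by (intro exI[of _ i] exI[of _ m] exI[of _ k\<^sub>n])
      (auto simp: Let_def k_def[symmetric] Yc_def Xc_def mult.commute mYj m0 kn power_add mult.left_commute dest: eigD)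
qed

text \<open>
  When \<open>\<xi>\<close> and \<open>\<eta>\<close> are nilpotent, start with an eigenvector of \<open>A\<close>
  killed by \<open>\<eta>\<close> and let \<open>d\<close> be least with \<open>\<xi>\<^sup>d v = 0\<close>. Then
  \<open>d\<close> is the first positive zero of \<open>sigma\<close>: applying \<open>\<eta>\<close> to
  \<open>\<xi>\<^sup>d v = 0\<close> gives a zero at \<open>d\<close>, and a zero at a smaller \<open>j\<close> would
  make \<open>\<xi>\<^sup>j v, \<dots>, \<xi>\<^bsup>d-1\<^esup> v\<close> span a proper submodule.
\<close>

lemma type_nilpotent:
  assumes X0: "Xc = 0" and Y0: "Yc = 0"
  obtains i d m where "i \<le> n - 1" "d > 0" "chain_basis d m"
    "\<And>j. j < d \<Longrightarrow> A (m j) = scale (\<rho> * q powi (int i - int j)) (m j)"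
    "\<And>j. j < d - 1 \<Longrightarrow> \<xi> (m j) = m (j + 1)" "\<xi> (m (d - 1)) = 0" "\<eta> (m 0) = 0"
    "\<And>l. 1 \<le> l \<Longrightarrow> \<eta> (m l) = scale (sigma \<beta>\<^sub>3 w ((\<rho> * q ^ i) ^ (2 * n\<^sub>1)) l) (m (l - 1))"
    "sigma \<beta>\<^sub>3 w ((\<rho> * q ^ i) ^ (2 * n\<^sub>1)) d = 0"
    "\<And>j. 0 < j \<Longrightarrow> j < d \<Longrightarrow> sigma \<beta>\<^sub>3 w ((\<rho> * q ^ i) ^ (2 * n\<^sub>1)) j \<noteq> 0"
proof -
  have "module_hom scale scale (\<lambda>v. v)" by (rule module_homI) auto
  then obtain i0 v0 \<mu> where v00: "v0 \<in> eig (\<rho> * q ^ i0)" "v0 \<noteq> 0"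
    using joint_eigenvector by blast
  define e where "e = (LEAST e. (\<eta> ^^ e) v0 = 0)"
  have "(\<eta> ^^ n) v0 = 0" by (simp add: Yn_scalar Y0)
  then have e: "(\<eta> ^^ e) v0 = 0" unfolding e_def by (rule LeastI)
  then have "e > 0" using v00 by (cases e) auto
  define v where "v = (\<eta> ^^ (e - 1)) v0"
  have v0: "v \<noteq> 0" unfolding v_def using not_less_Least[of "e - 1" "\<lambda>e. (\<eta> ^^ e) v0 = 0"] \<open>e > 0\<close> by (simp add: e_def)
  have ve: "v \<in> eig (\<rho> * q ^ i0 * q ^ (e - 1))" unfolding v_def by (rule eig_Ypow[OF v00(1)])
  obtain i where i: "i < n" and "\<rho> * q ^ i0 * q ^ (e - 1) = \<rho> * q ^ i" using eigenvalue[OF ve v0] .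
  then have v: "v \<in> eig (\<rho> * q ^ i)" using ve by metis
  have "e = Suc (e - 1)" using \<open>e > 0\<close> by simp
  then have Yv: "\<eta> v = 0" using e unfolding v_def by (metis funpow.simps(2) comp_apply)
  define d where "d = (LEAST d. (\<xi> ^^ d) v = 0)"
  have Xn0: "(\<xi> ^^ n) v = 0" by (simp add: Xn_scalar X0)
  then have d: "(\<xi> ^^ d) v = 0" unfolding d_def by (rule LeastI)
  have dn: "d \<le> n" unfolding d_def by (rule Least_le) (rule Xn0)
  have d0: "d > 0" using d v0 by (cases d) auto
  define m where "m = (\<lambda>j. (\<xi> ^^ j) v)"
  let ?s = "sigma \<beta>\<^sub>3 w ((\<rho> * q ^ i) ^ (2 * n\<^sub>1))"
  have nz: "m j \<noteq> 0" if "j < d" for j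
    unfolding m_def using not_less_Least[of j "\<lambda>d. (\<xi> ^^ d) v = 0"] that by (simp add: d_def)
  have eig: "m j \<in> eig (\<rho> * q ^ i * inverse q ^ j)" for j
    unfolding m_def by (rule eig_Xpow[OF v])
  have Yj: "\<eta> (m j) = scale (?s j) (m (j - 1))" for j
    using Y_Xpow[OF v, of j] by (simp add: m_def Yv funpow_zero[OF hom(7)])
  have mXj: "\<xi> (m j) = m (j + 1)" for j by (simp add: m_def)
  have md: "m d = 0" using d by (simp add: m_def)
  have "\<xi> (m (d - 1)) = m d" using d0 by (simp add: mXj)
  then have Xd: "\<xi> (m (d - 1)) = 0" using md by simp
  have Xspan: "\<xi> (m j) \<in> span (m ` {l..<d})" if "j < d" "l \<le> j" for j l
  proof (cases "j = d - 1")
    case True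
    then show ?thesis using Xd by (simp only: span_zero)
  next
    case False
    then show ?thesis using that by (auto simp: mXj intro!: span_base)
  qed
  have chain: "chain_basis d m"
  proof (rule chain_basisI[OF d0 nz eig])
    show "inj_on (\<lambda>j. \<rho> * q ^ i * inverse q ^ j) {..<d}" using inj_eig(2)[of "\<rho> * q ^ i" d] \<rho>0 q_root dn by simp
    show "\<xi> (m j) \<in> span (m ` {..<d})" if "j < d" for j
      using Xspan[OF that, of 0] by (simp add: atLeast0LessThan)
    show "\<eta> (m j) \<in> span (m ` {..<d})" if "j < d" for j
      unfolding Yj using that by (intro span_scale span_base) auto
  qed
  have "?s d = 0"
  proof -
    have "scale (?s d) (m (d - 1)) = 0" using Yj[of d] module_hom.zero[OF hom(8)] by (simp add: md)
    then show ?thesis using nz[of "d - 1"] d0 by simp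
  qed
  moreover have "?s j \<noteq> 0" if j: "0 < j" "j < d" for j
  proof
    assume s: "?s j = 0"
    \<comment> \<open>\<open>m j, \<dots>, m (d - 1)\<close> span an invariant subspace, in which the coordinate at \<open>m 0\<close> vanishes\<close>
    have "span (m ` {j..<d}) = UNIV"
    proof (rule invariant_span)
      show "m j \<in> m ` {j..<d}" "m j \<noteq> 0" using j nz by auto
    next
      fix u assume "u \<in> m ` {j..<d}"
      then obtain l where l: "u = m l" "j \<le> l" "l < d" by auto
      then show "\<exists>\<nu>. u \<in> eig \<nu>" using eig by blast
      show "\<xi> u \<in> span (m ` {j..<d})" using Xspan l by simp
      show "\<eta> u \<in> span (m ` {j..<d})"
      proof (cases "l = j")
        case True
        then show ?thesis using l s by (simp add: Yj span_zero)
      next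
        case False
        then show ?thesis unfolding l(1) Yj by (intro span_scale span_base imageI) (use l False in auto)
      qed
    qed
    moreover obtain f where f: "\<And>v v'. f (v + v') = f v + f v'" "\<And>c v. f (scale c v) = c *c f v" "\<And>j. j < d \<Longrightarrow> f (m j) = basis_vec j"
      using chain unfolding chain_basis_def by blast
    have "subspace {v. f v 0 = 0}"
      unfolding subspace_def using f(2)[of 0 0] by (auto simp: f(1,2) coord_scale_def)
    then have "span (m ` {j..<d}) \<subseteq> {v. f v 0 = 0}"
      by (intro span_minimal) (use j f(3) in \<open>auto simp: basis_vec_def\<close>)
    ultimately have "f (m 0) 0 = 0" by auto
    then show False using f(3)[OF d0] by (simp add: basis_vec_def)
  qed
  ultimately show ?thesis
    using that[of i d m] i d0 chain eigD[OF eig] Xd Yv Yj mXj by (auto simp: powi_eig m_def)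
qed

end

context H_central
begin

lemma powi_split: "q powi (int k + - int (s * n\<^sub>1)) = q ^ k * w ^ s"
proof -
  have "q powi (int k + - int (s * n\<^sub>1)) = q powi int k * q powi (- int (s * n\<^sub>1))"
    using q_root by (intro power_int_add) simp
  then show ?thesis unfolding powi_w power_int_of_nat .
qed

lemma k_r_eq:
  assumes "1 \<le> l"
  shows "H_beta.k_r n\<^sub>1 q \<beta>\<^sub>3 \<rho> \<gamma>\<^sub>2 \<gamma>\<^sub>3 i l = sigma \<beta>\<^sub>3 w ((\<rho> * q ^ i) ^ (2 * n\<^sub>1)) l"
proof -
  obtain l' where l: "l = Suc l'" using assms by (cases l) auto
  have "(2 * int i - int l + 1) * int n\<^sub>1 = int (2 * i * n\<^sub>1) - int (l' * n\<^sub>1)" by (simp add: l algebra_simps)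
  then have "q powi ((2 * int i - int l + 1) * int n\<^sub>1) = q powi (int (2 * i * n\<^sub>1) + - int (l' * n\<^sub>1))" by simp
  also have "\<dots> = q ^ (2 * i * n\<^sub>1) * w ^ l'"
    by (rule powi_split)
  also have "q ^ (2 * i * n\<^sub>1) = (q ^ i) ^ (2 * n\<^sub>1)" by (simp add: mult_ac flip: power_mult)
  finally have 2: "q powi ((2 * int i - int l + 1) * int n\<^sub>1) * \<rho> ^ (2 * n\<^sub>1) = (\<rho> * q ^ i) ^ (2 * n\<^sub>1) * w ^ (l - 1)"
    by (simp add: l power_mult_distrib)
  have 3: "{0..l - 1} = {..<l}" using assms by auto
  show ?thesis
    unfolding H_beta.k_r_def 2 3 powi_w sigma_def by (simp add: sum_distrib_right)
qed

text \<open>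
  If \<open>sigma\<close> does not vanish at \<open>1\<close>, then its first positive zero is \<open>r\<close>. For
  \<open>w \<noteq> 1\<close>, \<open>sigma\<close> vanishes at \<open>s > 0\<close> exactly if \<open>w\<^sup>s =
  1\<close> or \<open>s\<close> satisfies the equation \<open>P s\<close> in the definition of \<open>r\<close>. If
  \<open>P\<close> has a solution at all, then its least solution is at most the order of \<open>w\<close> by
  periodicity, so it is the first zero; otherwise the first zero is the order of \<open>w\<close>, which is that of
  \<open>q\<close> to the power \<open>n\<^sub>1\<close>.
\<close>

lemma r_eq:
  assumes ne: "\<beta>\<^sub>3 * (\<rho> ^ (2 * n\<^sub>1) * q ^ (2 * n\<^sub>1 * i) - \<gamma>\<^sub>2 * \<gamma>\<^sub>3) \<noteq> 0" and d: "d > 0"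
    and z: "sigma \<beta>\<^sub>3 w ((\<rho> * q ^ i) ^ (2 * n\<^sub>1)) d = 0"
    and nz: "\<And>j. 0 < j \<Longrightarrow> j < d \<Longrightarrow> sigma \<beta>\<^sub>3 w ((\<rho> * q ^ i) ^ (2 * n\<^sub>1)) j \<noteq> 0"
  shows "H_beta.r n\<^sub>1 q \<rho> \<gamma>\<^sub>2 \<gamma>\<^sub>3 i = d"
proof -
  define \<Lambda> where "\<Lambda> = (\<rho> * q ^ i) ^ (2 * n\<^sub>1)"
  define P where "P = (\<lambda>s. s > 0 \<and> \<Lambda> * w ^ (s - 1) = \<gamma>\<^sub>2 * \<gamma>\<^sub>3)"
  have \<Lambda>: "\<Lambda> = \<rho> ^ (2 * n\<^sub>1) * q ^ (2 * n\<^sub>1 * i)"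
    by (simp add: \<Lambda>_def power_mult_distrib mult_ac flip: power_mult)
  have b3: "\<beta>\<^sub>3 \<noteq> 0" "\<Lambda> \<noteq> \<gamma>\<^sub>2 * \<gamma>\<^sub>3" using ne by (auto simp: \<Lambda>)
  have P_eq: "(s > 0 \<and> q powi ((2 * int i - int s + 1) * int n\<^sub>1) = inverse (\<rho> ^ (2 * n\<^sub>1)) * \<gamma>\<^sub>2 * \<gamma>\<^sub>3) \<longleftrightarrow> P s" for s
  proof (cases s)
    case (Suc s')
    have "(2 * int i - int s + 1) * int n\<^sub>1 = int (2 * n\<^sub>1 * i) + - int (s' * n\<^sub>1)" by (simp add: Suc algebra_simps)
    then have "q powi ((2 * int i - int s + 1) * int n\<^sub>1) = q ^ (2 * n\<^sub>1 * i) * w ^ s'"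
      by (simp only: powi_split)
    then show ?thesis using \<rho>0 by (auto simp: P_def Suc \<Lambda> field_simps)
  qed (simp add: P_def)
  \<comment> \<open>for \<open>w = 1\<close> the geometric sum is \<open>d\<close>, which is nonzero in characteristic zero\<close>
  have w1: "w \<noteq> 1"
  proof
    assume "w = 1"
    then have "of_nat d * \<beta>\<^sub>3 * (\<Lambda> - \<gamma>\<^sub>2 * \<gamma>\<^sub>3) = 0" using z by (simp add: sigma_def \<Lambda>_def)
    then show False using b3 d by simp
  qed
  have sig: "sigma \<beta>\<^sub>3 w \<Lambda> s = 0 \<longleftrightarrow> w ^ s = 1 \<or> P s" if "s > 0" for s
  proof -
    have "(1 - w) * (\<Sum>j<s. w ^ j) = 1 - w ^ s" by (simp add: one_diff_power_eq)
    then have "(\<Sum>j<s. w ^ j) = 0 \<longleftrightarrow> w ^ s = 1" using w1 by (metis eq_iff_diff_eq_0 mult_eq_0_iff)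
    then show ?thesis using b3 that by (simp add: sigma_def P_def)
  qed
  have pw: "p ^ s = 1 \<longleftrightarrow> w ^ s = 1" for s by (simp add: wp(5) power_inverse)
  have d_zero: "w ^ d = 1 \<or> P d" using sig[OF d] z by (simp add: \<Lambda>_def)
  have small: "w ^ j \<noteq> 1 \<and> \<not> P j" if "0 < j" "j < d" for j
    using sig[OF that(1)] nz[OF that] by (simp add: \<Lambda>_def)
  show ?thesis
  proof (cases "\<exists>s. P s")
    case True
    have "P d"
    proof (rule ccontr)
      assume "\<not> P d"
      then have wd: "w ^ d = 1" using d_zero by simp
      obtain s where s: "P s" using True by blast
      let ?s = "(s - 1) mod d"
      have "s - 1 = d * ((s - 1) div d) + ?s" by simp
      then have "w ^ (s - 1) = (w ^ d) ^ ((s - 1) div d) * w ^ ?s" by (metis power_add power_mult)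
      then have "P (Suc ?s)" using s wd by (simp add: P_def)
      moreover have "?s < d" using d by simp
      ultimately show False using small[of "Suc ?s"] \<open>\<not> P d\<close> by (cases "Suc ?s = d") auto
    qed
    moreover have "P s \<Longrightarrow> d \<le> s" for s using small[of s] by (cases "d \<le> s") (auto simp: P_def)
    ultimately have "(LEAST s. P s) = d" by (rule Least_equality)
    then show ?thesis using True unfolding H_beta.r_def P_eq by (simp add: Let_def)
  next
    case False
    then have "w ^ d = 1" using d_zero by simp
    moreover have "d \<le> s" if "s > 0 \<and> w ^ s = 1" for s using small[of s] that by (cases "d \<le> s") auto
    ultimately have "H_beta.t n\<^sub>1 q = d"
      unfolding H_beta.t_def p_def[symmetric] pw by (intro Least_equality) (use d in auto)
    then show ?thesis using False unfolding H_beta.r_def P_eq by (simp add: Let_def)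
  qed
qed

lemma type_0_or_r:
  assumes "Xc = 0" "Yc = 0"
  shows "\<exists>i d m. i \<le> n - 1 \<and> chain_basis d m \<and>
    (\<forall>j<d. A (m j) = scale (\<rho> * q powi (int i - int j)) (m j)) \<and>
    (\<forall>j<d - 1. \<xi> (m j) = m (j + 1)) \<and> \<xi> (m (d - 1)) = 0 \<and> \<eta> (m 0) = 0 \<and>
    (\<forall>l\<in>{1..d - 1}. \<eta> (m l) = scale (H_beta.k_r n\<^sub>1 q \<beta>\<^sub>3 \<rho> \<gamma>\<^sub>2 \<gamma>\<^sub>3 i l) (m (l - 1))) \<and>
    d > 0 \<and>
    d = (if \<beta>\<^sub>3 * (\<rho> ^ (2 * n\<^sub>1) * q ^ (2 * n\<^sub>1 * i) - \<gamma>\<^sub>2 * \<gamma>\<^sub>3) = 0 then 1 else H_beta.r n\<^sub>1 q \<rho> \<gamma>\<^sub>2 \<gamma>\<^sub>3 i)"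
proof -
  show ?thesis
  proof (rule type_nilpotent[OF assms])
    fix i d m assume *: "i \<le> n - 1" "d > 0" "chain_basis d m"
      "\<And>j. j < d \<Longrightarrow> A (m j) = scale (\<rho> * q powi (int i - int j)) (m j)"
      "\<And>j. j < d - 1 \<Longrightarrow> \<xi> (m j) = m (j + 1)" "\<xi> (m (d - 1)) = 0" "\<eta> (m 0) = 0"
      and Y: "\<And>l. 1 \<le> l \<Longrightarrow> \<eta> (m l) = scale (sigma \<beta>\<^sub>3 w ((\<rho> * q ^ i) ^ (2 * n\<^sub>1)) l) (m (l - 1))"
      and z: "sigma \<beta>\<^sub>3 w ((\<rho> * q ^ i) ^ (2 * n\<^sub>1)) d = 0"
      and nz: "\<And>j. 0 < j \<Longrightarrow> j < d \<Longrightarrow> sigma \<beta>\<^sub>3 w ((\<rho> * q ^ i) ^ (2 * n\<^sub>1)) j \<noteq> 0"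
    have "\<beta>\<^sub>3 * (\<rho> ^ (2 * n\<^sub>1) * q ^ (2 * n\<^sub>1 * i) - \<gamma>\<^sub>2 * \<gamma>\<^sub>3) = sigma \<beta>\<^sub>3 w ((\<rho> * q ^ i) ^ (2 * n\<^sub>1)) 1"
      by (simp add: sigma_def power_mult_distrib mult_ac flip: power_mult)
    then have "d = 1" if "\<beta>\<^sub>3 * (\<rho> ^ (2 * n\<^sub>1) * q ^ (2 * n\<^sub>1 * i) - \<gamma>\<^sub>2 * \<gamma>\<^sub>3) = 0"
      using nz[of 1] *(2) that by (cases "1 < d") auto
    then have "d = (if \<beta>\<^sub>3 * (\<rho> ^ (2 * n\<^sub>1) * q ^ (2 * n\<^sub>1 * i) - \<gamma>\<^sub>2 * \<gamma>\<^sub>3) = 0 then 1 else H_beta.r n\<^sub>1 q \<rho> \<gamma>\<^sub>2 \<gamma>\<^sub>3 i)"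
      using r_eq[OF _ *(2) z nz] by auto
    moreover have "\<forall>l\<in>{1..d - 1}. \<eta> (m l) = scale (H_beta.k_r n\<^sub>1 q \<beta>\<^sub>3 \<rho> \<gamma>\<^sub>2 \<gamma>\<^sub>3 i l) (m (l - 1))"
      using Y k_r_eq by auto
    ultimately show ?thesis using * by blast
  qed
qed

end

section \<open>Transport to coordinate space\<close>

lemma vector_space_coord: "Vector_Spaces.vector_space ((*c) :: 'k::field \<Rightarrow> (nat \<Rightarrow> 'k) \<Rightarrow> (nat \<Rightarrow> 'k))"
  by unfold_locales (auto simp: coord_scale_def fun_eq_iff algebra_simps)

text \<open>
  A linear bijection onto \<open>coords d\<close> carries a module structure along.
\<close>

lemma transport_module:
  fixes scale :: "'k::field \<Rightarrow> 'm::ab_group_add \<Rightarrow> 'm"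
  assumes M: "left_module scale A \<iota> UNIV act"
    and f: "bij_betw f UNIV (coords d)" "\<And>v v'. f (v + v') = f v + f v'" "\<And>c v. f (scale c v) = c *c f v"
  obtains act' where "left_module (*c) A \<iota> (coords d) act'"
    and "module_isomorphic A scale UNIV act (*c) (coords d) act'"
    and "\<And>h v. act' h (f v) = f (act h v)"
proof -
  define act' where "act' = (\<lambda>h v. f (act h (inv_into UNIV f v)))"
  interpret left_module scale A \<iota> UNIV act by (rule M)
  have inj: "inj f" using f(1) by (simp add: bij_betw_def)
  then have act': "act' h (f v) = f (act h v)" for h v by (simp add: act'_def)
  have fin: "f v \<in> coords d" for v using f(1) by (auto simp: bij_betw_def)
  have ex: "\<exists>u. v = f u" if "v \<in> coords d" for v using f(1) that by (auto simp: bij_betw_def)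
  have iso: "module_isomorphic A scale UNIV act (*c) (coords d) act'"
    unfolding module_isomorphic_def using f act' by (intro exI[of _ f]) auto
  interpret C: Vector_Spaces.vector_space "(*c) :: 'k \<Rightarrow> (nat \<Rightarrow> 'k) \<Rightarrow> (nat \<Rightarrow> 'k)" by (rule vector_space_coord)
  have "left_module (*c) A \<iota> (coords d) act'"
  proof
    show "C.subspace (coords d)" by (auto simp: C.subspace_def coords_def coord_scale_def)
  next
    fix h and v :: "nat \<Rightarrow> 'k" assume "h \<in> carrier A" "v \<in> coords d"
    then show "act' h v \<in> coords d" by (auto simp: act'_def fin)
  next
    fix h and v u :: "nat \<Rightarrow> 'k" assume h: "h \<in> carrier A" and "v \<in> coords d" "u \<in> coords d"
    then obtain v' u' where "v = f v'" "u = f u'" using ex by metis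
    then show "act' h (v + u) = act' h v + act' h u" using h by (simp add: act' act_add flip: f(2))
  next
    fix h c and v :: "nat \<Rightarrow> 'k" assume h: "h \<in> carrier A" and "v \<in> coords d"
    then obtain v' where "v = f v'" using ex by metis
    then show "act' h (c *c v) = c *c act' h v" using h by (simp add: act' act_scale flip: f(3))
  next
    fix h h' and v :: "nat \<Rightarrow> 'k" assume h: "h \<in> carrier A" "h' \<in> carrier A" and "v \<in> coords d"
    then obtain v' where "v = f v'" using ex by metis
    then show "act' (h \<oplus>\<^bsub>A\<^esub> h') v = act' h v + act' h' v" "act' (h \<otimes>\<^bsub>A\<^esub> h') v = act' h (act' h' v)"
      using h by (simp_all add: act' add_act mult_act f(2))
  next
    fix v :: "nat \<Rightarrow> 'k" and c assume "v \<in> coords d"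
    then obtain v' where "v = f v'" using ex by metis
    then show "act' \<one>\<^bsub>A\<^esub> v = v" "act' (\<iota> c) v = c *c v" by (simp_all add: act' one_act scalar_act f(3))
  qed
  then show thesis using that iso act' by blast
qed

section \<open>Modules over \<open>H\<^sub>\<beta>\<close> as systems of operators\<close>

lemma ring_of_noncommutative_type: "ring (ring_of_type_algebra :: 'a::ring_1 ring)"
proof (intro ringI abelian_groupI monoidI)
  show "\<exists>y\<in>carrier ring_of_type_algebra. y \<oplus>\<^bsub>ring_of_type_algebra\<^esub> x = \<zero>\<^bsub>ring_of_type_algebra\<^esub>" for x :: 'a
    by (intro bexI[of _ "- x"]) (simp_all add: ring_of_type_algebra_def)
qed (simp_all add: ring_of_type_algebra_def algebra_simps)

context H_beta
begin

lemma ideal_relation_ideal: "ideal relation_ideal ring_of_type_algebra"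
  unfolding relation_ideal_def
  by (rule ring.genideal_ideal[OF ring_of_noncommutative_type]) (simp add: ring_of_type_algebra_def)

lemma cls_hom: "cls \<in> ring_hom ring_of_type_algebra H"
  unfolding H_def cls_def[abs_def] using ideal.rcos_ring_hom[OF ideal_relation_ideal] .

lemma cls_simps:
  "cls u \<in> carrier H" "cls (u + v) = cls u \<oplus>\<^bsub>H\<^esub> cls v" "cls (u * v) = cls u \<otimes>\<^bsub>H\<^esub> cls v" "cls 1 = \<one>\<^bsub>H\<^esub>"
  using cls_hom by (auto simp: ring_hom_def ring_of_type_algebra_def)

lemma carrier_H: "h \<in> carrier H \<Longrightarrow> \<exists>u. h = cls u"
  by (auto simp: H_def cls_def FactRing_def A_RCOSETS_def' ring_of_type_algebra_def)

lemma cls_relator: "u \<in> relators \<Longrightarrow> cls u = cls 0"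
proof -
  interpret ideal relation_ideal ring_of_type_algebra by (rule ideal_relation_ideal)
  assume "u \<in> relators"
  then have "u \<in> relation_ideal"
    unfolding relation_ideal_def
    using ring.genideal_self[OF ring_of_noncommutative_type, of relators] by (auto simp: ring_of_type_algebra_def)
  moreover have "0 \<in> relation_ideal" using additive_subgroup.zero_closed[OF is_additive_subgroup]
    by (simp add: ring_of_type_algebra_def)
  ultimately show ?thesis unfolding cls_def
    using a_coset_join2[OF _ a_subgroup] by (simp add: ring_of_type_algebra_def)
qed

end

lemma single_Word_Cons: "Poly_Mapping.single (Word (g # ls)) s = var g * Poly_Mapping.single (Word ls) s"
  by (simp add: var_def mult_single plus_word_def)

text \<open>
  An irreducible \<open>H\<^sub>\<beta>\<close>-module whose underlying space is a whole type.
\<close>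

locale H_module = H_beta n n\<^sub>1 q \<beta>\<^sub>1 \<beta>\<^sub>2 \<beta>\<^sub>3
  + irreducible_left_module scale "H_beta.H n n\<^sub>1 q \<beta>\<^sub>1 \<beta>\<^sub>2 \<beta>\<^sub>3" "H_beta.scalar n n\<^sub>1 q \<beta>\<^sub>1 \<beta>\<^sub>2 \<beta>\<^sub>3" UNIV act
  for n n\<^sub>1 :: nat and q \<beta>\<^sub>1 \<beta>\<^sub>2 \<beta>\<^sub>3 :: "'k::{alg_closed_field, field_char_0}"
    and scale :: "'k \<Rightarrow> 'm::ab_group_add \<Rightarrow> 'm" and act +
  assumes n2: "n \<ge> 2" and root: "primitive_root n q"
begin

text \<open>
  The action of the free algebra through its quotient \<open>H\<^sub>\<beta>\<close>.
\<close>

definition "op u = act (cls u)"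

lemma op_add: "op (u + u') v = op u v + op u' v"
  by (simp add: op_def cls_simps add_act)

lemma op_mult: "op (u * u') v = op u (op u' v)"
  by (simp add: op_def cls_simps mult_act)

lemma op_one: "op 1 v = v"
  by (simp add: op_def cls_simps one_act)

lemma op_const: "op (const s) v = scale s v"
  by (simp add: op_def scalar_def[symmetric] scalar_act)

lemma op_vec: "op u (v + v') = op u v + op u v'" "op u (scale s v) = scale s (op u v)"
  by (simp_all add: op_def cls_simps act_add act_scale)

lemma op_diff: "op (u - u') v = op u v - op u' v"
  using op_add[of "u - u'" u' v] by simp

lemma op_power: "op (u ^ k) v = (op u ^^ k) v"
  by (induction k arbitrary: v) (simp_all add: op_one op_mult)

lemma op_relator: "u \<in> relators \<Longrightarrow> op u v = 0"
  using op_diff[of 0 0 v] by (simp add: op_def cls_relator)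

text \<open>
  A subspace that is invariant under the generators is invariant under the whole algebra.
\<close>

lemma op_closed:
  assumes U: "subspace U" and gens: "\<And>g v. v \<in> U \<Longrightarrow> op (var g) v \<in> U" and v: "v \<in> U"
  shows "op u v \<in> U"
proof -
  have single: "op (Poly_Mapping.single w s) v \<in> U" for w s
  proof (cases w)
    case (Word ls)
    have "op (Poly_Mapping.single (Word ls) s) v \<in> U"
    proof (induction ls)
      case Nil
      then show ?case using op_const[of s v] U v by (simp add: const_def zero_word_def subspace_scale)
    next
      case (Cons g ls)
      then show ?case by (simp add: single_Word_Cons op_mult gens)
    qed
    then show ?thesis using Word by simp
  qed
  show ?thesis
  proof (induction u rule: update_induct)
    case const
    then show ?case using op_const[of 0 v] U by (simp add: const_def subspace_0)
  next
    case (update f k s)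
    have "Poly_Mapping.update k s f = f + Poly_Mapping.single k s"
      using update(1) by (intro poly_mapping_eqI) (auto simp: lookup_update lookup_add lookup_single in_keys_iff)
    then show ?case using U single update by (simp add: op_add subspace_add)
  qed
qed

text \<open>
  Each relator of \<open>H\<^sub>\<beta>\<close> acts as zero, which gives the relations between the operators.
\<close>

lemma H_operators_op:
  "H_operators scale n n\<^sub>1 q \<beta>\<^sub>1 \<beta>\<^sub>2 \<beta>\<^sub>3 (op (var Ga)) (op (var Ga')) (op (var Gb)) (op (var Gb'))
    (op (var Gc)) (op (var Gc')) (op (var Gx)) (op (var Gy))"
proof
  note rel = op_relator[unfolded relators_def Let_def]
  note ops = op_diff op_mult op_one op_const op_power
  show "n \<ge> 2" "primitive_root n q" using n2 root .
  fix v
  show "op (var Ga) (op (var Ga') v) = v" using rel[of "var Ga * var Ga' - 1" v] by (simp add: ops)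
  show "op (var Ga') (op (var Ga) v) = v" using rel[of "var Ga' * var Ga - 1" v] by (simp add: ops)
  show "op (var Gb) (op (var Gb') v) = v" using rel[of "var Gb * var Gb' - 1" v] by (simp add: ops)
  show "op (var Gb') (op (var Gb) v) = v" using rel[of "var Gb' * var Gb - 1" v] by (simp add: ops)
  show "op (var Gc) (op (var Gc') v) = v" using rel[of "var Gc * var Gc' - 1" v] by (simp add: ops)
  show "op (var Gc') (op (var Gc) v) = v" using rel[of "var Gc' * var Gc - 1" v] by (simp add: ops)
  show "op (var Gb) (op (var Ga) v) = op (var Ga) (op (var Gb) v)"
    using rel[of "var Ga * var Gb - var Gb * var Ga" v] by (simp add: ops)
  show "op (var Gc) (op (var Ga) v) = op (var Ga) (op (var Gc) v)"
    using rel[of "var Ga * var Gc - var Gc * var Ga" v] by (simp add: ops)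
  show "op (var Gc) (op (var Gb) v) = op (var Gb) (op (var Gc) v)"
    using rel[of "var Gb * var Gc - var Gc * var Gb" v] by (simp add: ops)
  show "op (var Gx) (op (var Gb) v) = op (var Gb) (op (var Gx) v)"
    using rel[of "var Gb * var Gx - var Gx * var Gb" v] by (simp add: ops)
  show "op (var Gx) (op (var Gc) v) = op (var Gc) (op (var Gx) v)"
    using rel[of "var Gc * var Gx - var Gx * var Gc" v] by (simp add: ops)
  show "op (var Gy) (op (var Gb) v) = op (var Gb) (op (var Gy) v)"
    using rel[of "var Gb * var Gy - var Gy * var Gb" v] by (simp add: ops)
  show "op (var Gy) (op (var Gc) v) = op (var Gc) (op (var Gy) v)"
    using rel[of "var Gc * var Gy - var Gy * var Gc" v] by (simp add: ops)
  show "op (var Gx) (op (var Ga) v) = scale q (op (var Ga) (op (var Gx) v))"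
    using rel[of "var Gx * var Ga - const q * var Ga * var Gx" v] by (simp add: ops)
  show "op (var Gy) (op (var Ga) v) = scale (inverse q) (op (var Ga) (op (var Gy) v))"
    using rel[of "var Gy * var Ga - const (inverse q) * var Ga * var Gy" v] by (simp add: ops)
  show "op (var Gy) (op (var Gx) v) = scale (inverse q ^ n\<^sub>1) (op (var Gx) (op (var Gy) v))
    + scale \<beta>\<^sub>3 ((op (var Ga) ^^ (2 * n\<^sub>1)) v - op (var Gb) (op (var Gc) v))"
    using rel[of "var Gy * var Gx - const (inverse q ^ n\<^sub>1) * var Gx * var Gy - const \<beta>\<^sub>3 * (var Ga ^ (2 * n\<^sub>1) - var Gb * var Gc)" v]
    by (simp add: ops diff_eq_eq add.commute)
  show "(op (var Gx) ^^ n) v = scale \<beta>\<^sub>1 ((op (var Ga) ^^ (n * n\<^sub>1)) v - (op (var Gb) ^^ n) v)"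
    using rel[of "var Gx ^ n - const \<beta>\<^sub>1 * (var Ga ^ (n * n\<^sub>1) - var Gb ^ n)" v] by (simp add: ops)
  show "(op (var Gy) ^^ n) v = scale \<beta>\<^sub>2 ((op (var Ga) ^^ (n * n\<^sub>1)) v - (op (var Gc) ^^ n) v)"
    using rel[of "var Gy ^ n - const \<beta>\<^sub>2 * (var Ga ^ (n * n\<^sub>1) - var Gc ^ n)" v] by (simp add: ops)
next
  show "\<exists>v::'m. v \<noteq> 0" using nontrivial by auto
next
  fix U
  assume U: "subspace U" and gens: "\<And>g u. g \<in> {op (var Ga), op (var Ga'), op (var Gb), op (var Gb'), op (var Gc),
    op (var Gc'), op (var Gx), op (var Gy)} \<Longrightarrow> u \<in> U \<Longrightarrow> g u \<in> U"
  have "op (var g) u \<in> U" if "u \<in> U" for g u using gens[OF _ that] by (cases g) auto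
  then have "act h u \<in> U" if "h \<in> carrier H" "u \<in> U" for h u
    using op_closed[OF U, of u] carrier_H[OF that(1)] that(2) by (auto simp: op_def)
  then have "submodule U" using U by (simp add: submodule_def)
  then show "U = {0} \<or> U = UNIV" by (rule irreducible)
qed (simp_all add: op_vec)

lemma classification:
  fixes nth_root :: "'k \<Rightarrow> 'k"
  assumes nth_root: "\<And>\<gamma>. \<gamma> \<noteq> 0 \<Longrightarrow> nth_root \<gamma> ^ n = \<gamma>"
  shows "\<exists>\<gamma>\<^sub>1 \<gamma>\<^sub>2 \<gamma>\<^sub>3 i V act'.
    \<gamma>\<^sub>1 \<noteq> 0 \<and> \<gamma>\<^sub>2 \<noteq> 0 \<and> \<gamma>\<^sub>3 \<noteq> 0 \<and> i \<le> n - 1 \<and>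
    (is_V_I (nth_root \<gamma>\<^sub>1) \<gamma>\<^sub>1 \<gamma>\<^sub>2 \<gamma>\<^sub>3 i V act' \<or> is_V_II (nth_root \<gamma>\<^sub>1) \<gamma>\<^sub>1 \<gamma>\<^sub>2 \<gamma>\<^sub>3 i V act' \<or>
     is_V_0 (nth_root \<gamma>\<^sub>1) \<gamma>\<^sub>1 \<gamma>\<^sub>2 \<gamma>\<^sub>3 i V act' \<or> is_V_r (nth_root \<gamma>\<^sub>1) \<gamma>\<^sub>1 \<gamma>\<^sub>2 \<gamma>\<^sub>3 i V act') \<and>
    module_isomorphic H scale UNIV act (*c) V act'"
proof -
  let ?A = "op (var Ga)" and ?A' = "op (var Ga')" and ?B = "op (var Gb)" and ?B' = "op (var Gb')"
    and ?C = "op (var Gc)" and ?C' = "op (var Gc')" and ?X = "op (var Gx)" and ?Y = "op (var Gy)"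
  obtain \<gamma>\<^sub>1 \<gamma>\<^sub>2 \<gamma>\<^sub>3 where \<gamma>: "\<gamma>\<^sub>1 \<noteq> 0" "\<gamma>\<^sub>2 \<noteq> 0" "\<gamma>\<^sub>3 \<noteq> 0"
    and scal: "\<And>v. (?A ^^ n) v = scale \<gamma>\<^sub>1 v" "\<And>v. ?B v = scale \<gamma>\<^sub>2 v" "\<And>v. ?C v = scale \<gamma>\<^sub>3 v"
    using H_operators.central_scalars[OF H_operators_op] by blast
  define \<rho> where "\<rho> = nth_root \<gamma>\<^sub>1"
  have "\<rho> ^ n = \<gamma>\<^sub>1" unfolding \<rho>_def using nth_root \<gamma> by blast
  then interpret O: H_central scale n n\<^sub>1 q \<beta>\<^sub>1 \<beta>\<^sub>2 \<beta>\<^sub>3 ?A ?A' ?B ?B' ?C ?C' ?X ?Y \<gamma>\<^sub>1 \<gamma>\<^sub>2 \<gamma>\<^sub>3 \<rho>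
    using H_operators_op \<gamma> scal by (intro H_central.intro H_central_axioms.intro)
  have M: "left_module scale H scalar UNIV act" by unfold_locales
  have X: "\<beta>\<^sub>1 * (\<gamma>\<^sub>1 ^ n\<^sub>1 - \<gamma>\<^sub>2 ^ n) = O.Xc" and Y: "\<beta>\<^sub>2 * (\<gamma>\<^sub>1 ^ n\<^sub>1 - \<gamma>\<^sub>3 ^ n) = O.Yc"
    by (simp_all add: O.Xc_def O.Yc_def)
  \<comment> \<open>a basis of \<open>M\<close> turns \<open>M\<close> into a module on \<open>coords d\<close> whose action on the standard basis is known\<close>
  have model: thesis
    if chain: "O.chain_basis d m" and
      *: "\<And>act' f. left_module (*c) H scalar (coords d) act' \<Longrightarrow> module_isomorphic H scale UNIV act (*c) (coords d) act' \<Longrightarrow>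
        \<forall>v\<in>coords d. act' b v = \<gamma>\<^sub>2 *c v \<Longrightarrow> \<forall>v\<in>coords d. act' c v = \<gamma>\<^sub>3 *c v \<Longrightarrow>
        (\<And>j. j < d \<Longrightarrow> f (m j) = basis_vec j) \<Longrightarrow> (\<And>c v. f (scale c v) = c *c f v) \<Longrightarrow> f 0 = 0 \<Longrightarrow>
        (\<And>j. j < d \<Longrightarrow> act' a (basis_vec j) = f (?A (m j))) \<Longrightarrow>
        (\<And>j. j < d \<Longrightarrow> act' x (basis_vec j) = f (?X (m j))) \<Longrightarrow>
        (\<And>j. j < d \<Longrightarrow> act' y (basis_vec j) = f (?Y (m j))) \<Longrightarrow> thesis"
    for d m thesis
  proof -
    obtain f where f: "bij_betw f UNIV (coords d)" "\<And>v v'. f (v + v') = f v + f v'" "\<And>c v. f (scale c v) = c *c f v"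
      and fm: "\<And>j. j < d \<Longrightarrow> f (m j) = basis_vec j"
      using chain unfolding O.chain_basis_def by blast
    obtain act' where tr: "left_module (*c) H scalar (coords d) act'" "module_isomorphic H scale UNIV act (*c) (coords d) act'"
      "\<And>h v. act' h (f v) = f (act h v)"
      by (rule transport_module[OF M f]) blast
    have basis: "act' h (basis_vec j) = f (act h (m j))" if "j < d" for h j
      using tr(3)[of h "m j"] fm[OF that] by simp
    have bc: "act' b v = \<gamma>\<^sub>2 *c v" "act' c v = \<gamma>\<^sub>3 *c v" if "v \<in> coords d" for v
    proof -
      have "v \<in> range f" using that f(1) by (simp add: bij_betw_def)
      then obtain u where "v = f u" by blast
      then show "act' b v = \<gamma>\<^sub>2 *c v" "act' c v = \<gamma>\<^sub>3 *c v"
        using tr(3)[of _ u] scal(2,3)[of u] f(3) by (simp_all add: op_def)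
    qed
    have "f 0 = 0" using f(2)[of 0 0] by simp
    then show thesis using *[of act' f] tr(1,2) bc fm f(3) basis by (auto simp: op_def)
  qed
  consider "O.Xc \<noteq> 0" | "O.Xc = 0" "O.Yc \<noteq> 0" | "O.Xc = 0" "O.Yc = 0" by blast
  then show ?thesis
  proof cases
    case 1
    obtain i m k\<^sub>1 where i: "i \<le> n - 1" and chain: "O.chain_basis n m" and
      k: "let k = k_I \<rho> \<gamma>\<^sub>1 \<gamma>\<^sub>2 \<gamma>\<^sub>3 i k\<^sub>1 in
       (\<Prod>l = 1..n. k l) = (\<gamma>\<^sub>1 ^ n\<^sub>1 - \<gamma>\<^sub>3 ^ n) * \<beta>\<^sub>2 \<and>
       (\<forall>j<n. ?A (m j) = scale (\<rho> * q powi (int i - int j)) (m j)) \<and>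
       (\<forall>j<n - 1. ?X (m j) = m (j + 1)) \<and>
       ?X (m (n - 1)) = scale ((\<gamma>\<^sub>1 ^ n\<^sub>1 - \<gamma>\<^sub>2 ^ n) * \<beta>\<^sub>1) (m 0) \<and>
       (\<forall>j\<in>{1..n - 1}. ?Y (m j) = scale (k (n - j + 1)) (m (j - 1))) \<and>
       ?Y (m 0) = scale (k 1) (m (n - 1))"
      using O.type_I[OF 1] by blast
    show ?thesis
    proof (rule model[OF chain])
      fix act' f
      assume L: "left_module (*c) H scalar (coords n) act'" and iso: "module_isomorphic H scale UNIV act (*c) (coords n) act'"
        and bc: "\<forall>v\<in>coords n. act' b v = \<gamma>\<^sub>2 *c v" "\<forall>v\<in>coords n. act' c v = \<gamma>\<^sub>3 *c v"
        and f: "\<And>j. j < n \<Longrightarrow> f (m j) = basis_vec j" "\<And>c v. f (scale c v) = c *c f v" "f 0 = 0"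
        and acts: "\<And>j. j < n \<Longrightarrow> act' a (basis_vec j) = f (?A (m j))" "\<And>j. j < n \<Longrightarrow> act' x (basis_vec j) = f (?X (m j))"
          "\<And>j. j < n \<Longrightarrow> act' y (basis_vec j) = f (?Y (m j))"
      have "is_V_I \<rho> \<gamma>\<^sub>1 \<gamma>\<^sub>2 \<gamma>\<^sub>3 i (coords n) act'"
        unfolding is_V_I_def using 1 L bc k n2
        by (intro conjI exI[of _ k\<^sub>1]) (auto simp: X Let_def acts f)
      then show ?thesis using \<gamma> i iso unfolding \<rho>_def by blast
    qed
  next
    case 2
    obtain i m k\<^sub>n where i: "i \<le> n - 1" and chain: "O.chain_basis n m" and
      k: "let k = k_II \<rho> \<gamma>\<^sub>1 \<gamma>\<^sub>2 \<gamma>\<^sub>3 i k\<^sub>n in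
       (\<Prod>l = 1..n. k l) = (\<gamma>\<^sub>1 ^ n\<^sub>1 - \<gamma>\<^sub>2 ^ n) * \<beta>\<^sub>1 \<and>
       (\<forall>j<n. ?A (m j) = scale (\<rho> * q ^ (i + j)) (m j)) \<and>
       (\<forall>j<n - 1. ?Y (m j) = m (j + 1)) \<and>
       ?Y (m (n - 1)) = scale ((\<gamma>\<^sub>1 ^ n\<^sub>1 - \<gamma>\<^sub>3 ^ n) * \<beta>\<^sub>2) (m 0) \<and>
       (\<forall>j\<in>{1..n - 1}. ?X (m j) = scale (k j) (m (j - 1))) \<and>
       ?X (m 0) = scale (k n) (m (n - 1))"
      using O.type_II[OF 2(2)] by blast
    show ?thesis
    proof (rule model[OF chain])
      fix act' f
      assume L: "left_module (*c) H scalar (coords n) act'" and iso: "module_isomorphic H scale UNIV act (*c) (coords n) act'"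
        and bc: "\<forall>v\<in>coords n. act' b v = \<gamma>\<^sub>2 *c v" "\<forall>v\<in>coords n. act' c v = \<gamma>\<^sub>3 *c v"
        and f: "\<And>j. j < n \<Longrightarrow> f (m j) = basis_vec j" "\<And>c v. f (scale c v) = c *c f v" "f 0 = 0"
        and acts: "\<And>j. j < n \<Longrightarrow> act' a (basis_vec j) = f (?A (m j))" "\<And>j. j < n \<Longrightarrow> act' x (basis_vec j) = f (?X (m j))"
          "\<And>j. j < n \<Longrightarrow> act' y (basis_vec j) = f (?Y (m j))"
      have "is_V_II \<rho> \<gamma>\<^sub>1 \<gamma>\<^sub>2 \<gamma>\<^sub>3 i (coords n) act'"
        unfolding is_V_II_def using 2 L bc k n2
        by (intro conjI exI[of _ k\<^sub>n]) (auto simp: X Y Let_def acts f)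
      then show ?thesis using \<gamma> i iso unfolding \<rho>_def by blast
    qed
  next
    case 3
    obtain i d m where i: "i \<le> n - 1" and chain: "O.chain_basis d m" and
      k: "\<forall>j<d. ?A (m j) = scale (\<rho> * q powi (int i - int j)) (m j)"
        "\<forall>j<d - 1. ?X (m j) = m (j + 1)" "?X (m (d - 1)) = 0" "?Y (m 0) = 0"
        "\<forall>l\<in>{1..d - 1}. ?Y (m l) = scale (k_r \<rho> \<gamma>\<^sub>2 \<gamma>\<^sub>3 i l) (m (l - 1))" and d0: "d > 0" and
      d: "d = (if \<beta>\<^sub>3 * (\<rho> ^ (2 * n\<^sub>1) * q ^ (2 * n\<^sub>1 * i) - \<gamma>\<^sub>2 * \<gamma>\<^sub>3) = 0 then 1 else r \<rho> \<gamma>\<^sub>2 \<gamma>\<^sub>3 i)"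
      using O.type_0_or_r[OF 3] by blast
    show ?thesis
    proof (rule model[OF chain])
      fix act' f
      assume L: "left_module (*c) H scalar (coords d) act'" and iso: "module_isomorphic H scale UNIV act (*c) (coords d) act'"
        and bc: "\<forall>v\<in>coords d. act' b v = \<gamma>\<^sub>2 *c v" "\<forall>v\<in>coords d. act' c v = \<gamma>\<^sub>3 *c v"
        and f: "\<And>j. j < d \<Longrightarrow> f (m j) = basis_vec j" "\<And>c v. f (scale c v) = c *c f v" "f 0 = 0"
        and acts: "\<And>j. j < d \<Longrightarrow> act' a (basis_vec j) = f (?A (m j))" "\<And>j. j < d \<Longrightarrow> act' x (basis_vec j) = f (?X (m j))"
          "\<And>j. j < d \<Longrightarrow> act' y (basis_vec j) = f (?Y (m j))"
      show ?thesis
      proof (cases "\<beta>\<^sub>3 * (\<rho> ^ (2 * n\<^sub>1) * q ^ (2 * n\<^sub>1 * i) - \<gamma>\<^sub>2 * \<gamma>\<^sub>3) = 0")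
        case True
        then have d1: "d = 1" using d by simp
        have "is_V_0 \<rho> \<gamma>\<^sub>1 \<gamma>\<^sub>2 \<gamma>\<^sub>3 i (coords d) act'"
          unfolding is_V_0_def X Y using 3 True L bc k by (auto simp: d1 acts f)
        then show ?thesis using \<gamma> i iso unfolding \<rho>_def by blast
      next
        case False
        then have dr: "r \<rho> \<gamma>\<^sub>2 \<gamma>\<^sub>3 i = d" using d by simp
        have "is_V_r \<rho> \<gamma>\<^sub>1 \<gamma>\<^sub>2 \<gamma>\<^sub>3 i (coords d) act'"
          unfolding is_V_r_def X Y Let_def dr using 3 False L bc k d0 by (auto simp: acts f)
        then show ?thesis using \<gamma> i iso unfolding \<rho>_def by blast
      qed
    qed
  qed
qed

end

theorem theorem4p5:
  fixes n n\<^sub>1 :: nat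
    and q \<beta>\<^sub>1 \<beta>\<^sub>2 \<beta>\<^sub>3 :: "'k::{alg_closed_field, field_char_0}"
    and nth_root :: "'k \<Rightarrow> 'k"
    and scale :: "'k \<Rightarrow> 'm::ab_group_add \<Rightarrow> 'm"
    and act :: "(word \<Rightarrow>\<^sub>0 'k) set \<Rightarrow> 'm \<Rightarrow> 'm"
  assumes "n \<ge> 2"
    and "primitive_root n q"
    and "1 \<le> n\<^sub>1" and "n\<^sub>1 \<le> n"
    and "\<not> 2 dvd gcd n n\<^sub>1"
    and "\<And>\<gamma>. \<gamma> \<noteq> 0 \<Longrightarrow> nth_root \<gamma> ^ n = \<gamma>"
    and "irreducible_left_module scale
           (H_beta.H n n\<^sub>1 q \<beta>\<^sub>1 \<beta>\<^sub>2 \<beta>\<^sub>3) (H_beta.scalar n n\<^sub>1 q \<beta>\<^sub>1 \<beta>\<^sub>2 \<beta>\<^sub>3) UNIV act"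
  shows "\<exists>\<gamma>\<^sub>1 \<gamma>\<^sub>2 \<gamma>\<^sub>3 i V act'.
    \<gamma>\<^sub>1 \<noteq> 0 \<and> \<gamma>\<^sub>2 \<noteq> 0 \<and> \<gamma>\<^sub>3 \<noteq> 0 \<and> i \<le> n - 1 \<and>
    (H_beta.is_V_I n n\<^sub>1 q \<beta>\<^sub>1 \<beta>\<^sub>2 \<beta>\<^sub>3 (nth_root \<gamma>\<^sub>1) \<gamma>\<^sub>1 \<gamma>\<^sub>2 \<gamma>\<^sub>3 i V act' \<or>
     H_beta.is_V_II n n\<^sub>1 q \<beta>\<^sub>1 \<beta>\<^sub>2 \<beta>\<^sub>3 (nth_root \<gamma>\<^sub>1) \<gamma>\<^sub>1 \<gamma>\<^sub>2 \<gamma>\<^sub>3 i V act' \<or>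
     H_beta.is_V_0 n n\<^sub>1 q \<beta>\<^sub>1 \<beta>\<^sub>2 \<beta>\<^sub>3 (nth_root \<gamma>\<^sub>1) \<gamma>\<^sub>1 \<gamma>\<^sub>2 \<gamma>\<^sub>3 i V act' \<or>
     H_beta.is_V_r n n\<^sub>1 q \<beta>\<^sub>1 \<beta>\<^sub>2 \<beta>\<^sub>3 (nth_root \<gamma>\<^sub>1) \<gamma>\<^sub>1 \<gamma>\<^sub>2 \<gamma>\<^sub>3 i V act') \<and>
    module_isomorphic (H_beta.H n n\<^sub>1 q \<beta>\<^sub>1 \<beta>\<^sub>2 \<beta>\<^sub>3) scale UNIV act coord_scale V act'"
proof -
  interpret H_module n n\<^sub>1 q \<beta>\<^sub>1 \<beta>\<^sub>2 \<beta>\<^sub>3 scale act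
    using assms(1,2,7) by (intro H_module.intro H_module_axioms.intro)
  show ?thesis using classification[of nth_root] assms(6) by blast
qed

end
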